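(* Let $p$ be an odd prime and $G=Q_{4p}$. (1) Every element of $\mathcal S(G)$ is $0$ or of the form $2^kp^\ell m$ with $\gcd(m,2p)=1$, where $k=0$ or $k\ge4$, and $\ell=0$ or $\ell\ge3$. (2) Every integer $2^kp^\ell m$ with $\gcd(m,2p)=1$, $\ell=0$ or $\ell\ge 3$, and $k\in\{0,4\}$ or $k\ge 6$, lies in $\mathcal S(G)$; so does every $2^5p^\ell m$ with $\gcd(m,2p)=1$ and $\ell=4$ or $\ell\ge 6$. (3) If $2^5m\in\mathcal S(G)$ with $\gcd(m,2p)=1$ then $|m|\ge \tfrac12(p^2+1)$, and $2^5\cdot\tfrac12(p^2+1)\in\mathcal S(G)$. (4) If $p\equiv 3\pmod 4$ and $2^5p^3m\in\mathcal S(G)$ or $2^5p^5m\in\mathcal S(G)$ with $\gcd(m,2p)=1$, then $|m|\ge\tfrac12(p^2+1)$; moreover, there are elements of $\mathcal S(G)$ of the forms $\pm 2^5p^3\cdot\tfrac12(p^2+1)$ and $\pm 2^5p^5\cdot\tfrac12(p^2+1)$. (5) If $p\equiv1\pmod 4$ then every integer multiple of $2^5p^5$ lies in $\mathcal S(G)$. (6) If $p=5$ then every integer multiple of $2^5p^3$ lies in $\mathcal S(G)$.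
   Context: For a finite group $G=\{g_1,\dots,g_N\}$ the group determinant $\mathscr D_G$ is the determinant of the $N\times N$ matrix with $(i,j)$ entry $x_{g_ig_j^{-1}}$, and $\mathcal S(G)$ is the set of its values when all $x_g\in\mathbb Z$. $Q_{4n}=\langle x,y : x^{2n}=1,\ y^2=x^n,\ xy=yx^{-1}\rangle$ is the dicyclic group of order $4n$. Equivalently, $\mathcal S(Q_{4n})=\{M_{Q_{4n}}(f+yg): f,g\in\mathbb Z[x]\}$ where $M_{Q_{4n}}(f+yg)=\prod_{z^{2n}=1}\big(f(z)f(z^{-1})-z^ng(z)g(z^{-1})\big)$. *)

theory Defs
  imports "HOL-Algebra.Group" "HOL-Combinatorics.Permutations" "HOL-Computational_Algebra.Primes"
begin

text \<open>Group determinant of a finite group G (Leibniz expansion of the matrix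
  with (g,h) entry x (g h^-1), indexed by the elements of G; the ordering of the
  elements does not affect the determinant).\<close>
definition group_det :: "('a, 'b) monoid_scheme \<Rightarrow> ('a \<Rightarrow> int) \<Rightarrow> int" where
  "group_det G x = (\<Sum>\<sigma> | \<sigma> permutes carrier G.
      sign \<sigma> * (\<Prod>g\<in>carrier G. x (g \<otimes>\<^bsub>G\<^esub> inv\<^bsub>G\<^esub> (\<sigma> g))))"

definition det_values :: "('a, 'b) monoid_scheme \<Rightarrow> int set" where
  "det_values G = {group_det G x | x. True}"

text \<open>dicyclic n is the dicyclic group Q_{4n} (order 4n) = <x,y | x^{2n}=1, y^2=x^n, xy=yx^{-1}>.
  The pair (a,b) with 0 <= a < 2n, b in {0,1} represents x^a y^b.
  Multiplication: x^a y^b x^c y^d = x^(a + (-1)^b c) y^(b+d), with y^2 = x^n.\<close>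
definition dicyclic :: "nat \<Rightarrow> (int \<times> int) monoid" where
  "dicyclic n = \<lparr> carrier = {0..<2 * int n} \<times> {0, 1},
     monoid.mult = (\<lambda>(a, b) (c, d).
        if b = 0 then ((a + c) mod (2 * int n), d)
        else if d = 0 then ((a - c) mod (2 * int n), 1)
        else ((a - c + int n) mod (2 * int n), 0)),
     monoid.one = (0, 0) \<rparr>"

end

(* Evaluating f + y g at the p-th roots of unity z and at -z turns the group determinant into
   a product of |f1(z)|^2 - |g1(z)|^2 and |f2(z)|^2 + |g2(z)|^2 over z^p = 1, where f1, g1, f2, g2 are
   integer combinations of powers of z subject only to f1 = f2 and g1 = g2 modulo 2.
   The factors with z <> 1 occur in conjugate pairs, so each product is its value at 1 times the
   square of an integer, the half norm, which modulo p is a power of the value at 1; the two half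
   norms agree modulo 2. This gives the divisibility conditions. For 2^5 the sum of squares at 1 is,
   up to a power of 2, an odd number W dividing m; either p divides one of its two squares, or the half
   norm B exceeds 1, is 1 or -1 modulo p, and B^2 divides m.
   Conversely, for real e and u with e - u suitably divisible one can choose f1, g1 with
   |f1|^2 - |g1|^2 = e u off 1, while adding a multiple of 1 + z + ... + z^(p-1) changes only the value
   at 1. Taking e and u to be products of cyclotomic units, all norms are 1 or powers of p and the
   value at 1 can be tuned freely. *)
theory Submission
  imports Defs Complex_Main "Jordan_Normal_Form.Char_Poly" "HOL-Number_Theory.Number_Theory"
begin

text \<open>Closure under multiplication reduces the existence claims to a short list of values:
  integers prime to 2p, some powers of 2, odd multiples of p^3, and a few multiples of 2^5. The
  exponent 5 is the obstacle. The parities alone force 2^4 into an even value; for exactly one more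
  2, the two squares at 1 must be odd after removal of a common factor 1 or 4, so that their sum
  becomes 2W. The bound (p^2+1)/2 is the least W for which one odd square is divisible by p^2. The
  freedom at 1 comes from the sums z^-t + ... + z^t. Such a sum and its alternating twin agree
  modulo 2 and have norm 1 off 1 if p does not divide 2t+1, but at 1 they are 2t+1 and 1 or -1.
  Powers of p come from z^-1 - z, of norm p and value 0 at 1, which is congruent modulo 2 to the
  unit z + z^-1. Galois theory is replaced by one orthogonality computation: an integer combination
  of powers that is constant off 1 takes there an integer value, congruent modulo p to its value at
  1.\<close>

section \<open>Factoring the group determinant by a Fourier transform on the cyclic subgroup\<close>

lemma group_det_eq_det:
  assumes e: "bij_betw e {0..<N} (carrier G)"
  shows "group_det G x = det (mat N N (\<lambda>(i, j). x (e i \<otimes>\<^bsub>G\<^esub> inv\<^bsub>G\<^esub> (e j))))"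
proof -
  let ?M = "mat N N (\<lambda>(i, j). x (e i \<otimes>\<^bsub>G\<^esub> inv\<^bsub>G\<^esub> (e j)))"
  let ?m = "map_permutation {0..<N} e"
  have inj: "inj_on e {0..<N}" and im: "e ` {0..<N} = carrier G"
    using e by (auto simp: bij_betw_def)
  have bij: "bij_betw ?m {\<pi>. \<pi> permutes {0..<N}} {\<sigma>. \<sigma> permutes carrier G}"
  proof -
    have "?m = (\<lambda>\<pi> x. if x \<in> carrier G then e (\<pi> (inv_into {0..<N} e x)) else x)"
      by (auto simp: fun_eq_iff map_permutation_def restrict_id_def im)
    thus ?thesis using bij_betw_permutations[OF e] by simp
  qed
  have "group_det G x = (\<Sum>\<pi> | \<pi> permutes {0..<N}. sign (?m \<pi>) *
      (\<Prod>g\<in>carrier G. x (g \<otimes>\<^bsub>G\<^esub> inv\<^bsub>G\<^esub> (?m \<pi> g))))"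
    unfolding group_det_def
    by (rule sum.reindex_bij_betw[OF bij, symmetric])
  also have "\<dots> = (\<Sum>\<pi> | \<pi> permutes {0..<N}. sign \<pi> * (\<Prod>i = 0..<N. ?M $$ (i, \<pi> i)))"
  proof (rule sum.cong[OF refl])
    fix \<pi> assume "\<pi> \<in> {\<pi>. \<pi> permutes {0..<N}}"
    hence p: "\<pi> permutes {0..<N}" by simp
    have "(\<Prod>g\<in>carrier G. x (g \<otimes>\<^bsub>G\<^esub> inv\<^bsub>G\<^esub> (?m \<pi> g)))
       = (\<Prod>i = 0..<N. x (e i \<otimes>\<^bsub>G\<^esub> inv\<^bsub>G\<^esub> (?m \<pi> (e i))))"
      by (rule prod.reindex_bij_betw[OF e, symmetric])
    also have "\<dots> = (\<Prod>i = 0..<N. ?M $$ (i, \<pi> i))"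
    proof (rule prod.cong[OF refl])
      fix i assume i: "i \<in> {0..<N}"
      have "\<pi> i \<in> {0..<N}" using permutes_in_image[OF p] i by blast
      thus "x (e i \<otimes>\<^bsub>G\<^esub> inv\<^bsub>G\<^esub> (?m \<pi> (e i))) = ?M $$ (i, \<pi> i)"
        using i map_permutation_apply[OF inj, of i \<pi>] by auto
    qed
    finally show "sign (?m \<pi>) * (\<Prod>g\<in>carrier G. x (g \<otimes>\<^bsub>G\<^esub> inv\<^bsub>G\<^esub> (?m \<pi> g))) =
       sign \<pi> * (\<Prod>i = 0..<N. ?M $$ (i, \<pi> i))"
      using sign_map_permutation[OF inj p] by simp
  qed
  also have "\<dots> = det ?M"
    by (subst det_def'[of _ N]) auto
  finally show ?thesis .
qed

text \<open>For s = 1 or -1 the map c -> b + s c permutes the residues modulo N, and j -> s (j - b)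
  undoes it since s * s = 1. Both signs occur: one type of block depends on a - c, the other on a +
  c.\<close>

lemma sum_periodic_reflect:
  fixes h :: "int \<Rightarrow> 'a :: comm_monoid_add"
  assumes per: "\<And>x. h (x mod int N) = h x" and N: "N > 0" and s: "s = 1 \<or> s = -1"
  shows "(\<Sum>c = 0..<N. h (b + s * int c)) = (\<Sum>c = 0..<N. h (int c))"
proof -
  have nat_int: "(\<Sum>c = 0..<N. k (int c)) = sum k {0..<int N}" for k :: "int \<Rightarrow> 'a"
    by (rule sum.reindex_bij_witness[of _ nat int]) auto
  have "(\<Sum>c\<in>{0..<int N}. h (b + s * c)) = (\<Sum>c\<in>{0..<int N}. h c)"
  proof (rule sum.reindex_bij_witness[of _ "\<lambda>j. (s * (j - b)) mod int N" "\<lambda>c. (b + s * c) mod int N"])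
    fix a assume a: "a \<in> {0..<int N}"
    have "(s * ((b + s * a) mod int N - b)) mod int N = (s * (b + s * a - b)) mod int N"
      by (metis mod_diff_left_eq mod_mult_right_eq)
    also have "s * (b + s * a - b) = a" using s by auto
    finally show "(s * ((b + s * a) mod int N - b)) mod int N = a" using a by simp
    have "(b + s * ((s * (a - b)) mod int N)) mod int N = (b + s * (s * (a - b))) mod int N"
      by (metis mod_add_right_eq mod_mult_right_eq)
    also have "b + s * (s * (a - b)) = a" using s by auto
    finally show "(b + s * ((s * (a - b)) mod int N)) mod int N = a" using a by simp
    show "h ((b + s * a) mod int N) = h (b + s * a)" by (rule per)
  qed (use N in auto)
  thus ?thesis using nat_int[of "\<lambda>c. h (b + s * c)"] nat_int[of h] by simp
qed

definition diag_fun :: "nat \<Rightarrow> (nat \<Rightarrow> 'a :: comm_ring_1) \<Rightarrow> 'a mat" where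
  "diag_fun N d = mat N N (\<lambda>(i, j). if i = j then d i else 0)"

lemma diag_fun_carrier [simp]: "diag_fun N d \<in> carrier_mat N N"
  by (simp add: diag_fun_def)

lemma mult_diag_fun:
  assumes "A \<in> carrier_mat N N"
  shows "A * diag_fun N d = mat N N (\<lambda>(i, j). A $$ (i, j) * d j)"
proof (rule eq_matI)
  fix i j assume "i < dim_row (mat N N (\<lambda>(i, j). A $$ (i, j) * d j))"
    "j < dim_col (mat N N (\<lambda>(i, j). A $$ (i, j) * d j))"
  hence ij: "i < N" "j < N" by auto
  have "(A * diag_fun N d) $$ (i, j) = (\<Sum>k = 0..<N. A $$ (i, k) * (if k = j then d k else 0))"
    using ij assms by (simp add: scalar_prod_def diag_fun_def)
  also have "\<dots> = (\<Sum>k = 0..<N. if k = j then A $$ (i, j) * d j else 0)"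
    by (rule sum.cong) auto
  also have "\<dots> = A $$ (i, j) * d j" using ij by simp
  finally show "(A * diag_fun N d) $$ (i, j) = mat N N (\<lambda>(i, j). A $$ (i, j) * d j) $$ (i, j)"
    using ij by simp
qed (use assms in \<open>auto simp: diag_fun_def\<close>)

lemma diag_fun_mult: "diag_fun N d * diag_fun N d' = diag_fun N (\<lambda>i. d i * d' i)"
  by (subst mult_diag_fun) (auto simp: diag_fun_def)

lemma det_diag_fun: "det (diag_fun N d) = (\<Prod>i<N. d i)"
proof -
  have "det (diag_fun N d) = prod_list (diag_mat (diag_fun N d))"
    by (rule det_upper_triangular[of _ N]) (auto simp: diag_fun_def)
  also have "diag_mat (diag_fun N d) = map d [0..<N]"
    by (auto simp: diag_mat_def diag_fun_def)
  also have "prod_list (map d [0..<N]) = (\<Prod>i<N. d i)"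
    by (simp add: prod.distinct_set_conv_list[symmetric] atLeast0LessThan)
  finally show ?thesis .
qed

locale root_of_unity =
  fixes N :: nat and w :: complex
  assumes N: "N > 0" and w: "w = cis (2 * pi / real N)"
begin

lemma w_nz [simp]: "w \<noteq> 0" by (simp add: w)

lemma w_pow_N: "w ^ N = 1"
  using N by (simp add: w DeMoivre)

lemma w_powi_N: "w powi (int N * k) = 1"
  by (simp add: power_int_mult w_pow_N)

lemma w_powi_mod: "w powi ((x mod int N) * k) = w powi (x * k)"
proof -
  have "x * k = (x mod int N) * k + int N * (x div int N * k)"
    by (metis add.commute distrib_right mult.assoc mult_div_mod_eq)
  thus ?thesis by (simp add: power_int_add w_powi_N)
qed

lemma bij_w: "bij_betw (\<lambda>k. w ^ k) {..<N} {z. z ^ N = 1}"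
proof -
  have "(\<lambda>k. w ^ k) = (\<lambda>k. cis (2 * pi * real k / real N))"
    by (auto simp: w DeMoivre mult_ac)
  thus ?thesis using bij_betw_roots_unity[OF N] by simp
qed

lemma w_powi_eq_1_iff: "w powi k = 1 \<longleftrightarrow> int N dvd k"
proof
  assume "w powi k = 1"
  hence "w powi ((k mod int N) * 1) = 1" using w_powi_mod[of k 1] by simp
  hence "w ^ nat (k mod int N) = w ^ 0" using N by (simp add: power_int_def)
  hence "nat (k mod int N) = 0"
    using inj_onD[OF bij_betw_imp_inj_on[OF bij_w], of "nat (k mod int N)" 0] N
    by (auto simp: nat_less_iff)
  moreover have "k mod int N \<ge> 0" using N by simp
  ultimately show "int N dvd k" by (simp add: dvd_eq_mod_eq_0)
next
  assume "int N dvd k" thus "w powi k = 1" using w_powi_N by (auto elim!: dvdE)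
qed

lemma sum_w_powi:
  "(\<Sum>c = 0..<N. w powi (int c * k)) = (if int N dvd k then of_nat N else 0)"
proof (cases "int N dvd k")
  case True
  hence "w powi (int c * k) = 1" for c using w_powi_eq_1_iff by simp
  thus ?thesis using True by simp
next
  case False
  hence ne: "w powi k \<noteq> 1" using w_powi_eq_1_iff by blast
  have "w powi (int c * k) = (w powi k) ^ c" for c
    by (simp add: power_int_mult mult.commute[of "int c"])
  hence "(\<Sum>c = 0..<N. w powi (int c * k)) = (\<Sum>c<N. (w powi k) ^ c)"
    by (simp add: atLeast0LessThan)
  also have "\<dots> = ((w powi k) ^ N - 1) / (w powi k - 1)"
    using ne by (simp add: geometric_sum)
  also have "(w powi k) ^ N = 1"
    using w_powi_N[of k] by (simp add: power_int_mult mult.commute[of "int N"])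
  finally show ?thesis using False by simp
qed

text \<open>The Fourier matrix for s = 1 and its conjugate for s = -1; they are inverse to each
  other up to the factor N.\<close>

definition dft :: "int \<Rightarrow> complex mat" where
  "dft s = mat N N (\<lambda>(a, k). w powi (s * int a * int k))"

lemma dft_carrier [simp]: "dft s \<in> carrier_mat N N" by (simp add: dft_def)

lemma det_dft_nz: "det (dft 1) \<noteq> 0" "det (dft (-1)) \<noteq> 0"
proof -
  have "dft 1 * dft (-1) = diag_fun N (\<lambda>_. of_nat N)"
  proof (rule eq_matI)
    fix i j assume "i < dim_row (diag_fun N (\<lambda>_. of_nat N :: complex))"
      "j < dim_col (diag_fun N (\<lambda>_. of_nat N :: complex))"
    hence ij: "i < N" "j < N" by (auto simp: diag_fun_def)
    have "(dft 1 * dft (-1)) $$ (i, j) = (\<Sum>c = 0..<N. w powi (int i * int c) * w powi (- int c * int j))"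
      using ij by (simp add: dft_def scalar_prod_def)
    also have "\<dots> = (\<Sum>c = 0..<N. w powi (int c * (int i - int j)))"
      by (rule sum.cong) (auto simp: power_int_add[symmetric] algebra_simps)
    also have "\<dots> = (if i = j then of_nat N else 0)"
    proof -
      have "int N dvd int i - int j \<longleftrightarrow> i = j"
        using ij by (auto simp: mod_eq_dvd_iff[symmetric])
      thus ?thesis by (simp add: sum_w_powi)
    qed
    finally show "(dft 1 * dft (-1)) $$ (i, j) = diag_fun N (\<lambda>_. of_nat N) $$ (i, j)"
      using ij by (simp add: diag_fun_def)
  qed (auto simp: dft_def diag_fun_def)
  hence "det (dft 1) * det (dft (-1)) = of_nat N ^ N"
    by (subst det_mult[symmetric, of _ N]) (auto simp: det_diag_fun)
  thus "det (dft 1) \<noteq> 0" "det (dft (-1)) \<noteq> 0" using N by auto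
qed

text \<open>Substitute j = a + t c + r in the column sum: as t * t = 1, the exponent s c k becomes
  -t s (a + r) k + t s j k. So a circulant block (t = -1) keeps the Fourier matrix, and a block
  depending on a + c (t = 1) turns it into its conjugate.\<close>

lemma circulant_mult_dft:
  fixes F :: "int \<Rightarrow> complex"
  assumes per: "\<And>x. F (x mod int N) = F x" and t: "t = 1 \<or> t = -1"
  shows "mat N N (\<lambda>(a, c). F (int a + t * int c + r)) * dft s =
    dft (- t * s) * diag_fun N (\<lambda>k. w powi (- t * s * r * int k) * (\<Sum>j = 0..<N. F (int j) * w powi (t * s * int j * int k)))"
proof (subst mult_diag_fun, simp, rule eq_matI)
  fix i k
  let ?R = "mat N N (\<lambda>(i, j). dft (- t * s) $$ (i, j) * (w powi (- t * s * r * int j) * (\<Sum>l = 0..<N. F (int l) * w powi (t * s * int l * int j))))"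
  assume "i < dim_row ?R" "k < dim_col ?R"
  hence ik: "i < N" "k < N" by auto
  have tt: "t * t = 1" using t by auto
  define h where "h x = F x * w powi (x * (t * s * int k))" for x
  have hp: "h (x mod int N) = h x" for x unfolding h_def by (simp only: per w_powi_mod)
  have "(mat N N (\<lambda>(a, c). F (int a + t * int c + r)) * dft s) $$ (i, k)
     = (\<Sum>c = 0..<N. F (int i + t * int c + r) * w powi (s * int c * int k))"
    using ik by (simp add: dft_def scalar_prod_def)
  also have "\<dots> = (\<Sum>c = 0..<N. w powi (- t * s * (int i + r) * int k) * h ((int i + r) + t * int c))"
  proof (rule sum.cong[OF refl])
    fix c
    have "s * int c * int k = - t * s * (int i + r) * int k + ((int i + r) + t * int c) * (t * s * int k)"
      using t by (auto simp: algebra_simps)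
    hence "w powi (s * int c * int k) = w powi (- t * s * (int i + r) * int k) *
        w powi (((int i + r) + t * int c) * (t * s * int k))"
      by (metis power_int_add w_nz)
    thus "F (int i + t * int c + r) * w powi (s * int c * int k) =
       w powi (- t * s * (int i + r) * int k) * h ((int i + r) + t * int c)"
      unfolding h_def by (simp add: add_ac)
  qed
  also have "\<dots> = w powi (- t * s * (int i + r) * int k) * (\<Sum>c = 0..<N. h (int c))"
    unfolding sum_distrib_left[symmetric] by (subst sum_periodic_reflect[of h N t, OF hp N t]) simp
  also have "w powi (- t * s * (int i + r) * int k) = w powi (- t * s * int i * int k) * w powi (- t * s * r * int k)"
    by (simp add: power_int_add[symmetric] algebra_simps)
  also have "(\<Sum>c = 0..<N. h (int c)) = (\<Sum>l = 0..<N. F (int l) * w powi (t * s * int l * int k))"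
    unfolding h_def by (simp add: mult_ac)
  finally show "(mat N N (\<lambda>(a, c). F (int a + t * int c + r)) * dft s) $$ (i, k) = ?R $$ (i, k)"
    using ik by (simp add: dft_def mult_ac)
qed (auto simp: dft_def)

end

text \<open>Since (x^a y)^2 = x^n is central of order 2, the inverse of x^a y is x^(a+n) y.\<close>

lemma dicyclic_inv:
  assumes n: "n > 0" and a: "0 \<le> a" "a < 2 * int n"
  shows "inv\<^bsub>dicyclic n\<^esub> (a, 0) = ((- a) mod (2 * int n), 0)"
    and "inv\<^bsub>dicyclic n\<^esub> (a, 1) = ((a + int n) mod (2 * int n), 1)"
proof -
  define N where "N = 2 * int n"
  have N: "N > 0" using n by (simp add: N_def)
  have uniq: "c = b mod N" if "0 \<le> c" "c < N" "(b - c) mod N = 0" for b c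
  proof -
    have "b mod N = c mod N" using that(3) by (metis mod_eq_dvd_iff dvd_eq_mod_eq_0)
    thus ?thesis using that by simp
  qed
  have red: "(x + y mod N) mod N = (x + y) mod N" "(y mod N + x) mod N = (y + x) mod N"
    "(x - y mod N) mod N = (x - y) mod N" "(y mod N - x) mod N = (y - x) mod N"
    "(x - y mod N + z) mod N = (x - y + z) mod N" "(y mod N - x + z) mod N = (y - x + z) mod N" for x y z
    by (simp_all add: mod_simps) (metis mod_add_left_eq mod_diff_left_eq mod_diff_right_eq)+
  show "inv\<^bsub>dicyclic n\<^esub> (a, 0) = ((- a) mod (2 * int n), 0)"
    unfolding m_inv_def
  proof (rule the_equality)
    show "((- a) mod (2 * int n), 0) \<in> carrier (dicyclic n) \<and>
      (a, 0) \<otimes>\<^bsub>dicyclic n\<^esub> ((- a) mod (2 * int n), 0) = \<one>\<^bsub>dicyclic n\<^esub> \<and>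
      ((- a) mod (2 * int n), 0) \<otimes>\<^bsub>dicyclic n\<^esub> (a, 0) = \<one>\<^bsub>dicyclic n\<^esub>"
      using N by (simp add: dicyclic_def N_def[symmetric] red)
  next
    fix y assume y: "y \<in> carrier (dicyclic n) \<and> (a, 0) \<otimes>\<^bsub>dicyclic n\<^esub> y = \<one>\<^bsub>dicyclic n\<^esub> \<and>
        y \<otimes>\<^bsub>dicyclic n\<^esub> (a, 0) = \<one>\<^bsub>dicyclic n\<^esub>"
    obtain c d where cd: "y = (c, d)" by (cases y)
    from y have "0 \<le> c" "c < N" "d = 0" "(a + c) mod N = 0"
      by (auto simp: cd dicyclic_def N_def split: if_splits)
    moreover have "(- a - c) mod N = 0"
      using \<open>(a + c) mod N = 0\<close> by (metis diff_conv_add_uminus minus_add_distrib mod_0 mod_minus_eq minus_zero)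
    ultimately show "y = ((- a) mod (2 * int n), 0)" using uniq[of c "- a"] cd by (simp add: N_def)
  qed
  show "inv\<^bsub>dicyclic n\<^esub> (a, 1) = ((a + int n) mod (2 * int n), 1)"
    unfolding m_inv_def
  proof (rule the_equality)
    have "(a + int n - a + int n) mod N = 0" "(a - (a + int n) + int n) mod N = 0"
      by (simp_all add: N_def)
    thus "((a + int n) mod (2 * int n), 1) \<in> carrier (dicyclic n) \<and>
      (a, 1) \<otimes>\<^bsub>dicyclic n\<^esub> ((a + int n) mod (2 * int n), 1) = \<one>\<^bsub>dicyclic n\<^esub> \<and>
      ((a + int n) mod (2 * int n), 1) \<otimes>\<^bsub>dicyclic n\<^esub> (a, 1) = \<one>\<^bsub>dicyclic n\<^esub>"
      using N by (simp add: dicyclic_def N_def[symmetric] red)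
  next
    fix y assume y: "y \<in> carrier (dicyclic n) \<and> (a, 1) \<otimes>\<^bsub>dicyclic n\<^esub> y = \<one>\<^bsub>dicyclic n\<^esub> \<and>
        y \<otimes>\<^bsub>dicyclic n\<^esub> (a, 1) = \<one>\<^bsub>dicyclic n\<^esub>"
    obtain c d where cd: "y = (c, d)" by (cases y)
    from y have "0 \<le> c" "c < N" "d = 1" "(a - c + int n) mod N = 0"
      by (auto simp: cd dicyclic_def N_def split: if_splits)
    moreover have "(a + int n - c) mod N = 0" using \<open>(a - c + int n) mod N = 0\<close>
      by (simp add: algebra_simps)
    ultimately show "y = ((a + int n) mod (2 * int n), 1)" using uniq[of c "a + int n"] cd by (simp add: N_def)
  qed
qed

text \<open>List the elements x^a before the elements x^a y. The matrix then has blocks A, B, C, A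
  with A circulant and B, C functions of a + c. The Fourier transform makes all four blocks
  diagonal, hence commuting, and the determinant splits over the 2n-th roots of unity.\<close>

lemma group_det_dicyclic:
  fixes x :: "int \<times> int \<Rightarrow> int"
  assumes n: "n > 0"
  defines "f \<equiv> \<lambda>b z. \<Sum>j<2 * n. of_int (x (int j, b)) * z ^ j :: complex"
  shows "of_int (group_det (dicyclic n) x) =
    (\<Prod>z | z ^ (2 * n) = 1. f 0 z * f 0 (inverse z) - z ^ n * f 1 z * f 1 (inverse z))"
proof -
  define N where "N = 2 * n"
  define w where "w = cis (2 * pi / real N)"
  interpret root_of_unity N w by unfold_locales (use n in \<open>auto simp: N_def w_def\<close>)
  have N2: "int N = 2 * int n" by (simp add: N_def)
  define e where "e i = (if i < N then (int i, 0 :: int) else (int (i - N), 1))" for i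
  have e: "bij_betw e {0..<N + N} (carrier (dicyclic n))"
  proof (rule bij_betw_byWitness[where f' = "\<lambda>(a, b). if b = 0 then nat a else nat a + N"])
    show "e ` {0..<N + N} \<subseteq> carrier (dicyclic n)"
      by (auto simp: e_def dicyclic_def N2 N_def)
    show "(\<lambda>(a, b). if b = 0 then nat a else nat a + N) ` carrier (dicyclic n) \<subseteq> {0..<N + N}"
      by (auto simp: dicyclic_def N_def)
  qed (auto simp: e_def dicyclic_def N2 N_def)
  define F where "F b k = (of_int (x (k mod int N, b)) :: complex)" for b k
  have per: "F b (k mod int N) = F b k" for b k by (simp add: F_def)
  define A where "A = mat N N (\<lambda>(a, c). F 0 (int a + (-1) * int c + 0))"
  define B where "B = mat N N (\<lambda>(a, c). F 1 (int a + 1 * int c + int n))"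
  define C where "C = mat N N (\<lambda>(a, c). F 1 (int a + 1 * int c + 0))"
  let ?M = "mat (N + N) (N + N) (\<lambda>(i, j). x (e i \<otimes>\<^bsub>dicyclic n\<^esub> inv\<^bsub>dicyclic n\<^esub> (e j)))"
  have carr: "A \<in> carrier_mat N N" "B \<in> carrier_mat N N" "C \<in> carrier_mat N N"
    by (auto simp: A_def B_def C_def)
  have invs: "inv\<^bsub>dicyclic n\<^esub> (int i, 0) = ((- int i) mod int N, 0)"
    "inv\<^bsub>dicyclic n\<^esub> (int i, 1) = ((int i + int n) mod int N, 1)" if "i < N" for i
    using dicyclic_inv[of n "int i"] that n by (auto simp: N2 N_def)
  have red: "(y + z mod int N) mod int N = (y + z) mod int N"
    "(y - z mod int N) mod int N = (y - z) mod int N"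
    "(y - z mod int N + u) mod int N = (y - z + u) mod int N" for y z u
    by (simp_all add: mod_simps) (metis mod_add_left_eq mod_diff_right_eq)
  have mult: "(a, b) \<otimes>\<^bsub>dicyclic n\<^esub> (c, d) =
     (if b = 0 then ((a + c) mod int N, d)
      else if d = 0 then ((a - c) mod int N, 1) else ((a - c + int n) mod int N, 0))" for a b c d
    by (simp add: dicyclic_def N2)
  have M: "map_mat of_int ?M = four_block_mat A B C A"
  proof (rule eq_matI)
    fix i j assume "i < dim_row (four_block_mat A B C A)" "j < dim_col (four_block_mat A B C A)"
    hence ij: "i < N + N" "j < N + N" using carr by auto
    consider "i < N" "j < N" | "i < N" "j \<ge> N" | "i \<ge> N" "j < N" | "i \<ge> N" "j \<ge> N" by linarith
    thus "map_mat of_int ?M $$ (i, j) = four_block_mat A B C A $$ (i, j)"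
    proof cases
      case 1
      thus ?thesis using ij by (simp add: A_def B_def C_def F_def e_def invs mult red)
    next
      case 2
      define j' where "j' = j - N"
      have "j' < N" "j = j' + N" using ij 2 by (auto simp: j'_def)
      thus ?thesis using ij 2
        by (simp add: A_def B_def C_def F_def e_def invs mult red add_ac)
    next
      case 3
      define i' where "i' = i - N"
      have "i' < N" "i = i' + N" using ij 3 by (auto simp: i'_def)
      thus ?thesis using ij 3
        by (simp add: A_def B_def C_def F_def e_def invs mult red)
    next
      case 4
      define i' j' where "i' = i - N" and "j' = j - N"
      have "i' < N" "i = i' + N" "j' < N" "j = j' + N" using ij 4 by (auto simp: i'_def j'_def)
      thus ?thesis using ij 4
        by (simp add: A_def B_def C_def F_def e_def invs mult red)
    qed
  qed (use carr in auto)
  define \<phi> where "\<phi> = (\<lambda>(b :: int) (s :: int) (k :: nat). (\<Sum>j = 0..<N. F b (int j) * w powi (s * int j * int k)))"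
  define d1 where "d1 = (\<lambda>k. \<phi> 0 (-1) k)"
  \<comment> \<open>The shift by n in B, which stems from y^2 = x^n, turns into the factor
    z^n.\<close>
  define d2 where "d2 = (\<lambda>k. w powi (int n * int k) * \<phi> 1 (-1) k)"
  define d3 where "d3 = (\<lambda>k. \<phi> 1 1 k)"
  define d4 where "d4 = (\<lambda>k. \<phi> 0 1 k)"
  have AV: "A * dft 1 = dft 1 * diag_fun N d1"
    unfolding A_def by (subst circulant_mult_dft[of "F 0" "-1" 0 1, OF per]) (auto simp: d1_def \<phi>_def)
  have BV: "B * dft (-1) = dft 1 * diag_fun N d2"
    unfolding B_def by (subst circulant_mult_dft[of "F 1" 1 "int n" "-1", OF per]) (auto simp: d2_def \<phi>_def)
  have CV: "C * dft 1 = dft (-1) * diag_fun N d3"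
    unfolding C_def by (subst circulant_mult_dft[of "F 1" 1 0 1, OF per]) (auto simp: d3_def \<phi>_def)
  have DV: "A * dft (-1) = dft (-1) * diag_fun N d4"
    unfolding A_def by (subst circulant_mult_dft[of "F 0" "-1" 0 "-1", OF per]) (auto simp: d4_def \<phi>_def)
  \<comment> \<open>B and C exchange the two Fourier matrices, so the base change uses
    \<open>dft 1\<close> on the x^a and \<open>dft (-1)\<close> on the x^a y.\<close>
  let ?V = "four_block_mat (dft 1) (0\<^sub>m N N) (0\<^sub>m N N) (dft (-1))"
  let ?K = "four_block_mat (diag_fun N d1) (diag_fun N d2) (diag_fun N d3) (diag_fun N d4)"
  have V: "?V \<in> carrier_mat (N + N) (N + N)" "?K \<in> carrier_mat (N + N) (N + N)"
    "four_block_mat A B C A \<in> carrier_mat (N + N) (N + N)"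
    using carr by auto
  have pc: "dft s * diag_fun N d \<in> carrier_mat N N" for s d
    by (rule mult_carrier_mat[of _ N N]) auto
  have z: "0\<^sub>m N N * diag_fun N d = 0\<^sub>m N N" for d :: "nat \<Rightarrow> complex"
    by (rule left_mult_zero_mat[of _ N]) auto
  have "four_block_mat A B C A * ?V = ?V * ?K"
    by (subst (1 2) mult_four_block_mat[of _ N N _ N _ N _ _ N _ N])
       (use carr in \<open>auto simp: AV BV CV DV z left_add_zero_mat[OF pc] right_add_zero_mat[OF pc]\<close>)
  hence "det (four_block_mat A B C A) * det ?V = det ?V * det ?K"
    using det_mult[OF V(3) V(1)] det_mult[OF V(1) V(2)] by metis
  moreover have "det ?V \<noteq> 0"
    using det_dft_nz by (subst det_four_block_mat_upper_right_zero[of _ N _ N]) auto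
  ultimately have "det (four_block_mat A B C A) = det ?K" by simp
  also have "\<dots> = det (diag_fun N d1 * diag_fun N d4 - diag_fun N d2 * diag_fun N d3)"
    by (rule det_four_block_mat[of _ N]) (auto simp: diag_fun_mult mult.commute)
  also have "diag_fun N d1 * diag_fun N d4 - diag_fun N d2 * diag_fun N d3 = diag_fun N (\<lambda>k. d1 k * d4 k - d2 k * d3 k)"
    unfolding diag_fun_mult by (rule eq_matI) (auto simp: diag_fun_def)
  also have "det \<dots> = (\<Prod>k<N. d1 k * d4 k - d2 k * d3 k)" by (rule det_diag_fun)
  also have "\<dots> = (\<Prod>k<N. f 0 (w ^ k) * f 0 (inverse (w ^ k)) - (w ^ k) ^ n * f 1 (w ^ k) * f 1 (inverse (w ^ k)))"
  proof (rule prod.cong[OF refl])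
    fix k assume "k \<in> {..<N}"
    have pw: "w powi (int j * int k) = (w ^ k) ^ j" for j
      by (metis of_nat_mult power_int_of_nat power_mult mult.commute)
    have "w powi (- (int j * int k)) = inverse (w ^ k) ^ j" for j
      by (simp add: power_int_minus pw power_inverse)
    hence "\<phi> b 1 k = f b (w ^ k)" "\<phi> b (-1) k = f b (inverse (w ^ k))" for b
      by (simp_all add: \<phi>_def f_def N_def[symmetric] atLeast0LessThan F_def pw)
    moreover have "w powi (int n * int k) = (w ^ k) ^ n" by (rule pw)
    ultimately show "d1 k * d4 k - d2 k * d3 k = f 0 (w ^ k) * f 0 (inverse (w ^ k)) - (w ^ k) ^ n * f 1 (w ^ k) * f 1 (inverse (w ^ k))"
      by (simp add: d1_def d2_def d3_def d4_def mult_ac)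
  qed
  also have "\<dots> = (\<Prod>z | z ^ (2 * n) = 1. f 0 z * f 0 (inverse z) - z ^ n * f 1 z * f 1 (inverse z))"
    using prod.reindex_bij_betw[OF bij_w, of "\<lambda>z. f 0 z * f 0 (inverse z) - z ^ n * f 1 z * f 1 (inverse z)"]
    by (simp add: N_def)
  finally have "det (four_block_mat A B C A) = (\<Prod>z | z ^ (2 * n) = 1. f 0 z * f 0 (inverse z) - z ^ n * f 1 z * f 1 (inverse z))" .
  moreover have "of_int (group_det (dicyclic n) x) = det (four_block_mat A B C A)"
    unfolding group_det_eq_det[OF e] M[symmetric] by (rule of_int_hom.hom_det[symmetric])
  ultimately show ?thesis by simp
qed

text \<open>Multiplication by z shifts the N coefficients cyclically, the top one re-entering as the
  constant term because z^N = 1; this is the induction step.\<close>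

lemma poly_eq_sum_mod_roots_of_unity:
  fixes q :: "int poly"
  assumes "N > 0"
  shows "\<exists>c :: nat \<Rightarrow> int. \<forall>z :: complex. z ^ N = 1 \<longrightarrow>
           poly (of_int_poly q) z = (\<Sum>k<N. of_int (c k) * z ^ k)"
proof (induction q)
  case 0
  show ?case by (intro exI[of _ "\<lambda>_. 0"]) auto
next
  case (pCons a q)
  then obtain c where c: "\<And>z :: complex. z ^ N = 1 \<Longrightarrow> poly (of_int_poly q) z = (\<Sum>k<N. of_int (c k) * z ^ k)"
    by blast
  obtain M where M: "N = Suc M" using assms by (cases N) auto
  define c' where "c' k = (if k = 0 then a + c M else c (k - 1))" for k
  have "poly (of_int_poly (pCons a q)) z = (\<Sum>k<N. of_int (c' k) * z ^ k)" if z: "z ^ N = 1" for z :: complex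
  proof -
    have "(\<Sum>k<N. of_int (c' k) * z ^ k) = of_int (c' 0) + (\<Sum>k<M. of_int (c' (Suc k)) * z ^ Suc k)"
      unfolding M by (subst sum.lessThan_Suc_shift) simp
    also have "\<dots> = of_int a + of_int (c M) * (z * z ^ M) + (\<Sum>k<M. of_int (c k) * z ^ Suc k)"
      using z by (simp add: c'_def M)
    also have "\<dots> = of_int a + z * (\<Sum>k<N. of_int (c k) * z ^ k)"
      by (simp add: M algebra_simps sum_distrib_left)
    finally show ?thesis using c[OF z] by (simp add: of_int_hom.map_poly_pCons_hom)
  qed
  thus ?case by blast
qed

section \<open>The p-th roots of unity for an odd prime p\<close>

locale prime_roots =
  fixes p :: nat
  assumes prime_p: "prime p" and odd_p: "odd p"
begin

definition \<mu> :: "complex set" where "\<mu> = {z. z ^ p = 1}"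

definition m :: nat where "m = (p - 1) div 2"

lemma p_gt: "p > 2" "p > 0" "p > 1"
  using prime_p odd_p prime_gt_1_nat[OF prime_p] by (auto, metis even_numeral less_one linorder_neqE_nat not_less_eq numeral_2_eq_2)

lemma p_eq: "p = 2 * m + 1" and m_pos: "m > 0"
  using odd_p p_gt by (auto simp: m_def elim!: oddE)

sublocale root_of_unity p "cis (2 * pi / real p)"
  by unfold_locales (use p_gt in auto)

abbreviation "\<omega> \<equiv> cis (2 * pi / real p)"

lemma bij_\<omega>: "bij_betw (\<lambda>k. \<omega> ^ k) {..<p} \<mu>"
  using bij_w by (simp add: \<mu>_def)

lemma finite_\<mu> [simp]: "finite \<mu>"
  using bij_betw_finite[OF bij_\<omega>] by simp

lemma card_\<mu>: "card \<mu> = p"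
  using bij_betw_same_card[OF bij_\<omega>] by simp

lemma one_in_\<mu> [simp]: "1 \<in> \<mu>" by (simp add: \<mu>_def)

lemma \<mu>_norm: "z \<in> \<mu> \<Longrightarrow> norm z = 1"
  using p_gt by (auto simp: \<mu>_def) (metis norm_one norm_power power_eq_1_iff norm_ge_zero power_eq_imp_eq_base power_one less_nat_zero_code neq0_conv zero_le_one)

lemma \<mu>_cnj_mult: "z \<in> \<mu> \<Longrightarrow> z * cnj z = 1"
  using \<mu>_norm[of z] by (simp add: complex_norm_square[symmetric])

lemma \<mu>_nz: "z \<in> \<mu> \<Longrightarrow> z \<noteq> 0"
  using \<mu>_norm by force

lemma \<mu>_inverse: "z \<in> \<mu> \<Longrightarrow> inverse z = cnj z"
  using \<mu>_cnj_mult by (metis inverse_unique)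

lemma \<mu>_cnj: "z \<in> \<mu> \<Longrightarrow> cnj z \<in> \<mu>"
  by (auto simp: \<mu>_def) (metis complex_cnj_one complex_cnj_power)

lemma \<mu>_power: "z \<in> \<mu> \<Longrightarrow> z ^ k \<in> \<mu>"
  by (auto simp: \<mu>_def) (metis power_mult mult.commute power_one)

lemma \<mu>_mult: "z \<in> \<mu> \<Longrightarrow> y \<in> \<mu> \<Longrightarrow> z * y \<in> \<mu>"
  by (auto simp: \<mu>_def power_mult_distrib)

lemma \<mu>_pow_p: "z \<in> \<mu> \<Longrightarrow> z ^ p = 1" by (simp add: \<mu>_def)

lemma \<mu>_cnj_eq_power: assumes z: "z \<in> \<mu>" shows "cnj z = z ^ (p - 1)"
proof -
  have "z ^ (p - 1) * z = 1" using \<mu>_pow_p[OF z] p_gt by (metis Suc_diff_1 mult.commute power_Suc)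
  thus ?thesis using \<mu>_cnj_mult[OF z]  by (metis mult.commute mult.left_neutral mult.assoc)
qed

lemma \<mu>_pow_eq_1_iff:
  assumes z: "z \<in> \<mu>" "z \<noteq> 1" shows "z ^ k = 1 \<longleftrightarrow> p dvd k"
proof -
  obtain a where a: "a < p" "z = \<omega> ^ a" using z bij_\<omega> by (auto simp: bij_betw_def)
  have "a > 0" using a z(2) by (cases a) auto
  hence na: "\<not> p dvd a" using a by (auto dest: dvd_imp_le)
  have "z ^ k = \<omega> powi (int (a * k))" by (simp only: power_int_of_nat a power_mult)
  hence "z ^ k = 1 \<longleftrightarrow> p dvd a * k" by (simp only: w_powi_eq_1_iff int_dvd_int_iff)
  thus ?thesis using na prime_p by (simp add: prime_dvd_mult_iff)
qed

lemma bij_power: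
  assumes z: "z \<in> \<mu>" "z \<noteq> 1" shows "bij_betw (\<lambda>k. z ^ k) {..<p} \<mu>"
proof -
  have "inj_on (\<lambda>k. z ^ k) {..<p}"
  proof (rule linorder_inj_onI)
    fix x y :: nat assume xy: "x < y" "x \<in> {..<p}" "y \<in> {..<p}"
    have "z ^ y = z ^ x * z ^ (y - x)" using xy by (simp add: power_add[symmetric])
    moreover have "z ^ (y - x) \<noteq> 1" unfolding \<mu>_pow_eq_1_iff[OF z] using xy by (auto dest: dvd_imp_le)
    ultimately show "z ^ x \<noteq> z ^ y" using \<mu>_nz[OF z(1)] by simp
  qed auto
  moreover have "(\<lambda>k. z ^ k) ` {..<p} \<subseteq> \<mu>" using \<mu>_power z by auto
  ultimately show ?thesis
    by (metis bij_betw_def card_\<mu> card_image card_lessThan card_subset_eq finite_\<mu>)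
qed

lemma sum_\<mu>_power: "(\<Sum>z\<in>\<mu>. z ^ k) = (if p dvd k then of_nat p else 0)"
proof -
  have "(\<Sum>z\<in>\<mu>. z ^ k) = (\<Sum>c<p. (\<omega> ^ c) ^ k)"
    by (rule sum.reindex_bij_betw[OF bij_\<omega>, symmetric])
  also have "\<dots> = (\<Sum>c = 0..<p. \<omega> powi (int c * int k))"
    by (simp add: atLeast0LessThan power_int_def nat_mult_distrib power_mult)
  finally show ?thesis by (simp add: sum_w_powi)
qed

section \<open>Integer combinations of roots of unity\<close>

text \<open>The ring Z[x]/(x^p - 1) as functions on \<open>\<mu>\<close>, so that conjugation and z
  -> z^k act pointwise; values off \<open>\<mu>\<close> are left free. The root 1 is kept together
  with the others because the congruences modulo p compare it with them.\<close>

definition R :: "(complex \<Rightarrow> complex) set" where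
  "R = {f. \<exists>q :: int poly. \<forall>z\<in>\<mu>. f z = poly (of_int_poly q) z}"

lemma R_I: "(\<And>z. z \<in> \<mu> \<Longrightarrow> f z = poly (of_int_poly q) z) \<Longrightarrow> f \<in> R"
  by (auto simp: R_def)

lemma R_E: assumes "f \<in> R" obtains q where "\<And>z. z \<in> \<mu> \<Longrightarrow> f z = poly (of_int_poly q) z"
  using assms by (auto simp: R_def)

lemma R_cong: "f \<in> R \<Longrightarrow> (\<And>z. z \<in> \<mu> \<Longrightarrow> g z = f z) \<Longrightarrow> g \<in> R"
  by (auto simp: R_def)

lemma R_of_int [simp, intro]: "(\<lambda>z. of_int a) \<in> R"
  by (rule R_I[of _ "[:a:]"]) (simp add: of_int_hom.map_poly_pCons_hom)

lemma R_num [simp, intro]: "(\<lambda>z. 0) \<in> R" "(\<lambda>z. 1) \<in> R" "(\<lambda>z. numeral k) \<in> R"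
  using R_of_int[of 0] R_of_int[of 1] R_of_int[of "numeral k"] by simp_all

lemma R_id [simp, intro]: "(\<lambda>z. z) \<in> R"
  by (rule R_I[of _ "[:0, 1:]"]) simp

lemma R_add [intro!]: assumes "f \<in> R" "g \<in> R" shows "(\<lambda>z. f z + g z) \<in> R"
proof -
  obtain q r where "\<And>z. z \<in> \<mu> \<Longrightarrow> f z = poly (of_int_poly q) z" "\<And>z. z \<in> \<mu> \<Longrightarrow> g z = poly (of_int_poly r) z"
    using R_E assms by metis
  thus ?thesis by (intro R_I[of _ "q + r"]) (simp add: of_int_poly_hom.hom_add)
qed

lemma R_mult [intro!]: assumes "f \<in> R" "g \<in> R" shows "(\<lambda>z. f z * g z) \<in> R"
proof -
  obtain q r where "\<And>z. z \<in> \<mu> \<Longrightarrow> f z = poly (of_int_poly q) z" "\<And>z. z \<in> \<mu> \<Longrightarrow> g z = poly (of_int_poly r) z"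
    using R_E assms by metis
  thus ?thesis by (intro R_I[of _ "q * r"]) (simp add: of_int_poly_hom.hom_mult)
qed

lemma R_uminus [intro!]: "f \<in> R \<Longrightarrow> (\<lambda>z. - f z) \<in> R"
  using R_mult[OF R_of_int[of "-1"], of f] by simp

lemma R_diff [intro!]: "f \<in> R \<Longrightarrow> g \<in> R \<Longrightarrow> (\<lambda>z. f z - g z) \<in> R"
  using R_add[of f "\<lambda>z. - g z"] by auto

lemma R_power [intro!]: "f \<in> R \<Longrightarrow> (\<lambda>z. f z ^ k) \<in> R"
  by (induction k) auto

lemma R_sum [intro!]: "(\<And>i. i \<in> I \<Longrightarrow> f i \<in> R) \<Longrightarrow> (\<lambda>z. \<Sum>i\<in>I. f i z) \<in> R"
  by (induction I rule: infinite_finite_induct) auto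

lemma R_prod [intro!]: "(\<And>i. i \<in> I \<Longrightarrow> f i \<in> R) \<Longrightarrow> (\<lambda>z. \<Prod>i\<in>I. f i z) \<in> R"
  by (induction I rule: infinite_finite_induct) auto

lemma R_comp_power: assumes "f \<in> R" shows "(\<lambda>z. f (z ^ k)) \<in> R"
proof -
  obtain q where "\<And>z. z \<in> \<mu> \<Longrightarrow> f z = poly (of_int_poly q) z" using assms unfolding R_def by blast
  thus ?thesis
    by (intro R_I[of _ "pcompose q (Polynomial.monom 1 k)"])
       (simp add: \<mu>_power of_int_hom.map_poly_pcompose poly_pcompose map_poly_monom poly_monom)
qed

lemma poly_of_int_cnj: "poly (of_int_poly q) (cnj z) = cnj (poly (of_int_poly q) z)"
  by (induction q) auto

lemma R_at_cnj: assumes "f \<in> R" "z \<in> \<mu>" shows "f (cnj z) = cnj (f z)"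
proof -
  obtain q where "\<And>z. z \<in> \<mu> \<Longrightarrow> f z = poly (of_int_poly q) z" using assms(1) unfolding R_def by blast
  thus ?thesis using assms(2) by (simp add: \<mu>_cnj poly_of_int_cnj)
qed

text \<open>Integer coefficients let conjugation pass to the argument, where it is the power map z
  -> z^(p-1).\<close>

lemma R_cnj [intro!]: assumes "f \<in> R" shows "(\<lambda>z. cnj (f z)) \<in> R"
  by (rule R_cong[OF R_comp_power[OF assms, of "p - 1"]])
     (simp add: R_at_cnj[OF assms, symmetric] \<mu>_cnj_eq_power)

lemma R_normal_form: assumes "f \<in> R"
  obtains c :: "nat \<Rightarrow> int" where "\<And>z. z \<in> \<mu> \<Longrightarrow> f z = (\<Sum>k<p. of_int (c k) * z ^ k)"
proof -
  obtain q where q: "\<And>z. z \<in> \<mu> \<Longrightarrow> f z = poly (of_int_poly q) z" using assms unfolding R_def by blast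
  obtain c where c: "\<And>z :: complex. z ^ p = 1 \<Longrightarrow> poly (of_int_poly q) z = (\<Sum>k<p. of_int (c k) * z ^ k)"
    using poly_eq_sum_mod_roots_of_unity[OF N, of q] by blast
  show ?thesis using that[of c] q c by (simp add: \<mu>_def)
qed

lemma R_at_1: assumes "f \<in> R" obtains a :: int where "f 1 = of_int a"
proof -
  obtain q where "\<And>z. z \<in> \<mu> \<Longrightarrow> f z = poly (of_int_poly q) z" using assms unfolding R_def by blast
  thus ?thesis using that[of "poly q 1"] by (simp add: of_int_hom.poly_map_poly_1)
qed

text \<open>Congruence modulo the ideal 2R. For members of \<open>R\<close> this is exactly the
  condition for being the values of one integer polynomial at z and at -z.\<close>

definition cong2 :: "(complex \<Rightarrow> complex) \<Rightarrow> (complex \<Rightarrow> complex) \<Rightarrow> bool" (infix "\<approx>" 50) where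
  "f \<approx> g \<longleftrightarrow> (\<exists>h\<in>R. \<forall>z\<in>\<mu>. f z = g z + 2 * h z)"

lemma cong2_I: "h \<in> R \<Longrightarrow> (\<And>z. z \<in> \<mu> \<Longrightarrow> f z = g z + 2 * h z) \<Longrightarrow> f \<approx> g"
  by (auto simp: cong2_def)

lemma cong2_refl [simp, intro]: "f \<approx> f"
  by (rule cong2_I[of "\<lambda>_. 0"]) auto

lemma cong2_sym: assumes "f \<approx> g" shows "g \<approx> f"
proof -
  obtain h where "h \<in> R" "\<And>z. z \<in> \<mu> \<Longrightarrow> f z = g z + 2 * h z" using assms by (auto simp: cong2_def)
  thus ?thesis by (intro cong2_I[of "\<lambda>z. - h z"]) auto
qed

lemma cong2_trans [trans]: assumes "f \<approx> g" "g \<approx> k" shows "f \<approx> k"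
proof -
  obtain h h' where "h \<in> R" "\<And>z. z \<in> \<mu> \<Longrightarrow> f z = g z + 2 * h z" "h' \<in> R" "\<And>z. z \<in> \<mu> \<Longrightarrow> g z = k z + 2 * h' z"
    using assms by (auto simp: cong2_def)
  thus ?thesis by (intro cong2_I[of "\<lambda>z. h z + h' z"]) auto
qed

lemma cong2_add: assumes "f \<approx> g" "f' \<approx> g'" shows "(\<lambda>z. f z + f' z) \<approx> (\<lambda>z. g z + g' z)"
proof -
  obtain h h' where "h \<in> R" "\<And>z. z \<in> \<mu> \<Longrightarrow> f z = g z + 2 * h z" "h' \<in> R" "\<And>z. z \<in> \<mu> \<Longrightarrow> f' z = g' z + 2 * h' z"
    using assms by (auto simp: cong2_def)
  thus ?thesis by (intro cong2_I[of "\<lambda>z. h z + h' z"]) auto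
qed

lemma cong2_uminus: assumes "f \<in> R" shows "(\<lambda>z. - f z) \<approx> f"
  by (rule cong2_I[of "\<lambda>z. - f z"]) (use assms in auto)

lemma cong2_mult: assumes "f \<approx> g" "f' \<approx> g'" "g \<in> R" "g' \<in> R"
  shows "(\<lambda>z. f z * f' z) \<approx> (\<lambda>z. g z * g' z)"
proof -
  obtain h h' where "h \<in> R" "\<And>z. z \<in> \<mu> \<Longrightarrow> f z = g z + 2 * h z" "h' \<in> R" "\<And>z. z \<in> \<mu> \<Longrightarrow> f' z = g' z + 2 * h' z"
    using assms by (auto simp: cong2_def)
  thus ?thesis using assms(3,4)
    by (intro cong2_I[of "\<lambda>z. g z * h' z + h z * g' z + 2 * (h z * h' z)"]) (auto simp: algebra_simps)
qed

lemma cong2_cnj: assumes "f \<approx> g" shows "(\<lambda>z. cnj (f z)) \<approx> (\<lambda>z. cnj (g z))"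
proof -
  obtain h where "h \<in> R" "\<And>z. z \<in> \<mu> \<Longrightarrow> f z = g z + 2 * h z" using assms by (auto simp: cong2_def)
  thus ?thesis by (intro cong2_I[of "\<lambda>z. cnj (h z)"]) auto
qed

lemma cong2_comp_power: assumes "f \<approx> g" shows "(\<lambda>z. f (z ^ k)) \<approx> (\<lambda>z. g (z ^ k))"
proof -
  obtain h where "h \<in> R" "\<And>z. z \<in> \<mu> \<Longrightarrow> f z = g z + 2 * h z" using assms by (auto simp: cong2_def)
  thus ?thesis by (intro cong2_I[of "\<lambda>z. h (z ^ k)"]) (auto simp: \<mu>_power intro: R_comp_power)
qed

lemma cong2_prod: "(\<And>i. i \<in> I \<Longrightarrow> f i \<approx> g i) \<Longrightarrow> (\<And>i. i \<in> I \<Longrightarrow> g i \<in> R) \<Longrightarrow>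
    (\<lambda>z. \<Prod>i\<in>I. f i z) \<approx> (\<lambda>z. \<Prod>i\<in>I. g i z)"
  by (induction I rule: infinite_finite_induct) (auto intro!: cong2_mult)

text \<open>A substitute for Galois invariance. By orthogonality the sum of z^(p-1) \<psi>(z) is p
  times an integer coefficient; the same sum is \<psi>(1) - \<beta>, so \<beta> is an integer
  congruent to \<psi>(1) modulo p.\<close>

lemma const_on_nontrivial_roots:
  assumes \<psi>: "\<psi> \<in> R" and const: "\<And>z. z \<in> \<mu> \<Longrightarrow> z \<noteq> 1 \<Longrightarrow> \<psi> z = \<beta>"
  obtains s t :: int where "\<psi> 1 = of_int s" "\<beta> = of_int (s - int p * t)"
proof -
  obtain c where c: "\<And>z. z \<in> \<mu> \<Longrightarrow> \<psi> z = (\<Sum>k<p. of_int (c k) * z ^ k)"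
    using R_normal_form[OF \<psi>] by blast
  obtain s where s: "\<psi> 1 = of_int s" using R_at_1[OF \<psi>] by blast
  \<comment> \<open>The weight belonging to the coefficient of index 1 is used: over z <> 1 it sums
    to -1, whereas the trivial weight would sum to p - 1 and call for a division.\<close>
  have "(\<Sum>z\<in>\<mu>. z ^ (p - 1) * \<psi> z) = (\<Sum>z\<in>\<mu>. \<Sum>k<p. of_int (c k) * z ^ (p - 1 + k))"
    by (intro sum.cong refl, simp only: c sum_distrib_left power_add mult_ac)
  also have "\<dots> = (\<Sum>k<p. of_int (c k) * (\<Sum>z\<in>\<mu>. z ^ (p - 1 + k)))"
    by (subst sum.swap) (simp add: sum_distrib_left)
  also have "\<dots> = (\<Sum>k<p. if k = 1 then of_int (c 1) * of_nat p else 0)"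
  proof (rule sum.cong[OF refl])
    fix k assume "k \<in> {..<p}"
    hence k: "k < p" by simp
    have "p dvd p - 1 + k \<longleftrightarrow> k = 1"
    proof
      assume "p dvd p - 1 + k"
      then obtain j where j: "p - 1 + k = p * j" by (rule dvdE)
      have "p * j < p * 2" using j k by linarith
      hence "j < 2" by (simp only: nat_mult_less_cancel_disj)
      moreover have "j \<noteq> 0" using j p_gt by (cases j) auto
      ultimately have "j = 1" by simp
      thus "k = 1" using j p_gt by simp
    qed (use p_gt in auto)
    thus "of_int (c k) * (\<Sum>z\<in>\<mu>. z ^ (p - 1 + k)) = (if k = 1 then of_int (c 1) * of_nat p else 0)"
      by (simp add: sum_\<mu>_power)
  qed
  also have "\<dots> = of_int (c 1) * of_nat p" using p_gt by simp
  finally have 1: "(\<Sum>z\<in>\<mu>. z ^ (p - 1) * \<psi> z) = of_int (c 1) * of_nat p" .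
  have sp: "(\<Sum>z\<in>\<mu>. g z) = g 1 + (\<Sum>z\<in>\<mu> - {1}. g z)" for g :: "complex \<Rightarrow> complex"
    by (rule sum.remove) auto
  have "(\<Sum>z\<in>\<mu> - {1}. z ^ (p - 1)) = -1"
  proof -
    have "\<not> p dvd p - 1" using p_gt by (auto dest: dvd_imp_le)
    hence "(\<Sum>z\<in>\<mu>. z ^ (p - 1)) = 0" by (simp add: sum_\<mu>_power)
    thus ?thesis using sp[of "\<lambda>z. z ^ (p - 1)"] by (simp add: add_eq_0_iff)
  qed
  moreover have "(\<Sum>z\<in>\<mu>. z ^ (p - 1) * \<psi> z) = \<psi> 1 + (\<Sum>z\<in>\<mu> - {1}. z ^ (p - 1)) * \<beta>"
    by (subst sp) (simp add: const sum_distrib_right)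
  ultimately have "\<beta> = of_int (s - int p * c 1)" using 1 s by (simp add: algebra_simps)
  thus ?thesis using that[OF s] by blast
qed

section \<open>Norms and half norms\<close>

definition nrm :: "(complex \<Rightarrow> complex) \<Rightarrow> complex" where
  "nrm f = (\<Prod>z\<in>\<mu> - {1}. f z)"

definition \<mu>up :: "complex set" where "\<mu>up = {z\<in>\<mu>. Im z > 0}"

text \<open>One root from each conjugate pair. For symmetric f in \<open>R\<close> this is the norm
  from the maximal real subfield of the p-th cyclotomic field.\<close>

definition hnrm :: "(complex \<Rightarrow> complex) \<Rightarrow> complex" where
  "hnrm f = (\<Prod>z\<in>\<mu>up. f z)"

definition sym :: "(complex \<Rightarrow> complex) \<Rightarrow> bool" where
  "sym f \<longleftrightarrow> (\<forall>z\<in>\<mu>. f (cnj z) = f z)"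

lemma finite_\<mu>up [simp]: "finite \<mu>up" by (simp add: \<mu>up_def)

lemma \<mu>_Im_nz: assumes "z \<in> \<mu>" "z \<noteq> 1" shows "Im z \<noteq> 0"
proof
  assume im: "Im z = 0"
  hence "cnj z = z" by (simp add: complex_eq_iff)
  hence "z ^ 2 = 1" using \<mu>_cnj_mult[OF assms(1)] by (simp add: power2_eq_square)
  hence "p dvd 2" using \<mu>_pow_eq_1_iff[OF assms] by blast
  thus False using p_gt by (auto dest: dvd_imp_le)
qed

lemma nrm_eq_hnrm_sq: assumes "sym f" shows "nrm f = (hnrm f)\<^sup>2"
proof -
  have "\<mu> - {1} = \<mu>up \<union> cnj ` \<mu>up" "\<mu>up \<inter> cnj ` \<mu>up = {}"
  proof -
    have "z \<in> cnj ` \<mu>up" if "z \<in> \<mu>" "z \<noteq> 1" "\<not> Im z > 0" for z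
      using that \<mu>_Im_nz[of z] \<mu>_cnj[of z] by (intro image_eqI[of _ _ "cnj z"]) (auto simp: \<mu>up_def)
    thus "\<mu> - {1} = \<mu>up \<union> cnj ` \<mu>up" by (auto simp: \<mu>up_def \<mu>_cnj)
    show "\<mu>up \<inter> cnj ` \<mu>up = {}" by (auto simp: \<mu>up_def)
  qed
  hence "nrm f = hnrm f * (\<Prod>z\<in>cnj ` \<mu>up. f z)"
    unfolding nrm_def hnrm_def by (simp add: prod.union_disjoint)
  also have "(\<Prod>z\<in>cnj ` \<mu>up. f z) = (\<Prod>z\<in>\<mu>up. f (cnj z))"
    by (subst prod.reindex) (auto simp: inj_on_def complex_cnj_cancel_iff)
  also have "\<dots> = hnrm f" unfolding hnrm_def
    by (rule prod.cong) (use assms in \<open>auto simp: sym_def \<mu>up_def\<close>)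
  finally show ?thesis by (simp add: power2_eq_square)
qed

text \<open>The powers z, ..., z^m of any nontrivial root meet each conjugate pair once, because i +
  j < p for i, j <= m. This exhibits the half norm as the constant value off 1 of a function that is
  visibly in \<open>R\<close>.\<close>

lemma hnrm_eq_prod_powers:
  assumes f: "sym f" and z: "z \<in> \<mu>" "z \<noteq> 1"
  shows "(\<Prod>j = 1..m. f (z ^ j)) = hnrm f"
proof -
  define r where "r u = (if Im u > 0 then u else cnj u)" for u
  have "bij_betw (\<lambda>j. r (z ^ j)) {1..m} \<mu>up"
    unfolding bij_betw_def
  proof
    show "inj_on (\<lambda>j. r (z ^ j)) {1..m}"
    proof (rule inj_onI)
      fix i j assume ij: "i \<in> {1..m}" "j \<in> {1..m}" and eq: "r (z ^ i) = r (z ^ j)"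
      have lt: "i < p" "j < p" "i + j < p" using ij p_eq by auto
      from eq have "z ^ i = z ^ j \<or> z ^ i = cnj (z ^ j)"
        unfolding r_def by (metis complex_cnj_cnj)
      thus "i = j"
      proof
        assume "z ^ i = z ^ j"
        thus ?thesis using bij_power[OF z] lt by (auto simp: bij_betw_def inj_on_def)
      next
        assume "z ^ i = cnj (z ^ j)"
        hence "z ^ (i + j) = 1" using \<mu>_cnj_mult[OF \<mu>_power[OF z(1), of j]] by (simp add: power_add mult.commute)
        hence "p dvd i + j" using \<mu>_pow_eq_1_iff[OF z] by blast
        thus ?thesis using lt ij by (auto dest: dvd_imp_le)
      qed
    qed
    show "(\<lambda>j. r (z ^ j)) ` {1..m} = \<mu>up"
    proof
      show "(\<lambda>j. r (z ^ j)) ` {1..m} \<subseteq> \<mu>up"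
      proof safe
        fix j assume j: "j \<in> {1..m}"
        have "z ^ j \<noteq> 1" unfolding \<mu>_pow_eq_1_iff[OF z] using j p_eq by (auto dest: dvd_imp_le)
        thus "r (z ^ j) \<in> \<mu>up"
          using \<mu>_Im_nz[OF \<mu>_power[OF z(1)], of j] \<mu>_power[OF z(1), of j] \<mu>_cnj[OF \<mu>_power[OF z(1), of j]]
          by (auto simp: \<mu>up_def r_def simp del: complex_cnj_power)
      qed
      show "\<mu>up \<subseteq> (\<lambda>j. r (z ^ j)) ` {1..m}"
      proof
        fix t assume t: "t \<in> \<mu>up"
        hence "t \<in> \<mu>" "Im t > 0" by (auto simp: \<mu>up_def)
        then obtain k where k: "k < p" "t = z ^ k" using bij_power[OF z] by (auto simp: bij_betw_def)
        have "k \<noteq> 0" using k \<open>Im t > 0\<close> by (cases k) auto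
        show "t \<in> (\<lambda>j. r (z ^ j)) ` {1..m}"
        proof (cases "k \<le> m")
          case True
          thus ?thesis using k \<open>k \<noteq> 0\<close> \<open>Im t > 0\<close> by (intro image_eqI[of _ _ k]) (auto simp: r_def)
        next
          case False
          have "z ^ (p - k) * z ^ k = 1" using k \<mu>_pow_p[OF z(1)] by (simp add: power_add[symmetric])
          hence "z ^ (p - k) = cnj t" using \<mu>_cnj_mult[OF \<open>t \<in> \<mu>\<close>] k
            by (metis mult.commute mult.left_neutral mult.assoc)
          hence "r (z ^ (p - k)) = t" using \<open>Im t > 0\<close> by (simp add: r_def del: complex_cnj_power)
          moreover have "p - k \<in> {1..m}" using False k p_eq by auto
          ultimately show ?thesis by blast
        qed
      qed
    qed
  qed
  hence "hnrm f = (\<Prod>j = 1..m. f (r (z ^ j)))"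
    unfolding hnrm_def by (rule prod.reindex_bij_betw[symmetric])
  also have "\<dots> = (\<Prod>j = 1..m. f (z ^ j))"
    by (rule prod.cong) (use f \<mu>_power[OF z(1)] in \<open>auto simp: r_def sym_def simp del: complex_cnj_power\<close>)
  finally show ?thesis ..
qed

text \<open>The product of the f(z^j) lies in \<open>R\<close> and is constant off 1; at 1 each of
  its m factors is a.\<close>

lemma hnrm_int:
  assumes f: "f \<in> R" "sym f" and f1: "f 1 = of_int a"
  obtains A :: int where "hnrm f = of_int A" "[A = a ^ m] (mod int p)"
proof -
  define \<psi> where "\<psi> z = (\<Prod>j = 1..m. f (z ^ j))" for z
  have "\<psi> \<in> R" unfolding \<psi>_def using f by (intro R_prod R_comp_power)
  then obtain s t where st: "\<psi> 1 = of_int s" "hnrm f = of_int (s - int p * t)"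
    using hnrm_eq_prod_powers[OF f(2)] const_on_nontrivial_roots[of \<psi> "hnrm f"] by (auto simp: \<psi>_def)
  have "\<psi> 1 = of_int (a ^ m)" by (simp add: \<psi>_def f1)
  hence "s = a ^ m" using st by (metis of_int_eq_iff)
  thus ?thesis using that[OF st(2)] by (simp add: cong_iff_dvd_diff)
qed

text \<open>Half the difference of the two products is an h in \<open>R\<close> that is constant off
  1, so its value (A - B)/2 there is an integer by \<open>const_on_nontrivial_roots\<close>.\<close>

lemma hnrm_cong2:
  assumes "f \<in> R" "g \<in> R" "sym f" "sym g" "f \<approx> g" "hnrm f = of_int A" "hnrm g = of_int B"
  shows "even (A - B)"
proof -
  define \<psi> where "\<psi> h z = (\<Prod>j = 1..m. h (z ^ j) :: complex)" for h :: "complex \<Rightarrow> complex" and z :: complex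
  have "\<psi> f \<approx> \<psi> g" unfolding \<psi>_def
    by (intro cong2_prod cong2_comp_power assms R_comp_power)
  then obtain h where h: "h \<in> R" "\<And>z. z \<in> \<mu> \<Longrightarrow> \<psi> f z = \<psi> g z + 2 * h z" by (auto simp: cong2_def)
  have "h z = of_int (A - B) / 2" if "z \<in> \<mu>" "z \<noteq> 1" for z
  proof -
    have "\<psi> f z = of_int A" "\<psi> g z = of_int B"
      using hnrm_eq_prod_powers[OF assms(3) that] hnrm_eq_prod_powers[OF assms(4) that] assms(6,7)
      by (simp_all add: \<psi>_def)
    hence "of_int A = of_int B + 2 * h z" using h(2)[OF that(1)] by simp
    thus ?thesis by simp
  qed
  then obtain s t where "complex_of_int (A - B) / 2 = of_int (s - int p * t)"
    using const_on_nontrivial_roots[OF h(1)] by metis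
  hence "complex_of_int (A - B) = of_int (2 * (s - int p * t))" by simp
  hence "A - B = 2 * (s - int p * t)" by (simp only: of_int_eq_iff)
  thus ?thesis by simp
qed

section \<open>Determinant values as products over roots of unity\<close>

text \<open>The 2p-th roots of unity are \<mu> and -\<mu>, and z^p is 1 on the first and -1 on the
  second, which decides the sign of the second square. f1, g1 stand for values at z, and f2, g2 for
  values at -z.\<close>

definition dval :: "(complex \<Rightarrow> complex) \<Rightarrow> (complex \<Rightarrow> complex) \<Rightarrow> (complex \<Rightarrow> complex) \<Rightarrow> (complex \<Rightarrow> complex) \<Rightarrow> complex" where
  "dval f1 g1 f2 g2 = (\<Prod>z\<in>\<mu>. f1 z * cnj (f1 z) - g1 z * cnj (g1 z)) *
     (\<Prod>z\<in>\<mu>. f2 z * cnj (f2 z) + g2 z * cnj (g2 z))"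

abbreviation "S \<equiv> det_values (dicyclic p)"

lemma dval_cong:
  assumes "\<And>z. z \<in> \<mu> \<Longrightarrow> f1 z = f1' z" "\<And>z. z \<in> \<mu> \<Longrightarrow> g1 z = g1' z"
    "\<And>z. z \<in> \<mu> \<Longrightarrow> f2 z = f2' z" "\<And>z. z \<in> \<mu> \<Longrightarrow> g2 z = g2' z"
  shows "dval f1 g1 f2 g2 = dval f1' g1' f2' g2'"
  unfolding dval_def by (intro arg_cong2[of _ _ _ _ "(*)"] prod.cong refl) (simp_all add: assms)

lemma \<mu>_uminus_pow: "z \<in> \<mu> \<Longrightarrow> (- z) ^ p = - 1"
  using odd_p by (simp add: \<mu>_pow_p)

lemma roots_2p: "{z. z ^ (2 * p) = 1} = \<mu> \<union> uminus ` \<mu>" "\<mu> \<inter> uminus ` \<mu> = {}"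
proof -
  have "z ^ (2 * p) = 1 \<longleftrightarrow> z ^ p = 1 \<or> z ^ p = -1" for z :: complex
    by (simp add: mult.commute[of 2] power_mult power2_eq_1_iff)
  moreover have "z ^ p = -1 \<longleftrightarrow> - z \<in> \<mu>" for z
    using odd_p by (auto simp: \<mu>_def minus_equation_iff[of _ 1])
  moreover have "- z \<in> \<mu> \<longleftrightarrow> z \<in> uminus ` \<mu>" for z by force
  ultimately show "{z. z ^ (2 * p) = 1} = \<mu> \<union> uminus ` \<mu>" by (auto simp: \<mu>_def)
  show "\<mu> \<inter> uminus ` \<mu> = {}"
    using \<mu>_uminus_pow \<mu>_pow_p by (auto simp: image_iff) fastforce
qed

text \<open>Only the terms of odd degree change sign under z -> -z, so f(z) - f(-z) is twice the odd
  part.\<close>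

lemma poly_fun_R:
  fixes c :: "nat \<Rightarrow> int" and M :: nat
  defines "f \<equiv> \<lambda>z. \<Sum>j<M. of_int (c j) * z ^ j"
  shows "f \<in> R" "(\<lambda>z. f (- z)) \<in> R" "f \<approx> (\<lambda>z. f (- z))"
proof -
  show "f \<in> R" unfolding f_def by auto
  have eq: "f (- z) = (\<Sum>j<M. of_int (c j * (-1) ^ j) * z ^ j)" for z
    unfolding f_def by (rule sum.cong) (auto simp: power_minus[of z])
  show "(\<lambda>z. f (- z)) \<in> R" unfolding eq by auto
  define h where "h z = (\<Sum>j<M. of_int (if odd j then c j else 0) * z ^ j)" for z :: complex
  show "f \<approx> (\<lambda>z. f (- z))"
  proof (rule cong2_I)
    show "h \<in> R" unfolding h_def by auto
    fix z
    show "f z = f (- z) + 2 * h z"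
      unfolding f_def h_def sum_distrib_left sum.distrib[symmetric] by (rule sum.cong) auto
  qed
qed

lemma lift_pair:
  assumes "f1 \<in> R" "f2 \<in> R" "f1 \<approx> f2"
  obtains c :: "nat \<Rightarrow> int" where
    "\<And>z. z \<in> \<mu> \<Longrightarrow> (\<Sum>j<2 * p. of_int (c j) * z ^ j) = f1 z"
    "\<And>z. z \<in> \<mu> \<Longrightarrow> (\<Sum>j<2 * p. of_int (c j) * (- z) ^ j) = f2 z"
proof -
  obtain h where h: "h \<in> R" "\<And>z. z \<in> \<mu> \<Longrightarrow> f1 z = f2 z + 2 * h z" using assms by (auto simp: cong2_def)
  obtain q where q: "\<And>z. z \<in> \<mu> \<Longrightarrow> f2 z = poly (of_int_poly q) z" using assms(2) unfolding R_def by blast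
  obtain r where r: "\<And>z. z \<in> \<mu> \<Longrightarrow> h z = poly (of_int_poly r) z" using h(1) unfolding R_def by blast
  let ?m = "Polynomial.monom 1 :: nat \<Rightarrow> int poly"
  \<comment> \<open>The substitution x^(p+1) takes the same value at z and at -z, and 1 + x^p is 2 at z and 0 at -z.\<close>
  define F where "F = pcompose q (?m (p + 1)) + (1 + ?m p) * pcompose r (?m (p + 1))"
  have F: "poly (of_int_poly F) y = poly (of_int_poly q) (y ^ (p + 1)) + (1 + y ^ p) * poly (of_int_poly r) (y ^ (p + 1))" for y :: complex
    unfolding F_def by (simp add: of_int_poly_hom.hom_add of_int_poly_hom.hom_mult of_int_hom.map_poly_pcompose
        poly_pcompose map_poly_monom poly_monom)
  obtain c where c: "\<And>y :: complex. y ^ (2 * p) = 1 \<Longrightarrow> poly (of_int_poly F) y = (\<Sum>k<2 * p. of_int (c k) * y ^ k)"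
    using poly_eq_sum_mod_roots_of_unity[of "2 * p" F] p_gt by auto
  show ?thesis
  proof
    fix z assume z: "z \<in> \<mu>"
    have y: "z ^ (2 * p) = 1" "(- z) ^ (2 * p) = 1" "z ^ (p + 1) = z" "(- z) ^ (p + 1) = z" "(- z) ^ p = -1"
      using z roots_2p(1) \<mu>_pow_p[OF z] \<mu>_uminus_pow[OF z] by (auto simp: power_add)
    show "(\<Sum>j<2 * p. of_int (c j) * z ^ j) = f1 z"
      unfolding c[OF y(1), symmetric] F y(3) using h(2)[OF z] q[OF z] r[OF z] \<mu>_pow_p[OF z] by simp
    show "(\<Sum>j<2 * p. of_int (c j) * (- z) ^ j) = f2 z"
      unfolding c[OF y(2), symmetric] F y(4,5) using q[OF z] by simp
  qed
qed

lemma group_det_eq_dval: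
  fixes x :: "int \<times> int \<Rightarrow> int"
  defines "f \<equiv> \<lambda>b z. \<Sum>j<2 * p. of_int (x (int j, b)) * z ^ j :: complex"
  shows "of_int (group_det (dicyclic p) x) = dval (f 0) (f 1) (\<lambda>z. f 0 (- z)) (\<lambda>z. f 1 (- z))"
proof -
  let ?h = "\<lambda>z. f 0 z * f 0 (inverse z) - z ^ p * f 1 z * f 1 (inverse z)"
  have R: "f b \<in> R" "(\<lambda>z. f b (- z)) \<in> R" for b
    unfolding f_def by (rule poly_fun_R)+
  have "of_int (group_det (dicyclic p) x) = (\<Prod>z\<in>\<mu> \<union> uminus ` \<mu>. ?h z)"
    unfolding group_det_dicyclic[OF p_gt(2)] roots_2p(1) f_def by (rule refl)
  also have "\<dots> = (\<Prod>z\<in>\<mu>. ?h z) * (\<Prod>z\<in>\<mu>. ?h (- z))"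
    by (subst prod.union_disjoint) (use roots_2p(2) in \<open>auto simp: prod.reindex inj_on_def\<close>)
  also have "(\<Prod>z\<in>\<mu>. ?h z) = (\<Prod>z\<in>\<mu>. f 0 z * cnj (f 0 z) - f 1 z * cnj (f 1 z))"
    by (rule prod.cong) (auto simp: \<mu>_inverse \<mu>_pow_p R_at_cnj[OF R(1)])
  also have "(\<Prod>z\<in>\<mu>. ?h (- z)) = (\<Prod>z\<in>\<mu>. f 0 (- z) * cnj (f 0 (- z)) + f 1 (- z) * cnj (f 1 (- z)))"
  proof (rule prod.cong[OF refl])
    fix z assume z: "z \<in> \<mu>"
    show "?h (- z) = f 0 (- z) * cnj (f 0 (- z)) + f 1 (- z) * cnj (f 1 (- z))"
      using R_at_cnj[OF R(2) z, of 0] R_at_cnj[OF R(2) z, of 1] \<mu>_uminus_pow[OF z]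
      by (simp add: inverse_minus_eq \<mu>_inverse[OF z])
  qed
  finally show ?thesis by (simp add: dval_def)
qed

lemma S_I:
  assumes "f1 \<in> R" "g1 \<in> R" "f2 \<in> R" "g2 \<in> R" "f1 \<approx> f2" "g1 \<approx> g2" "of_int d = dval f1 g1 f2 g2"
  shows "d \<in> S"
proof -
  obtain c where c: "\<And>z. z \<in> \<mu> \<Longrightarrow> (\<Sum>j<2 * p. of_int (c j) * z ^ j) = f1 z"
    "\<And>z. z \<in> \<mu> \<Longrightarrow> (\<Sum>j<2 * p. of_int (c j) * (- z) ^ j) = f2 z"
    using lift_pair[OF assms(1,3,5)] by blast
  obtain c' where c': "\<And>z. z \<in> \<mu> \<Longrightarrow> (\<Sum>j<2 * p. of_int (c' j) * z ^ j) = g1 z"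
    "\<And>z. z \<in> \<mu> \<Longrightarrow> (\<Sum>j<2 * p. of_int (c' j) * (- z) ^ j) = g2 z"
    using lift_pair[OF assms(2,4,6)] by blast
  define x where "x = (\<lambda>(a :: int, b :: int). if b = 0 then c (nat a) else c' (nat a))"
  have "complex_of_int (group_det (dicyclic p) x) = dval f1 g1 f2 g2"
    unfolding group_det_eq_dval by (rule dval_cong) (simp_all add: x_def c c')
  hence "group_det (dicyclic p) x = d" using assms(7) by (metis of_int_eq_iff)
  thus ?thesis unfolding det_values_def by blast
qed

lemma S_E:
  assumes "d \<in> S"
  obtains f1 g1 f2 g2 where "f1 \<in> R" "g1 \<in> R" "f2 \<in> R" "g2 \<in> R" "f1 \<approx> f2" "g1 \<approx> g2"
    "of_int d = dval f1 g1 f2 g2"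
proof -
  obtain x where x: "d = group_det (dicyclic p) x" using assms by (auto simp: det_values_def)
  show ?thesis
    by (rule that[OF _ _ _ _ _ _ group_det_eq_dval[of x, folded x]]) (rule poly_fun_R)+
qed

text \<open>The formulas come from the product (f + g J)(F + G J) with J F = cnj F J, where J^2 = 1
  for the first pair and J^2 = -1 for the second. The two versions differ by a sign only, which is
  invisible modulo 2.\<close>

lemma S_mult: assumes "d \<in> S" "d' \<in> S" shows "d * d' \<in> S"
proof -
  obtain f1 g1 f2 g2 where f: "f1 \<in> R" "g1 \<in> R" "f2 \<in> R" "g2 \<in> R" "f1 \<approx> f2" "g1 \<approx> g2"
    "of_int d = dval f1 g1 f2 g2" by (rule S_E[OF assms(1)]) (rule that)
  obtain F1 G1 F2 G2 where F: "F1 \<in> R" "G1 \<in> R" "F2 \<in> R" "G2 \<in> R" "F1 \<approx> F2" "G1 \<approx> G2"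
    "of_int d' = dval F1 G1 F2 G2" by (rule S_E[OF assms(2)]) (rule that)
  show ?thesis
  proof (rule S_I)
    let ?A = "\<lambda>z. f1 z * F1 z + g1 z * cnj (G1 z)" and ?B = "\<lambda>z. f1 z * G1 z + g1 z * cnj (F1 z)"
    let ?C = "\<lambda>z. f2 z * F2 z + - (g2 z * cnj (G2 z))" and ?D = "\<lambda>z. f2 z * G2 z + g2 z * cnj (F2 z)"
    show "?A \<in> R" "?B \<in> R" "?C \<in> R" "?D \<in> R"
      by (intro R_add R_mult R_uminus R_cnj f F)+
    have "(\<lambda>z. g1 z * cnj (G1 z)) \<approx> (\<lambda>z. g2 z * cnj (G2 z))"
      by (intro cong2_mult cong2_cnj f F R_cnj)
    also have "\<dots> \<approx> (\<lambda>z. - (g2 z * cnj (G2 z)))"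
      by (rule cong2_sym[OF cong2_uminus]) (use f F in auto)
    finally show "?A \<approx> ?C" by (intro cong2_add cong2_mult f F)
    show "?B \<approx> ?D" by (intro cong2_add cong2_mult cong2_cnj R_cnj f F)
    have "(\<Prod>z\<in>\<mu>. ?A z * cnj (?A z) - ?B z * cnj (?B z)) =
       (\<Prod>z\<in>\<mu>. f1 z * cnj (f1 z) - g1 z * cnj (g1 z)) * (\<Prod>z\<in>\<mu>. F1 z * cnj (F1 z) - G1 z * cnj (G1 z))"
      unfolding prod.distrib[symmetric] by (rule prod.cong[OF refl]) (simp add: algebra_simps)
    moreover have "(\<Prod>z\<in>\<mu>. ?C z * cnj (?C z) + ?D z * cnj (?D z)) =
       (\<Prod>z\<in>\<mu>. f2 z * cnj (f2 z) + g2 z * cnj (g2 z)) * (\<Prod>z\<in>\<mu>. F2 z * cnj (F2 z) + G2 z * cnj (G2 z))"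
      unfolding prod.distrib[symmetric] by (rule prod.cong[OF refl]) (simp add: algebra_simps)
    ultimately show "of_int (d * d') = dval ?A ?B ?C ?D"
      unfolding of_int_mult f(7) F(7) dval_def by (simp only: mult_ac)
  qed
qed

lemma S_minus_one: "-1 \<in> S"
  by (rule S_I[of "\<lambda>_. 0" "\<lambda>_. 1" "\<lambda>_. 0" "\<lambda>_. 1"]) (auto simp: dval_def card_\<mu> odd_p)

lemma S_uminus: "d \<in> S \<Longrightarrow> - d \<in> S"
  using S_mult[OF S_minus_one] by simp

lemma S_sign: "\<epsilon> = 1 \<or> \<epsilon> = -1 \<Longrightarrow> \<epsilon> * d \<in> S \<Longrightarrow> d \<in> S"
  using S_uminus[of "\<epsilon> * d"] by auto

lemma S_one: "1 \<in> S"
  using S_uminus[OF S_minus_one] by simp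

lemma S_zero: "0 \<in> S"
  by (rule S_I[of "\<lambda>_. 0" "\<lambda>_. 0" "\<lambda>_. 0" "\<lambda>_. 0"]) (use p_gt in \<open>auto simp: dval_def card_\<mu>\<close>)

lemma prod_\<mu>: "(\<Prod>z\<in>\<mu>. f z) = f 1 * nrm f"
  unfolding nrm_def by (rule prod.remove) auto

lemma nrm_mult: "nrm (\<lambda>z. f z * g z) = nrm f * nrm g"
  by (simp add: nrm_def prod.distrib)

lemma nrm_cong: "(\<And>z. z \<in> \<mu> \<Longrightarrow> z \<noteq> 1 \<Longrightarrow> f z = g z) \<Longrightarrow> nrm f = nrm g"
  unfolding nrm_def by (rule prod.cong) auto

definition \<Phi> :: "complex \<Rightarrow> complex" where "\<Phi> z = (\<Sum>k<p. z ^ k)"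

lemma \<Phi>_R [simp, intro!]: "\<Phi> \<in> R" unfolding \<Phi>_def[abs_def] by auto

lemma \<Phi>_1 [simp]: "\<Phi> 1 = of_nat p" by (simp add: \<Phi>_def)

lemma \<Phi>_0: "z \<in> \<mu> \<Longrightarrow> z \<noteq> 1 \<Longrightarrow> \<Phi> z = 0"
  by (simp add: \<Phi>_def geometric_sum \<mu>_pow_p)

text \<open>Adding the same 2w to e and to 0 keeps the difference of squared moduli factored:
  |e + 2w|^2 - |2w|^2 = e u for real e. The multiples of \<open>\<Phi>\<close> only affect the value at 1.\<close>

lemma S_construct:
  fixes \<alpha> \<beta> \<gamma> \<delta> :: int
  assumes R: "e \<in> R" "w \<in> R" "e' \<in> R" and real: "\<And>z. z \<in> \<mu> \<Longrightarrow> cnj (e z) = e z"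
    and cong: "e \<approx> e'" and par: "even (\<alpha> - \<gamma>)" "even (\<beta> - \<delta>)"
    and u: "\<And>z. z \<in> \<mu> \<Longrightarrow> u z = e z + 2 * (w z + cnj (w z))"
    and at1: "e 1 = of_int e1" "u 1 = of_int u1" "e' 1 = of_int e1'"
    and nrm: "nrm e * nrm u * nrm (\<lambda>z. e' z * cnj (e' z)) = of_int K"
    and d: "d = (e1 + (\<alpha> - \<beta>) * int p) * (u1 + (\<alpha> + \<beta>) * int p) * ((e1' + \<gamma> * int p)\<^sup>2 + (\<delta> * int p)\<^sup>2) * K"
  shows "d \<in> S"
proof -
  define f1 where "f1 z = e z + (2 * w z + of_int \<alpha> * \<Phi> z)" for z
  define g1 where "g1 z = 2 * w z + of_int \<beta> * \<Phi> z" for z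
  define f2 where "f2 z = e' z + of_int \<gamma> * \<Phi> z" for z
  \<comment> \<open>The second square vanishes off 1, so the sum of squares is just |e'|^2
    there.\<close>
  define g2 where "g2 z = of_int \<delta> * \<Phi> z" for z
  have c: "(\<lambda>z. 2 * w z + of_int a * \<Phi> z) \<approx> (\<lambda>z. of_int b * \<Phi> z)" if "even (a - b)" for a b :: int
  proof -
    obtain k where "a - b = 2 * k" using \<open>even (a - b)\<close> by (rule evenE)
    hence "a = b + 2 * k" by simp
    thus ?thesis by (intro cong2_I[of "\<lambda>z. w z + of_int k * \<Phi> z"]) (use R in \<open>auto simp: algebra_simps\<close>)
  qed
  obtain w1 :: int where w1: "w 1 = of_int w1" using R_at_1[OF R(2)] by blast
  \<comment> \<open>This factors the value at 1 as well: f1(1) - g1(1) = e1 + (\<alpha> - \<beta>) p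
    and f1(1) + g1(1) = u1 + (\<alpha> + \<beta>) p.\<close>
  have u1: "u1 = e1 + 4 * w1"
  proof -
    have "of_int u1 = (of_int (e1 + 4 * w1) :: complex)" using u[OF one_in_\<mu>] at1 w1 by simp
    thus ?thesis by (simp only: of_int_eq_iff)
  qed
  show ?thesis
  proof (rule S_I)
    show "f1 \<in> R" "g1 \<in> R" "f2 \<in> R" "g2 \<in> R"
      unfolding f1_def[abs_def] g1_def[abs_def] f2_def[abs_def] g2_def[abs_def] using R by auto
    show "f1 \<approx> f2" unfolding f1_def[abs_def] f2_def[abs_def] by (intro cong2_add cong c par)
    show "g1 \<approx> g2" unfolding g1_def[abs_def] g2_def[abs_def] by (intro c par)
    have "(\<Prod>z\<in>\<mu>. f1 z * cnj (f1 z) - g1 z * cnj (g1 z)) =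
        (f1 1 * cnj (f1 1) - g1 1 * cnj (g1 1)) * nrm (\<lambda>z. f1 z * cnj (f1 z) - g1 z * cnj (g1 z))"
      by (rule prod_\<mu>)
    also have "nrm (\<lambda>z. f1 z * cnj (f1 z) - g1 z * cnj (g1 z)) = nrm (\<lambda>z. e z * u z)"
      by (rule nrm_cong) (simp add: f1_def g1_def \<Phi>_0 real u algebra_simps)
    also have "f1 1 * cnj (f1 1) - g1 1 * cnj (g1 1) = of_int ((e1 + (\<alpha> - \<beta>) * int p) * (u1 + (\<alpha> + \<beta>) * int p))"
      by (simp add: f1_def g1_def at1 w1 u1 algebra_simps)
    finally have 1: "(\<Prod>z\<in>\<mu>. f1 z * cnj (f1 z) - g1 z * cnj (g1 z)) =
       of_int ((e1 + (\<alpha> - \<beta>) * int p) * (u1 + (\<alpha> + \<beta>) * int p)) * (nrm e * nrm u)"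
      by (simp only: nrm_mult)
    have "(\<Prod>z\<in>\<mu>. f2 z * cnj (f2 z) + g2 z * cnj (g2 z)) =
        (f2 1 * cnj (f2 1) + g2 1 * cnj (g2 1)) * nrm (\<lambda>z. f2 z * cnj (f2 z) + g2 z * cnj (g2 z))"
      by (rule prod_\<mu>)
    also have "nrm (\<lambda>z. f2 z * cnj (f2 z) + g2 z * cnj (g2 z)) = nrm (\<lambda>z. e' z * cnj (e' z))"
      by (rule nrm_cong) (simp add: f2_def g2_def \<Phi>_0)
    also have "f2 1 * cnj (f2 1) + g2 1 * cnj (g2 1) = of_int ((e1' + \<gamma> * int p)\<^sup>2 + (\<delta> * int p)\<^sup>2)"
      by (simp add: f2_def g2_def at1 power2_eq_square)
    finally show "of_int d = dval f1 g1 f2 g2"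
      unfolding dval_def 1 d of_int_mult nrm[symmetric] by (simp only: mult_ac)
  qed
qed

end

section \<open>Norms of cyclotomic units\<close>

text \<open>On the unit circle, off 1, this is (z^(2t+1) - 1) / (z^t (z - 1)): a real cyclotomic
  unit at the nontrivial p-th roots of unity if p does not divide 2t + 1.\<close>

primrec eps :: "nat \<Rightarrow> complex \<Rightarrow> complex" where
  "eps 0 z = 1"
| "eps (Suc t) z = eps t z + (z ^ Suc t + cnj z ^ Suc t)"

text \<open>This is \<open>eps t\<close> at -z. It agrees with \<open>eps t\<close> modulo 2 but is
  (-1)^t instead of 2t + 1 at 1; the constructions exploit that gap.\<close>

primrec alt :: "nat \<Rightarrow> complex \<Rightarrow> complex" where
  "alt 0 z = 1"
| "alt (Suc t) z = alt t z + (- 1) ^ Suc t * (z ^ Suc t + cnj z ^ Suc t)"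

text \<open>For this h, \<open>eps t\<close> minus \<open>alt t\<close> is 2 (h + cnj h), the shape
  that \<open>S_construct\<close> asks of u - e.\<close>

primrec odd_powers :: "nat \<Rightarrow> complex \<Rightarrow> complex" where
  "odd_powers 0 z = 0"
| "odd_powers (Suc t) z = odd_powers t z + (if even t then z ^ Suc t else 0)"

lemma eps_alt_cnj [simp]: "cnj (eps t z) = eps t z" "cnj (alt t z) = alt t z"
  by (induction t) (auto simp: add_ac)

lemma eps_1 [simp]: "eps t 1 = of_int (2 * int t + 1)"
  by (induction t) auto

lemma alt_1 [simp]: "alt t 1 = of_int ((- 1) ^ t)"
  by (induction t) auto

lemma alt_eq_eps: "alt t z = eps t z - 2 * (odd_powers t z + cnj (odd_powers t z))"
  by (induction t) (auto simp: algebra_simps)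

lemma eps_mult: assumes "z * cnj z = 1" shows "(z - 1) * eps t z = z ^ Suc t - cnj z ^ t"
proof (induction t)
  case (Suc t)
  have "(z - 1) * eps (Suc t) z = z ^ Suc t - cnj z ^ t + z * z ^ Suc t - z ^ Suc t + (z * cnj z) * cnj z ^ t - cnj z ^ Suc t"
    using Suc by (simp add: algebra_simps)
  thus ?case by (simp add: assms)
qed simp

lemma alt_mult: assumes "z * cnj z = 1" shows "(z + 1) * alt t z = (- 1) ^ t * (z ^ Suc t + cnj z ^ t)"
proof (induction t)
  case (Suc t)
  have "(z + 1) * alt (Suc t) z = (- 1) ^ t * (z ^ Suc t + cnj z ^ t) -
      (- 1) ^ t * (z * z ^ Suc t + z ^ Suc t + (z * cnj z) * cnj z ^ t + cnj z ^ Suc t)"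
    using Suc by (simp add: algebra_simps)
  thus ?case by (simp add: assms algebra_simps)
qed simp

context prime_roots
begin

lemma eps_R [simp, intro!]: "eps t \<in> R"
proof (induction t)
  case (Suc t)
  show ?case unfolding eps.simps(2)[abs_def] using Suc by auto
qed auto

lemma alt_R [simp, intro!]: "alt t \<in> R"
proof (induction t)
  case (Suc t)
  have "(\<lambda>z. of_int ((- 1) ^ Suc t) * (z ^ Suc t + cnj z ^ Suc t)) \<in> R"
    by (intro R_mult R_of_int R_add R_power R_cnj R_id)
  thus ?case unfolding alt.simps(2)[abs_def] using Suc by auto
qed auto

lemma odd_powers_R [simp, intro!]: "odd_powers t \<in> R"
proof (induction t)
  case (Suc t)
  thus ?case unfolding odd_powers.simps(2)[abs_def] by (cases "even t") auto
qed auto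

lemma alt_cong_eps: "alt t \<approx> eps t"
  by (rule cong2_I[of "\<lambda>z. - (odd_powers t z + cnj (odd_powers t z))"]) (auto simp: alt_eq_eps)

lemma pow_p: "x ^ p = x * (x\<^sup>2) ^ m" for x :: "'a :: monoid_mult"
  by (metis Suc_eq_plus1 p_eq power_Suc power_mult)

lemma nrm_cnj: "nrm (\<lambda>z. cnj (f z)) = cnj (nrm f)"
  by (simp add: nrm_def)

lemma card_nontrivial: "card (\<mu> - {1}) = 2 * m"
  using card_\<mu> p_eq by (simp add: card_Diff_singleton)

lemma nrm_const: "nrm (\<lambda>z. c) = c ^ (2 * m)"
  by (simp add: nrm_def card_nontrivial)

lemma nrm_sign [simp]: "nrm (\<lambda>z. (- 1) ^ k) = 1"
  by (simp add: nrm_const power_mult[symmetric] mult.commute)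

lemma nrm_one [simp]: "nrm (\<lambda>z. 1) = 1" by (simp add: nrm_def)

lemma nrm_power: "nrm (\<lambda>z. f z ^ k) = nrm f ^ k"
  by (simp add: nrm_def prod_power_distrib)

text \<open>The square is 1 because conjugation permutes the roots, the p-th power is 1 because each
  factor has p-th power 1, and p is odd.\<close>

lemma nrm_id: "nrm (\<lambda>z. z) = 1"
proof -
  have "nrm (\<lambda>z. z) = nrm (\<lambda>z. cnj z)" unfolding nrm_def
    by (rule prod.reindex_bij_witness[of _ cnj cnj]) (auto simp: \<mu>_cnj)
  hence "nrm (\<lambda>z. z) * nrm (\<lambda>z. z) = nrm (\<lambda>z. z * cnj z)" by (simp add: nrm_mult)
  also have "\<dots> = nrm (\<lambda>z. 1)" by (rule nrm_cong) (rule \<mu>_cnj_mult)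
  finally have sq: "nrm (\<lambda>z. z) ^ 2 = 1" by (simp add: power2_eq_square)
  have "nrm (\<lambda>z. z) ^ p = nrm (\<lambda>z. z ^ p)" by (simp add: nrm_power)
  also have "\<dots> = nrm (\<lambda>z. 1)" by (rule nrm_cong) (rule \<mu>_pow_p)
  finally have "nrm (\<lambda>z. z) * (nrm (\<lambda>z. z) ^ 2) ^ m = 1" by (simp add: pow_p)
  thus ?thesis by (simp add: sq)
qed

lemma nrm_monom: "nrm (\<lambda>z. z ^ k) = 1" "nrm (\<lambda>z. cnj z ^ k) = 1"
proof -
  show 1: "nrm (\<lambda>z. z ^ k) = 1" by (simp add: nrm_power nrm_id)
  show "nrm (\<lambda>z. cnj z ^ k) = 1" using nrm_cnj[of "\<lambda>z. z ^ k"] 1 by simp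
qed

text \<open>The map z -> z^a permutes the nontrivial roots; it is the Galois action.\<close>

lemma nrm_comp_power:
  assumes "\<not> p dvd a" shows "nrm (\<lambda>z. f (z ^ a)) = nrm f"
proof -
  have "inj_on (\<lambda>z. z ^ a) \<mu>"
  proof (rule inj_onI)
    fix y z assume yz: "y \<in> \<mu>" "z \<in> \<mu>" "y ^ a = z ^ a"
    have "(y * cnj z) ^ a = 1"
      using yz \<mu>_cnj_mult[OF \<mu>_power[OF yz(2), of a]] by (simp add: power_mult_distrib)
    hence "y * cnj z = 1"
      using \<mu>_pow_eq_1_iff[OF \<mu>_mult[OF yz(1) \<mu>_cnj[OF yz(2)]], of a] assms by blast
    thus "y = z" using \<mu>_cnj_mult[OF yz(2)]
      by (metis mult.assoc mult.commute mult.right_neutral)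
  qed
  hence inj: "inj_on (\<lambda>z. z ^ a) (\<mu> - {1})" by (rule inj_on_subset) auto
  have "(\<lambda>z. z ^ a) ` (\<mu> - {1}) \<subseteq> \<mu> - {1}"
    using \<mu>_power \<mu>_pow_eq_1_iff assms by auto
  hence "bij_betw (\<lambda>z. z ^ a) (\<mu> - {1}) (\<mu> - {1})"
    using inj by (simp add: bij_betw_def endo_inj_surj)
  thus ?thesis unfolding nrm_def by (rule prod.reindex_bij_betw)
qed

text \<open>1 + x + ... + x^(p-1) is the product of x - z over the nontrivial roots; put x = 1. The
  signs cancel because the number of roots is even.\<close>

lemma nrm_id_minus_1: "nrm (\<lambda>z. z - 1) = of_nat p"
proof -
  define Q where "Q = (\<Prod>z\<in>\<mu> - {1}. [:- z, 1:])"
  define Q' where "Q' = (\<Sum>k<p. Polynomial.monom (1 :: complex) k)"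
  have dQ: "degree Q = 2 * m" unfolding Q_def
    by (subst degree_prod_eq_sum_degree) (auto simp: card_nontrivial)
  have "lead_coeff Q = 1" unfolding Q_def by (simp add: lead_coeff_prod)
  hence cQ: "poly.coeff Q (2 * m) = 1" by (simp add: dQ)
  have cQ': "poly.coeff Q' (2 * m) = 1" using p_eq by (simp add: Q'_def coeff_sum)
  have dQ': "degree Q' \<le> 2 * m" unfolding Q'_def
    by (rule degree_sum_le) (use p_eq in \<open>auto simp: degree_monom_eq\<close>)
  have "Q = Q'"
  proof (rule poly_eqI_degree_lead_coeff[where A = "\<mu> - {1}" and n = "2 * m"])
    fix y assume y: "y \<in> \<mu> - {1}"
    have "poly Q y = 0" unfolding Q_def poly_prod using y by (intro prod_zero) auto
    moreover have "poly Q' y = \<Phi> y" by (simp add: Q'_def poly_sum poly_monom \<Phi>_def)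
    ultimately show "poly Q y = poly Q' y" using y \<Phi>_0 by auto
  qed (use dQ dQ' cQ cQ' card_nontrivial in auto)
  hence "poly Q 1 = of_nat p" by (simp add: Q'_def poly_sum poly_monom)
  moreover have "poly Q 1 = nrm (\<lambda>z. 1 - z)" by (simp add: Q_def poly_prod nrm_def)
  moreover have "nrm (\<lambda>z. 1 - z) = nrm (\<lambda>z. (- 1) ^ 1) * nrm (\<lambda>z. z - 1)"
    unfolding nrm_mult[symmetric] by simp
  ultimately show ?thesis by (simp only: nrm_sign mult_1)
qed

lemma nrm_power_minus_1: "\<not> p dvd a \<Longrightarrow> nrm (\<lambda>z. z ^ a - 1) = of_nat p"
  using nrm_comp_power[of a "\<lambda>z. z - 1"] nrm_id_minus_1 by simp

text \<open>f is g times the quotient of z^a - 1 and z^b - 1, which both have norm p. This is the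
  source of the cyclotomic units used below.\<close>

lemma nrm_unit:
  assumes "\<not> p dvd a" "\<not> p dvd b" and g: "nrm g = 1"
    and eq: "\<And>z. z \<in> \<mu> \<Longrightarrow> f z * (z ^ b - 1) = g z * (z ^ a - 1)"
  shows "nrm f = 1"
proof -
  have "nrm (\<lambda>z. f z * (z ^ b - 1)) = nrm (\<lambda>z. g z * (z ^ a - 1))"
    by (rule nrm_cong) (rule eq)
  thus ?thesis using g p_gt by (simp add: nrm_mult nrm_power_minus_1 assms)
qed

lemma not_p_dvd: "\<not> p dvd 1" "\<not> p dvd Suc 0" "\<not> p dvd 2" "\<not> p dvd 4" "\<not> p dvd 8"
proof -
  have "\<not> p dvd 2 ^ k" for k
  proof
    assume "p dvd 2 ^ k"
    hence "p dvd 2" using prime_p by (metis prime_dvd_power)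
    thus False using p_gt by (auto dest: dvd_imp_le)
  qed
  from this[of 0] this[of 1] this[of 2] this[of 3]
  show "\<not> p dvd 1" "\<not> p dvd Suc 0" "\<not> p dvd 2" "\<not> p dvd 4" "\<not> p dvd 8" by simp_all
qed

lemma \<mu>_cnj_pow: assumes z: "z \<in> \<mu>" shows "cnj z ^ t * z ^ (2 * t + 1) = z ^ Suc t"
proof -
  have "2 * t + 1 = t + Suc t" by simp
  hence "cnj z ^ t * z ^ (2 * t + 1) = (z * cnj z) ^ t * z ^ Suc t"
    by (simp only: power_add power_mult_distrib mult_ac)
  thus ?thesis using \<mu>_cnj_mult[OF z] by simp
qed

lemma nrm_eps: assumes "\<not> p dvd 2 * t + 1" shows "nrm (eps t) = 1"
proof (rule nrm_unit[of "2 * t + 1" 1 "\<lambda>z. cnj z ^ t"])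
  fix z assume z: "z \<in> \<mu>"
  show "eps t z * (z ^ 1 - 1) = cnj z ^ t * (z ^ (2 * t + 1) - 1)"
    
    unfolding right_diff_distrib[of "cnj z ^ t"] \<mu>_cnj_pow[OF z]
    using eps_mult[OF \<mu>_cnj_mult[OF z], of t] by (simp add: mult.commute)
qed (use assms not_p_dvd nrm_monom in auto)

lemma nrm_power_plus_1: assumes "\<not> p dvd a" shows "nrm (\<lambda>z. z ^ a + 1) = 1"
proof (rule nrm_unit[of "2 * a" a "\<lambda>z. 1"])
  show "\<not> p dvd 2 * a" using assms not_p_dvd prime_p by (simp add: prime_dvd_mult_iff)
  show "(z ^ a + 1) * (z ^ a - 1) = 1 * (z ^ (2 * a) - 1)" for z :: complex
    unfolding power_even_eq power2_eq_square by (simp add: algebra_simps)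
qed (use assms in auto)

lemma nrm_alt: assumes "\<not> p dvd 2 * t + 1" shows "nrm (alt t) = 1"
proof -
  have "nrm (\<lambda>z. (z ^ 1 + 1) * alt t z) = nrm (\<lambda>z. (- 1) ^ t * (cnj z ^ t * (z ^ (2 * t + 1) + 1)))"
  proof (rule nrm_cong)
    fix z assume z: "z \<in> \<mu>"
    show "(z ^ 1 + 1) * alt t z = (- 1) ^ t * (cnj z ^ t * (z ^ (2 * t + 1) + 1))"
      
      unfolding distrib_left[of "cnj z ^ t"] \<mu>_cnj_pow[OF z]
      using alt_mult[OF \<mu>_cnj_mult[OF z], of t] by simp
  qed
  thus ?thesis
    unfolding nrm_mult nrm_power_plus_1[OF assms] nrm_power_plus_1[OF not_p_dvd(1)] nrm_monom nrm_sign by simp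
qed

text \<open>Up to sign and powers of z these are z^2 + 1, z^4 + 1, z^2 - 1 and (z - 1)^2. The first
  two have value 2 at 1 and supply powers of 2; the last two vanish at 1 and supply powers of
  p.\<close>

lemma nrm_binomials:
  "nrm (\<lambda>z. z + cnj z) = 1" "nrm (\<lambda>z. z\<^sup>2 + (cnj z)\<^sup>2) = 1"
  "nrm (\<lambda>z. cnj z - z) = of_nat p" "nrm (\<lambda>z. z + cnj z - 2) = of_nat (p\<^sup>2)"
proof -
  have 1: "z + cnj z = cnj z ^ 1 * (z ^ 2 + 1)" "z\<^sup>2 + (cnj z)\<^sup>2 = cnj z ^ 2 * (z ^ 4 + 1)"
    "cnj z - z = (- 1) ^ 1 * (cnj z ^ 1 * (z ^ 2 - 1))" "z + cnj z - 2 = cnj z ^ 1 * (z ^ 1 - 1)\<^sup>2"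
    if z: "z \<in> \<mu>" for z
  proof -
    have c: "cnj z * z ^ 2 = z" "cnj z ^ 2 * z ^ 4 = z ^ 2"
    proof -
      have "cnj z * z ^ 2 = (z * cnj z) * z" by (simp add: power2_eq_square mult_ac)
      thus "cnj z * z ^ 2 = z" using \<mu>_cnj_mult[OF z] by simp
      have "cnj z ^ 2 * z ^ 4 = (z * cnj z) ^ 2 * z ^ 2" by (simp add: power_mult_distrib power_add[symmetric])
      thus "cnj z ^ 2 * z ^ 4 = z ^ 2" using \<mu>_cnj_mult[OF z] by simp
    qed
    show "z + cnj z = cnj z ^ 1 * (z ^ 2 + 1)" "z\<^sup>2 + (cnj z)\<^sup>2 = cnj z ^ 2 * (z ^ 4 + 1)"
      "cnj z - z = (- 1) ^ 1 * (cnj z ^ 1 * (z ^ 2 - 1))"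
      using c by (simp_all add: distrib_left right_diff_distrib)
    have "cnj z ^ 1 * (z ^ 1 - 1)\<^sup>2 = cnj z * z ^ 2 - 2 * (z * cnj z) + cnj z"
      by (simp add: power2_eq_square algebra_simps)
    thus "z + cnj z - 2 = cnj z ^ 1 * (z ^ 1 - 1)\<^sup>2" using c \<mu>_cnj_mult[OF z] by simp
  qed
  have "nrm (\<lambda>z. z + cnj z) = nrm (\<lambda>z. cnj z ^ 1 * (z ^ 2 + 1))" by (rule nrm_cong) (rule 1)
  thus "nrm (\<lambda>z. z + cnj z) = 1" unfolding nrm_mult nrm_monom nrm_power_plus_1[OF not_p_dvd(3)] by simp
  have "nrm (\<lambda>z. z\<^sup>2 + (cnj z)\<^sup>2) = nrm (\<lambda>z. cnj z ^ 2 * (z ^ 4 + 1))" by (rule nrm_cong) (rule 1)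
  thus "nrm (\<lambda>z. z\<^sup>2 + (cnj z)\<^sup>2) = 1" unfolding nrm_mult nrm_monom nrm_power_plus_1[OF not_p_dvd(4)] by simp
  have "nrm (\<lambda>z. cnj z - z) = nrm (\<lambda>z. (- 1) ^ 1 * (cnj z ^ 1 * (z ^ 2 - 1)))" by (rule nrm_cong) (rule 1)
  thus "nrm (\<lambda>z. cnj z - z) = of_nat p"
    unfolding nrm_mult nrm_monom nrm_sign nrm_power_minus_1[OF not_p_dvd(3)] by simp
  have "nrm (\<lambda>z. z + cnj z - 2) = nrm (\<lambda>z. cnj z ^ 1 * (z ^ 1 - 1)\<^sup>2)" by (rule nrm_cong) (rule 1)
  thus "nrm (\<lambda>z. z + cnj z - 2) = of_nat (p\<^sup>2)"
    unfolding nrm_mult nrm_monom nrm_power nrm_power_minus_1[OF not_p_dvd(1)] by simp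
qed

section \<open>Two families of determinant values\<close>

text \<open>Both e = k eps_s alt_t and u = k eps_t alt_s are congruent to k eps_s eps_t modulo 2 and
  have norm 1, but at 1 they are k1 (2s + 1) and k1 (2t + 1) up to sign. Multiples of p, with
  parities tied to those in the sum of squares, then adjust these values.\<close>

lemma S_family_A:
  fixes \<alpha> \<beta> \<gamma> \<delta> :: int
  assumes k: "k \<in> R" "\<And>z. z \<in> \<mu> \<Longrightarrow> cnj (k z) = k z" "k 1 = of_int k1" "nrm k = 1"
    and st: "\<not> p dvd 2 * s + 1" "\<not> p dvd 2 * t + 1"
    and e': "e' \<in> R" "e' \<approx> (\<lambda>z. k z * (eps s z * eps t z))" "e' 1 = of_int e1'" "nrm e' = of_int K"
    and par: "even (\<alpha> - \<gamma>)" "even (\<beta> - \<delta>)"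
    and d: "d = (k1 * (2 * int s + 1) * (- 1) ^ t + (\<alpha> - \<beta>) * int p) * (k1 * (2 * int t + 1) * (- 1) ^ s + (\<alpha> + \<beta>) * int p)
     * ((e1' + \<gamma> * int p)\<^sup>2 + (\<delta> * int p)\<^sup>2) * K\<^sup>2"
  shows "d \<in> S"
proof (rule S_construct[where e = "\<lambda>z. k z * (eps s z * alt t z)" and u = "\<lambda>z. k z * (eps t z * alt s z)"
      and w = "\<lambda>z. k z * (eps s z * odd_powers t z - eps t z * odd_powers s z)" and e' = e'
      and \<alpha> = \<alpha> and \<beta> = \<beta> and \<gamma> = \<gamma> and \<delta> = \<delta> and e1' = e1' and K = "K\<^sup>2"
      and ?e1.0 = "k1 * (2 * int s + 1) * (- 1) ^ t" and ?u1.0 = "k1 * (2 * int t + 1) * (- 1) ^ s"])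
  show "(\<lambda>z. k z * (eps s z * alt t z)) \<approx> e'"
    by (rule cong2_trans[OF _ cong2_sym[OF e'(2)]]) (intro cong2_mult cong2_refl alt_cong_eps k R_mult eps_R)
  show "k z * (eps t z * alt s z) = k z * (eps s z * alt t z) + 2 *
     (k z * (eps s z * odd_powers t z - eps t z * odd_powers s z) + cnj (k z * (eps s z * odd_powers t z - eps t z * odd_powers s z)))"
    if "z \<in> \<mu>" for z
    using k(2)[OF that] by (simp add: alt_eq_eps algebra_simps)
  show "nrm (\<lambda>z. k z * (eps s z * alt t z)) * nrm (\<lambda>z. k z * (eps t z * alt s z)) * nrm (\<lambda>z. e' z * cnj (e' z)) = of_int (K\<^sup>2)"
    unfolding nrm_mult nrm_cnj nrm_eps[OF st(1)] nrm_eps[OF st(2)] nrm_alt[OF st(1)] nrm_alt[OF st(2)] k(4) e'(4)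
    by (simp add: power2_eq_square)
qed (use k e' par d in auto)

text \<open>The exponents -m, ..., m and 0, ..., p - 1 run through the same residues modulo p. The
  symmetric form splits \<Phi> - 1 as h + cnj h.\<close>

lemma \<Phi>_eq_eps: assumes z: "z \<in> \<mu>" shows "\<Phi> z = eps m z"
proof (cases "z = 1")
  case True
  moreover have "of_nat p = (of_int (2 * int m + 1) :: complex)"
    by (subst p_eq) simp
  ultimately show ?thesis by simp
next
  case False
  have "cnj z ^ m * z ^ p = z ^ Suc m" using \<mu>_cnj_pow[OF z, of m] p_eq by metis
  hence "(z - 1) * eps m z = 0"
    using eps_mult[OF \<mu>_cnj_mult[OF z], of m] \<mu>_pow_p[OF z] by simp
  thus ?thesis using False \<Phi>_0[OF z] by simp
qed

lemma eps_eq_sum: "eps t z = 1 + ((\<Sum>j<t. z ^ Suc j) + cnj (\<Sum>j<t. z ^ Suc j))"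
  by (induction t) (auto simp: algebra_simps)

text \<open>Here u = e + 2 k (\<Phi> - 1). Off 1 it is k (z - 1)^2 / z and contributes p^2, at 1 it
  is 2 k1 p: together p^3, the least positive power of p that can occur.\<close>

lemma S_family_B:
  fixes \<alpha> \<beta> \<gamma> \<delta> :: int
  assumes k: "k \<in> R" "\<And>z. z \<in> \<mu> \<Longrightarrow> cnj (k z) = k z" "k 1 = of_int k1" "nrm k = 1"
    and e': "e' \<in> R" "e' \<approx> (\<lambda>z. k z * (z + cnj z))" "e' 1 = of_int e1'" "nrm e' = of_int K"
    and par: "even (\<alpha> - \<gamma>)" "even (\<beta> - \<delta>)"
    and d: "d = (2 * k1 + (\<alpha> - \<beta>) * int p) * (2 * k1 * int p + (\<alpha> + \<beta>) * int p)
     * ((e1' + \<gamma> * int p)\<^sup>2 + (\<delta> * int p)\<^sup>2) * ((int p)\<^sup>2 * K\<^sup>2)"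
  shows "d \<in> S"
proof (rule S_construct[where e = "\<lambda>z. k z * (z + cnj z)" and u = "\<lambda>z. k z * (z + cnj z - 2 + 2 * \<Phi> z)"
      and w = "\<lambda>z. k z * (\<Sum>j<m. z ^ Suc j)" and e' = e'
      and \<alpha> = \<alpha> and \<beta> = \<beta> and \<gamma> = \<gamma> and \<delta> = \<delta> and e1' = e1' and K = "(int p)\<^sup>2 * K\<^sup>2"
      and ?e1.0 = "2 * k1" and ?u1.0 = "2 * k1 * int p"])
  show "(\<lambda>z. k z * (z + cnj z)) \<approx> e'" by (rule cong2_sym[OF e'(2)])
  show "k z * (z + cnj z - 2 + 2 * \<Phi> z) = k z * (z + cnj z) + 2 *
     (k z * (\<Sum>j<m. z ^ Suc j) + cnj (k z * (\<Sum>j<m. z ^ Suc j)))"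
    if "z \<in> \<mu>" for z
    unfolding \<Phi>_eq_eps[OF that] eps_eq_sum complex_cnj_mult k(2)[OF that] by (simp add: algebra_simps)
  have "nrm (\<lambda>z. k z * (z + cnj z - 2 + 2 * \<Phi> z)) = nrm (\<lambda>z. k z * (z + cnj z - 2))"
    by (rule nrm_cong) (simp add: \<Phi>_0)
  thus "nrm (\<lambda>z. k z * (z + cnj z)) * nrm (\<lambda>z. k z * (z + cnj z - 2 + 2 * \<Phi> z)) * nrm (\<lambda>z. e' z * cnj (e' z)) = of_int ((int p)\<^sup>2 * K\<^sup>2)"
    unfolding nrm_mult nrm_cnj k(4) e'(4) nrm_binomials by (simp add: power2_eq_square)
qed (use k e' par d in auto)

section \<open>Explicit determinant values\<close>

abbreviation "c1 \<equiv> \<lambda>z. z + cnj z"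
abbreviation "c2 \<equiv> \<lambda>z. z\<^sup>2 + (cnj z)\<^sup>2"
abbreviation "s1 \<equiv> \<lambda>z. cnj z - z"

lemma c1_sq_cong: "(\<lambda>z. (c1 z)\<^sup>2) \<approx> c2"
proof (rule cong2_I[of "\<lambda>z. 1"])
  fix z assume z: "z \<in> \<mu>"
  have "(c1 z)\<^sup>2 = c2 z + 2 * (z * cnj z)" by (simp add: power2_eq_square algebra_simps)
  thus "(c1 z)\<^sup>2 = c2 z + 2 * 1" using \<mu>_cnj_mult[OF z] by simp
qed auto

lemma s1_cong: "s1 \<approx> c1"
  by (rule cong2_I[of "\<lambda>z. - z"]) auto

lemma s1_sq_cong: "(\<lambda>z. (s1 z)\<^sup>2) \<approx> c2"
proof (rule cong2_I[of "\<lambda>z. - 1"])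
  fix z assume z: "z \<in> \<mu>"
  have "(s1 z)\<^sup>2 = c2 z - 2 * (z * cnj z)" by (simp add: power2_eq_square algebra_simps)
  thus "(s1 z)\<^sup>2 = c2 z + 2 * - 1" using \<mu>_cnj_mult[OF z] by simp
qed auto

lemma not_p_dvd_add: "\<not> p dvd p + 2" "\<not> p dvd p + 4" "\<not> p dvd p + 8" "\<not> p dvd 3 * p + 2"
proof -
  have "p dvd p + k \<longleftrightarrow> p dvd k" "p dvd 3 * p + k \<longleftrightarrow> p dvd k" for k
    by (simp_all add: dvd_add_right_iff)
  thus "\<not> p dvd p + 2" "\<not> p dvd p + 4" "\<not> p dvd p + 8" "\<not> p dvd 3 * p + 2"
    using not_p_dvd by blast+
qed

lemma neg1_pow_sq [simp]: "((- 1) ^ t)\<^sup>2 = (1 :: int)"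
  by (cases "even t") auto

lemma int_p: "int p = 2 * int m + 1"
  using p_eq by linarith

text \<open>With s = 0 the factors at 1 are 2t + 1 = |n| and a sign, and \<open>alt t\<close> makes
  the sum of squares 1.\<close>

lemma S_coprime: assumes "coprime n (2 * int p)" shows "n \<in> S"
proof -
  have "odd n" "\<not> int p dvd n"
    using assms p_gt by (auto simp: coprime_commute[of n] coprime_absorb_left dest: coprime_common_divisor)
  hence "odd (nat \<bar>n\<bar>)" by (simp add: even_nat_iff)
  then obtain t where t: "nat \<bar>n\<bar> = 2 * t + 1" by (rule oddE)
  have nt: "\<not> p dvd 2 * t + 1"
    using \<open>\<not> int p dvd n\<close> unfolding t[symmetric] by (simp add: nat_abs_dvd_iff int_dvd_int_iff flip: int_dvd_int_iff)
  have n: "\<bar>n\<bar> = 2 * int t + 1" using t by linarith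
  have "(- 1) ^ t * (2 * int t + 1) \<in> S"
    by (rule S_family_A[where k = "\<lambda>z. 1" and ?k1.0 = 1 and s = 0 and t = t and e' = "alt t"
          and \<alpha> = 0 and \<beta> = 0 and \<gamma> = 0 and \<delta> = 0 and e1' = "(-1) ^ t" and K = 1])
       (use nt not_p_dvd nrm_alt alt_cong_eps in auto)
  hence "\<bar>n\<bar> \<in> S" unfolding n
    by (rule S_sign[rotated]) (cases "even t", auto)
  thus ?thesis using S_uminus[of "\<bar>n\<bar>"] by (cases "n \<ge> 0") auto
qed

lemma S_16: "16 \<in> S"
  by (rule S_family_A[where k = c1 and ?k1.0 = 2 and s = 0 and t = 0 and e' = c1
          and \<alpha> = 0 and \<beta> = 0 and \<gamma> = 0 and \<delta> = 0 and e1' = 2 and K = 1])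
     (use not_p_dvd nrm_binomials in \<open>auto simp: add.commute\<close>)

text \<open>c1^2 and c2 agree modulo 2 but are 4 and 2 at 1, so the factors there are 2, 2 and
  4^2.\<close>

lemma S_64: "64 \<in> S"
  by (rule S_family_A[where k = c2 and ?k1.0 = 2 and s = 0 and t = 0 and e' = "\<lambda>z. (c1 z)\<^sup>2"
          and \<alpha> = 0 and \<beta> = 0 and \<gamma> = 0 and \<delta> = 0 and e1' = 4 and K = 1])
     (use not_p_dvd nrm_binomials c1_sq_cong in \<open>auto simp: add.commute nrm_power\<close>)

lemma S_neg1_pow: "(- 1) ^ t * d \<in> S \<Longrightarrow> d \<in> S"
  by (rule S_sign[of "(- 1) ^ t"]) (cases "even t", auto)

text \<open>Here 2t + 1 = p + 2, and 4 (p + 2) - 4p = 8. The factors at 1 are, up to sign, 4, 8 and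
  the square of 2 or 4, according to whether the sum of squares uses c2 or the congruent
  c1^2.\<close>

lemma S_128_512: "128 \<in> S" "512 \<in> S"
proof -
  define t where "t = m + 1"
  have t: "2 * t + 1 = p + 2" "int t = int m + 1" using p_eq by (auto simp: t_def)
  have nt: "\<not> p dvd 2 * t + 1" unfolding t by (rule not_p_dvd_add)
  have c: "(\<lambda>z. c2 z * alt t z) \<approx> (\<lambda>z. (c1 z)\<^sup>2 * (eps 0 z * eps t z))"
    "(\<lambda>z. (c1 z)\<^sup>2 * alt t z) \<approx> (\<lambda>z. (c1 z)\<^sup>2 * (eps 0 z * eps t z))"
    unfolding eps.simps mult_1
    by (intro cong2_mult cong2_refl cong2_sym[OF c1_sq_cong] alt_cong_eps eps_R R_power R_add R_cnj R_id)+
  have "(- 1) ^ t * 128 \<in> S"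
    by (rule S_family_A[where k = "\<lambda>z. (c1 z)\<^sup>2" and ?k1.0 = 4 and s = 0 and t = t and e' = "\<lambda>z. c2 z * alt t z"
          and \<alpha> = "-2" and \<beta> = "-2" and \<gamma> = 0 and \<delta> = 0 and e1' = "2 * (- 1) ^ t" and K = 1])
       (use nt not_p_dvd nrm_binomials c nrm_alt int_p t in \<open>auto simp: add.commute nrm_power nrm_mult power_mult_distrib\<close>)
  thus "128 \<in> S" by (rule S_neg1_pow)
  have "(- 1) ^ t * 512 \<in> S"
    by (rule S_family_A[where k = "\<lambda>z. (c1 z)\<^sup>2" and ?k1.0 = 4 and s = 0 and t = t and e' = "\<lambda>z. (c1 z)\<^sup>2 * alt t z"
          and \<alpha> = "-2" and \<beta> = "-2" and \<gamma> = 0 and \<delta> = 0 and e1' = "4 * (- 1) ^ t" and K = 1])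
       (use nt not_p_dvd nrm_binomials c nrm_alt int_p t in \<open>auto simp: add.commute nrm_power nrm_mult power_mult_distrib\<close>)
  thus "512 \<in> S" by (rule S_neg1_pow)
qed

lemma S_16_mult_p_sq_plus_1: "16 * ((int p)\<^sup>2 + 1) \<in> S"
proof -
  \<comment> \<open>The odd numbers 2s + 1 = 3p + 2 and 2t + 1 = p + 8 are made so that subtracting
    3p and p leaves 2 and 8. This makes \<alpha> even and \<beta> odd, which permits the squares 1
    and p^2.\<close>
  define s t where "s = 3 * m + 2" and "t = m + 4"
  define \<epsilon> :: int where "\<epsilon> = (- 1) ^ m"
  have s: "2 * s + 1 = 3 * p + 2" "int s = 3 * int m + 2" "(- 1) ^ s = \<epsilon>"
    using p_eq by (auto simp: s_def \<epsilon>_def power_add power_mult)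
  have t: "2 * t + 1 = p + 8" "int t = int m + 4" "(- 1) ^ t = \<epsilon>"
    using p_eq by (auto simp: t_def \<epsilon>_def power_add)
  have nst: "\<not> p dvd 2 * s + 1" "\<not> p dvd 2 * t + 1" unfolding s t by (rule not_p_dvd_add)+
  have c: "(\<lambda>z. alt s z * alt t z) \<approx> (\<lambda>z. 1 * (eps s z * eps t z))"
    unfolding mult_1 by (intro cong2_mult alt_cong_eps eps_R)
  have \<epsilon>: "\<epsilon> = 1 \<or> \<epsilon> = -1" unfolding \<epsilon>_def by (cases "even m") auto
  have \<epsilon>2: "\<epsilon> * \<epsilon> = 1" using \<epsilon> by auto
  show ?thesis
  proof (rule S_family_A[where k = "\<lambda>z. 1" and ?k1.0 = 1 and s = s and t = t and e' = "\<lambda>z. alt s z * alt t z"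
          and \<alpha> = "- 2 * \<epsilon>" and \<beta> = \<epsilon> and \<gamma> = 0 and \<delta> = 1 and e1' = 1 and K = 1])
    show "alt s 1 * alt t 1 = of_int 1" using s t \<epsilon>2 by (simp flip: of_int_mult)
    show "16 * ((int p)\<^sup>2 + 1) = (1 * (2 * int s + 1) * (- 1) ^ t + (- 2 * \<epsilon> - \<epsilon>) * int p) *
       (1 * (2 * int t + 1) * (- 1) ^ s + (- 2 * \<epsilon> + \<epsilon>) * int p) * ((1 + 0 * int p)\<^sup>2 + (1 * int p)\<^sup>2) * 1\<^sup>2"
      unfolding s(2,3) t(2,3) int_p using \<epsilon> by (elim disjE) (simp_all add: power2_eq_square algebra_simps)
  qed (use nst c nrm_alt \<epsilon> in \<open>auto simp: nrm_mult\<close>)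
qed

text \<open>s1 is congruent to c1 modulo 2, has norm p and vanishes at 1. So the squares at 1 are
  (\<gamma> p)^2 and (\<delta> p)^2, and the norm of the sum of squares contributes another p^2. The
  16 is 2 times 2 (p + 4) - 2p.\<close>

lemma S_16_p4: assumes "odd \<gamma>" "odd \<delta>" shows "16 * (\<gamma>\<^sup>2 + \<delta>\<^sup>2) * int p ^ 4 \<in> S"
proof -
  define t where "t = m + 2"
  have t: "2 * t + 1 = p + 4" "int t = int m + 2" using p_eq by (auto simp: t_def)
  have nt: "\<not> p dvd 2 * t + 1" unfolding t by (rule not_p_dvd_add)
  have c: "(\<lambda>z. s1 z * alt t z) \<approx> (\<lambda>z. c1 z * (eps 0 z * eps t z))"
    unfolding eps.simps mult_1 by (intro cong2_mult s1_cong alt_cong_eps eps_R R_add R_cnj R_id)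
  have "(- 1) ^ t * (16 * (\<gamma>\<^sup>2 + \<delta>\<^sup>2) * int p ^ 4) \<in> S"
  proof (rule S_family_A[where k = c1 and ?k1.0 = 2 and s = 0 and t = t and e' = "\<lambda>z. s1 z * alt t z"
          and \<alpha> = "-1" and \<beta> = "-1" and \<gamma> = \<gamma> and \<delta> = \<delta> and e1' = 0 and K = "int p"])
    have "2 * (2 * int t + 1) - 2 * int p = 8" using t int_p by simp
    thus "(- 1) ^ t * (16 * (\<gamma>\<^sup>2 + \<delta>\<^sup>2) * int p ^ 4) = (2 * (2 * int 0 + 1) * (- 1) ^ t + (- 1 - - 1) * int p) *
       (2 * (2 * int t + 1) * (- 1) ^ 0 + (- 1 + - 1) * int p) * ((0 + \<gamma> * int p)\<^sup>2 + (\<delta> * int p)\<^sup>2) * (int p)\<^sup>2"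
      by (simp add: power2_eq_square power4_eq_xxxx algebra_simps)
  qed (use nt not_p_dvd nrm_binomials nrm_alt c assms in \<open>auto simp: nrm_mult add.commute\<close>)
  thus ?thesis by (rule S_neg1_pow)
qed

lemma S_32_p4: "2 ^ 5 * int p ^ 4 \<in> S"
  using S_16_p4[of 1 1] by simp

text \<open>As for p^4, but s1^2 in place of s1 raises the contribution of the norm from p^2 to
  p^4.\<close>

lemma S_32_p6: "2 ^ 5 * int p ^ 6 \<in> S"
proof -
  define t where "t = m + 2"
  have t: "2 * t + 1 = p + 4" "int t = int m + 2" using p_eq by (auto simp: t_def)
  have nt: "\<not> p dvd 2 * t + 1" unfolding t by (rule not_p_dvd_add)
  have c: "(\<lambda>z. (s1 z)\<^sup>2 * alt t z) \<approx> (\<lambda>z. c2 z * (eps 0 z * eps t z))"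
    unfolding eps.simps mult_1 by (intro cong2_mult s1_sq_cong alt_cong_eps eps_R R_add R_power R_cnj R_id)
  have "(- 1) ^ t * (2 ^ 5 * int p ^ 6) \<in> S"
  proof (rule S_family_A[where k = c2 and ?k1.0 = 2 and s = 0 and t = t and e' = "\<lambda>z. (s1 z)\<^sup>2 * alt t z"
          and \<alpha> = "-1" and \<beta> = "-1" and \<gamma> = 1 and \<delta> = 1 and e1' = 0 and K = "(int p)\<^sup>2"])
    have "2 * (2 * int t + 1) - 2 * int p = 8" using t int_p by simp
    thus "(- 1) ^ t * (2 ^ 5 * int p ^ 6) = (2 * (2 * int 0 + 1) * (- 1) ^ t + (- 1 - - 1) * int p) *
       (2 * (2 * int t + 1) * (- 1) ^ 0 + (- 1 + - 1) * int p) * ((0 + 1 * int p)\<^sup>2 + (1 * int p)\<^sup>2) * ((int p)\<^sup>2)\<^sup>2"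
      by (simp add: eval_nat_numeral algebra_simps)
  qed (use nt not_p_dvd nrm_binomials nrm_alt c in \<open>auto simp: nrm_mult nrm_power add.commute\<close>)
  thus ?thesis by (rule S_neg1_pow)
qed

text \<open>Exactly one of p + 1 and p - 1 is twice an odd number 2r + 1. With k =
  \<open>eps r\<close>, subtracting p from 2 k1 and from the value of e' leaves 1 or -1 in both
  places, so only p q and the norm p^2 remain.\<close>

lemma S_p3_mult: assumes q: "q mod 4 = 1" shows "int p ^ 3 * q \<in> S"
proof -
  obtain \<sigma> :: int and r :: nat where \<sigma>: "\<sigma> = 1 \<or> \<sigma> = -1" and r: "2 * (2 * int r + 1) = int p + \<sigma>"
  proof (cases "even m")
    case True
    then obtain r where "m = 2 * r" by (rule evenE)
    thus ?thesis using that[of 1 r] int_p by simp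
  next
    case False
    then obtain r where "m = 2 * r + 1" by (rule oddE)
    thus ?thesis using that[of "-1" r] int_p by simp
  qed
  have nr: "\<not> p dvd 2 * r + 1"
  proof
    assume "p dvd 2 * r + 1"
    hence "p \<le> 2 * r + 1" by (rule dvd_imp_le) simp
    hence "int p \<le> 2 * int r + 1" "int p > 2" using p_gt by linarith+
    thus False using r \<sigma> by (elim disjE) simp_all
  qed
  obtain j where j: "q = 4 * j + 1" using q by (metis mult_div_mod_eq)
  \<comment> \<open>Solves 2 (2r + 1) + 2 \<alpha> + 1 = q; the residue of q modulo 4 makes \<alpha>
    odd, as \<gamma> = -1 demands.\<close>
  define \<alpha> where "\<alpha> = 2 * j - (2 * int r + 1)"
  have \<alpha>: "odd \<alpha>" "q = 2 * (2 * int r + 1) + 2 * \<alpha> + 1" by (auto simp: \<alpha>_def j)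
  have "\<sigma> * (int p ^ 3 * q) \<in> S"
  proof (rule S_family_B[where k = "eps r" and ?k1.0 = "2 * int r + 1" and e' = "\<lambda>z. eps r z * c1 z"
          and \<alpha> = \<alpha> and \<beta> = "\<alpha> + 1" and \<gamma> = "-1" and \<delta> = 0 and e1' = "2 * (2 * int r + 1)" and K = 1])
    have "2 * (2 * int r + 1) + (\<alpha> - (\<alpha> + 1)) * int p = \<sigma>"
      "2 * (2 * int r + 1) * int p + (\<alpha> + (\<alpha> + 1)) * int p = int p * q"
      "2 * (2 * int r + 1) + - 1 * int p = \<sigma>"
      using r by (simp_all add: \<alpha>(2) algebra_simps)
    moreover have "\<sigma>\<^sup>2 = 1" using \<sigma> by auto
    ultimately show "\<sigma> * (int p ^ 3 * q) = (2 * (2 * int r + 1) + (\<alpha> - (\<alpha> + 1)) * int p) *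
        (2 * (2 * int r + 1) * int p + (\<alpha> + (\<alpha> + 1)) * int p) *
        ((2 * (2 * int r + 1) + - 1 * int p)\<^sup>2 + (0 * int p)\<^sup>2) * ((int p)\<^sup>2 * 1\<^sup>2)"
      by (simp add: power3_eq_cube power2_eq_square)
  qed (use nr nrm_eps nrm_binomials \<alpha> in \<open>auto simp: nrm_mult\<close>)
  thus ?thesis by (rule S_sign[OF \<sigma>])
qed

lemma S_p3_mult_odd: assumes q: "odd q" shows "int p ^ 3 * q \<in> S"
proof -
  have "q mod 4 = 1 \<or> (- q) mod 4 = 1" using q by presburger
  thus ?thesis using S_p3_mult[of q] S_uminus[OF S_p3_mult[of "- q"]] by auto
qed

text \<open>Now p - 1 = 2 (2r + 1). The difference of squares uses \<open>alt r\<close>, which is 1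
  or -1 at 1, and e' uses the congruent \<open>eps r\<close>, so that e'(1) - p = -1 and the sum of
  squares is 1 + p^2. The parameter q is left free to supply further powers of p.\<close>

lemma S_p_3_mod_4:
  assumes "p mod 4 = 3"
  shows "\<exists>\<epsilon>\<in>{1, -1}. \<epsilon> * (16 * int p ^ 3 * q * ((int p)\<^sup>2 + 1)) \<in> S"
proof -
  have "odd m" using assms p_eq by presburger
  then obtain r where "m = 2 * r + 1" by (rule oddE)
  hence r: "2 * (2 * int r + 1) = int p - 1" using int_p by simp
  have nr: "\<not> p dvd 2 * r + 1"
  proof
    assume "p dvd 2 * r + 1"
    hence "p \<le> 2 * r + 1" by (rule dvd_imp_le) simp
    hence "int p \<le> 2 * int r + 1" "int p > 2" using p_gt by linarith+
    thus False using r by simp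
  qed
  define \<epsilon> :: int where "\<epsilon> = (- 1) ^ r"
  have \<epsilon>: "\<epsilon> \<in> {1, -1}" by (cases "even r") (auto simp: \<epsilon>_def)
  hence "odd \<epsilon>" by auto
  have c: "(\<lambda>z. eps r z * c1 z) \<approx> (\<lambda>z. alt r z * c1 z)"
    by (intro cong2_mult cong2_refl cong2_sym[OF alt_cong_eps] alt_R R_add R_cnj R_id)
  have "\<epsilon> * (16 * int p ^ 3 * q * ((int p)\<^sup>2 + 1)) \<in> S"
  proof (rule S_family_B[where k = "alt r" and ?k1.0 = \<epsilon> and e' = "\<lambda>z. eps r z * c1 z"
          and \<alpha> = "4 * q - \<epsilon>" and \<beta> = "4 * q - \<epsilon>" and \<gamma> = "-1" and \<delta> = 1 and e1' = "int p - 1" and K = 1])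
    show "eps r 1 * c1 1 = of_int (int p - 1)" unfolding r[symmetric] by simp
    show "\<epsilon> * (16 * int p ^ 3 * q * ((int p)\<^sup>2 + 1)) = (2 * \<epsilon> + (4 * q - \<epsilon> - (4 * q - \<epsilon>)) * int p) *
        (2 * \<epsilon> * int p + (4 * q - \<epsilon> + (4 * q - \<epsilon>)) * int p) *
        ((int p - 1 + - 1 * int p)\<^sup>2 + (1 * int p)\<^sup>2) * ((int p)\<^sup>2 * 1\<^sup>2)"
      by (simp add: power3_eq_cube power2_eq_square algebra_simps)
  qed (use nr nrm_eps nrm_alt nrm_binomials \<open>odd \<epsilon>\<close> c in \<open>auto simp: nrm_mult \<epsilon>_def\<close>)
  thus ?thesis using \<epsilon> by blast
qed

end

text \<open>Expanding the right side gives both pure products plus nonnegative mixed terms; for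
  empty A it would read 2 <= 1. It bounds the half norm of a sum of squares by the half norms of the
  two squares.\<close>

lemma prod_add_ge:
  fixes x y :: "'a \<Rightarrow> real"
  assumes "finite A" "A \<noteq> {}" "\<And>i. i \<in> A \<Longrightarrow> 0 \<le> x i" "\<And>i. i \<in> A \<Longrightarrow> 0 \<le> y i"
  shows "(\<Prod>i\<in>A. x i) + (\<Prod>i\<in>A. y i) \<le> (\<Prod>i\<in>A. x i + y i)"
  using assms
proof (induction A rule: finite_ne_induct)
  case (insert a F)
  have nn: "0 \<le> x a" "0 \<le> y a" "0 \<le> (\<Prod>i\<in>F. x i)" "0 \<le> (\<Prod>i\<in>F. y i)"
    using insert.prems by (auto intro: prod_nonneg)
  have "x a * (\<Prod>i\<in>F. x i) + y a * (\<Prod>i\<in>F. y i) \<le> (x a + y a) * ((\<Prod>i\<in>F. x i) + (\<Prod>i\<in>F. y i))"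
    using nn by (simp add: algebra_simps)
  also have "\<dots> \<le> (x a + y a) * (\<Prod>i\<in>F. x i + y i)"
    using nn insert by (intro mult_left_mono) auto
  finally show ?case using insert.hyps by simp
qed auto

context prime_roots
begin

section \<open>Necessary conditions\<close>

lemma \<mu>up_nonempty: "\<mu>up \<noteq> {}"
proof -
  have "card (\<mu> - {1}) \<noteq> 0" using card_nontrivial m_pos by simp
  then obtain z where z: "z \<in> \<mu>" "z \<noteq> 1" by (metis Diff_iff card.empty ex_in_conv singletonI)
  thus ?thesis using \<mu>_Im_nz[OF z] \<mu>_cnj[OF z(1)] by (cases "Im z > 0") (auto simp: \<mu>up_def intro: exI[of _ "cnj z"])
qed

lemma sym_norm_sq: "f \<in> R \<Longrightarrow> sym (\<lambda>z. f z * cnj (f z))"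
  by (simp add: sym_def R_at_cnj mult.commute)

lemma prime_int_p: "prime (int p)"
  using prime_p by simp

lemma cong2_at_1:
  assumes "f \<approx> g" "f 1 = of_int x" "g 1 = of_int y" shows "even (x - y)"
proof -
  obtain h where h: "h \<in> R" "\<And>z. z \<in> \<mu> \<Longrightarrow> f z = g z + 2 * h z"
    using assms(1) by (auto simp: cong2_def)
  obtain k where "h 1 = of_int k" using R_at_1[OF h(1)] by blast
  hence "complex_of_int x = of_int (y + 2 * k)" using h(2)[OF one_in_\<mu>] assms by simp
  hence "x = y + 2 * k" by (simp only: of_int_eq_iff)
  thus ?thesis by simp
qed

text \<open>The last clause rests on positivity: B is at least C + E, the half norms of |f2|^2 and
  |g2|^2, which are nonnegative integers. So B = 1 makes one of them 0, and since they are c^(2m)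
  and e^(2m) modulo p, p divides c or e.\<close>

lemma S_structure:
  assumes "d \<in> S"
  obtains a b c e A B :: int where
    "d = (a\<^sup>2 - b\<^sup>2) * (c\<^sup>2 + e\<^sup>2) * A\<^sup>2 * B\<^sup>2" "even (a - c)" "even (b - e)" "even (A - B)"
    "[A = (a\<^sup>2 - b\<^sup>2) ^ m] (mod int p)" "[B = (c\<^sup>2 + e\<^sup>2) ^ m] (mod int p)"
    "B \<ge> 0" "B = 1 \<Longrightarrow> int p dvd c \<or> int p dvd e"
proof -
  obtain f1 g1 f2 g2 where f: "f1 \<in> R" "g1 \<in> R" "f2 \<in> R" "g2 \<in> R" "f1 \<approx> f2" "g1 \<approx> g2"
    "of_int d = dval f1 g1 f2 g2" by (rule S_E[OF assms]) (rule that)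
  define \<phi> \<psi> where "\<phi> z = f1 z * cnj (f1 z) + - (g1 z * cnj (g1 z))" and
    "\<psi> z = f2 z * cnj (f2 z) + g2 z * cnj (g2 z)" for z
  have R: "\<phi> \<in> R" "\<psi> \<in> R" unfolding \<phi>_def[abs_def] \<psi>_def[abs_def]
    by (intro R_add R_mult R_uminus R_cnj f)+
  have sy: "sym \<phi>" "sym \<psi>"
    using f by (simp_all add: sym_def \<phi>_def \<psi>_def R_at_cnj mult.commute)
  have "(\<lambda>z. - (g1 z * cnj (g1 z))) \<approx> (\<lambda>z. g1 z * cnj (g1 z))"
    by (intro cong2_uminus R_mult R_cnj f)
  also have "\<dots> \<approx> (\<lambda>z. g2 z * cnj (g2 z))" by (intro cong2_mult cong2_cnj R_cnj f)
  finally have c2: "\<phi> \<approx> \<psi>" unfolding \<phi>_def[abs_def] \<psi>_def[abs_def]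
    by (intro cong2_add cong2_mult cong2_cnj R_cnj f)
  obtain a where a: "f1 1 = of_int a" using R_at_1[OF f(1)] by blast
  obtain b where b: "g1 1 = of_int b" using R_at_1[OF f(2)] by blast
  obtain c where c: "f2 1 = of_int c" using R_at_1[OF f(3)] by blast
  obtain e where e: "g2 1 = of_int e" using R_at_1[OF f(4)] by blast
  note par = cong2_at_1
  have 1: "\<phi> 1 = of_int (a\<^sup>2 - b\<^sup>2)" "\<psi> 1 = of_int (c\<^sup>2 + e\<^sup>2)"
    by (simp_all add: \<phi>_def \<psi>_def a b c e power2_eq_square)
  obtain A where A: "hnrm \<phi> = of_int A" "[A = (a\<^sup>2 - b\<^sup>2) ^ m] (mod int p)"
    using hnrm_int[OF R(1) sy(1) 1(1)] by blast
  obtain B where B: "hnrm \<psi> = of_int B" "[B = (c\<^sup>2 + e\<^sup>2) ^ m] (mod int p)"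
    using hnrm_int[OF R(2) sy(2) 1(2)] by blast
  have AB: "even (A - B)" by (rule hnrm_cong2[OF R sy c2 A(1) B(1)])
  have "of_int d = (\<Prod>z\<in>\<mu>. \<phi> z) * (\<Prod>z\<in>\<mu>. \<psi> z)"
    unfolding f(7) dval_def \<phi>_def \<psi>_def by simp
  also have "\<dots> = of_int ((a\<^sup>2 - b\<^sup>2) * (c\<^sup>2 + e\<^sup>2) * A\<^sup>2 * B\<^sup>2)"
    unfolding prod_\<mu> nrm_eq_hnrm_sq[OF sy(1)] nrm_eq_hnrm_sq[OF sy(2)] A(1) B(1) 1 by simp
  finally have d: "d = (a\<^sup>2 - b\<^sup>2) * (c\<^sup>2 + e\<^sup>2) * A\<^sup>2 * B\<^sup>2" by (simp only: of_int_eq_iff)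
  define X where "X h = (\<Prod>z\<in>\<mu>up. (norm (h z))\<^sup>2)" for h :: "complex \<Rightarrow> complex"
  have X: "hnrm (\<lambda>z. h z * cnj (h z)) = of_real (X h)" "X h \<ge> 0" for h
    unfolding hnrm_def X_def by (simp_all add: complex_norm_square prod_nonneg del: of_real_power)
  have sq1: "f2 1 * cnj (f2 1) = of_int (c\<^sup>2)" "g2 1 * cnj (g2 1) = of_int (e\<^sup>2)"
    by (simp_all add: c e power2_eq_square)
  obtain C where C: "hnrm (\<lambda>z. f2 z * cnj (f2 z)) = of_int C" "[C = (c\<^sup>2) ^ m] (mod int p)"
    using hnrm_int[OF R_mult[OF f(3) R_cnj[OF f(3)]] sym_norm_sq[OF f(3)] sq1(1)] by blast
  obtain E where E: "hnrm (\<lambda>z. g2 z * cnj (g2 z)) = of_int E" "[E = (e\<^sup>2) ^ m] (mod int p)"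
    using hnrm_int[OF R_mult[OF f(4) R_cnj[OF f(4)]] sym_norm_sq[OF f(4)] sq1(2)] by blast
  have re: "x = of_int y" if "complex_of_real x = of_int y" for x y
    using that by (metis of_real_eq_iff of_real_of_int_eq)
  have XC: "X f2 = of_int C" and XE: "X g2 = of_int E" using X C(1) E(1) re by metis+
  have "hnrm \<psi> = of_real (\<Prod>z\<in>\<mu>up. (norm (f2 z))\<^sup>2 + (norm (g2 z))\<^sup>2)"
    unfolding hnrm_def \<psi>_def by (simp add: complex_norm_square del: of_real_power)
  hence "(\<Prod>z\<in>\<mu>up. (norm (f2 z))\<^sup>2 + (norm (g2 z))\<^sup>2) = of_int B" using B(1) re by metis
  moreover have "X f2 + X g2 \<le> (\<Prod>z\<in>\<mu>up. (norm (f2 z))\<^sup>2 + (norm (g2 z))\<^sup>2)"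
    unfolding X_def by (rule prod_add_ge) (auto simp: \<mu>up_nonempty)
  ultimately have "of_int (C + E) \<le> (of_int B :: real)" by (simp add: XC XE)
  hence BCE: "C + E \<le> B" by (simp only: of_int_le_iff)
  have nn: "C \<ge> 0" "E \<ge> 0" using X(2)[of f2] X(2)[of g2] by (simp_all add: XC XE)
  have dv: "int p dvd x" if "[0 = (x\<^sup>2) ^ m] (mod int p)" for x
  proof -
    have "int p dvd (x\<^sup>2) ^ m" using that by (metis cong_dvd_iff dvd_0_right)
    thus ?thesis using prime_int_p prime_dvd_power by blast
  qed
  show ?thesis
  proof (rule that[OF d par[OF f(5) a c] par[OF f(6) b e] AB A(2) B(2)])
    show "B \<ge> 0" using BCE nn by linarith
    assume "B = 1"
    hence "C = 0 \<or> E = 0" using BCE nn by linarith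
    thus "int p dvd c \<or> int p dvd e" using dv C(2) E(2) by blast
  qed
qed

lemma p_dvd_power_cong:
  assumes "[A = x ^ m] (mod int p)" shows "int p dvd A \<longleftrightarrow> int p dvd x"
proof -
  have "int p dvd A \<longleftrightarrow> int p dvd x ^ m" by (rule cong_dvd_iff[OF assms])
  also have "\<dots> \<longleftrightarrow> int p dvd x" using prime_int_p m_pos by (simp add: prime_dvd_power_iff)
  finally show ?thesis .
qed

text \<open>p divides a value at 1 exactly when it divides the corresponding half norm, which enters
  squared; so p comes together with p^2.\<close>

lemma S_p_dvd: assumes "d \<in> S" "int p dvd d" shows "int p ^ 3 dvd d"
proof -
  obtain a b c e A B :: int where d: "d = (a\<^sup>2 - b\<^sup>2) * (c\<^sup>2 + e\<^sup>2) * A\<^sup>2 * B\<^sup>2"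
    and A: "[A = (a\<^sup>2 - b\<^sup>2) ^ m] (mod int p)" and B: "[B = (c\<^sup>2 + e\<^sup>2) ^ m] (mod int p)"
    by (rule S_structure[OF assms(1)]) (rule that)
  have "int p dvd (a\<^sup>2 - b\<^sup>2) \<or> int p dvd (c\<^sup>2 + e\<^sup>2) \<or> int p dvd A \<or> int p dvd B"
    using assms(2) prime_int_p unfolding d by (simp add: prime_dvd_mult_iff prime_dvd_power_iff)
  hence "(int p dvd (a\<^sup>2 - b\<^sup>2) \<and> int p dvd A) \<or> (int p dvd (c\<^sup>2 + e\<^sup>2) \<and> int p dvd B)"
    using p_dvd_power_cong[OF A] p_dvd_power_cong[OF B] by blast
  hence "int p * int p ^ 2 dvd (a\<^sup>2 - b\<^sup>2) * A\<^sup>2 \<or> int p * int p ^ 2 dvd (c\<^sup>2 + e\<^sup>2) * B\<^sup>2"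
    by (auto intro: mult_dvd_mono dvd_power_same)
  moreover have "d = (a\<^sup>2 - b\<^sup>2) * A\<^sup>2 * ((c\<^sup>2 + e\<^sup>2) * B\<^sup>2)" unfolding d by (simp add: mult_ac)
  ultimately have "int p * int p ^ 2 dvd d" by (metis dvd_mult dvd_mult2)
  thus ?thesis by (simp add: power3_eq_cube power2_eq_square mult.assoc)
qed

end

section \<open>Powers of 2 in the values\<close>

lemma diff_squares_parity:
  fixes a b :: int assumes "even (a - b)" shows "4 dvd a\<^sup>2 - b\<^sup>2"
proof -
  have "2 * 2 dvd (a - b) * (a + b)" using assms by (intro mult_dvd_mono) auto
  thus ?thesis by (simp add: power2_eq_square algebra_simps)
qed

lemma odd_sq_mod_8: assumes "odd a" obtains k :: int where "a\<^sup>2 = 8 * k + 1"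
proof -
  obtain j where j: "a = 2 * j + 1" using assms by (rule oddE)
  have "even (j * (j + 1))" by simp
  then obtain k where "j * (j + 1) = 2 * k" by (rule evenE)
  hence "a\<^sup>2 = 8 * k + 1" by (simp add: j power2_eq_square algebra_simps)
  thus ?thesis by (rule that)
qed

text \<open>If A and B are even their squares suffice. Otherwise a, b, c, e share one parity: if
  even, both factors at 1 are divisible by 4; if odd, they are divisible by 8 and by 2.\<close>

lemma even_value_16_dvd:
  fixes a b c e A B :: int
  assumes d: "d = (a\<^sup>2 - b\<^sup>2) * (c\<^sup>2 + e\<^sup>2) * A\<^sup>2 * B\<^sup>2" and par: "even (a - c)" "even (b - e)" "even (A - B)"
    and "even d"
  shows "16 dvd d"
proof (cases "even A")
  case True
  hence "even B" using par(3) by simp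
  hence "2 ^ 2 * 2 ^ 2 dvd A\<^sup>2 * B\<^sup>2" using True by (intro mult_dvd_mono dvd_power_same)
  hence "16 dvd (a\<^sup>2 - b\<^sup>2) * (c\<^sup>2 + e\<^sup>2) * (A\<^sup>2 * B\<^sup>2)" by (simp add: dvd_mult)
  thus ?thesis unfolding d by (simp add: mult.assoc)
next
  case False
  hence "odd B" using par(3) by simp
  have "16 dvd (a\<^sup>2 - b\<^sup>2) * (c\<^sup>2 + e\<^sup>2)"
  proof (cases "even a")
    case True
    have "even b" using \<open>even d\<close> par True False \<open>odd B\<close> unfolding d by auto
    hence ev: "even c" "even e" using par True by auto
    have "2 ^ 2 dvd c\<^sup>2 + e\<^sup>2" using ev by (intro dvd_add dvd_power_same)
    moreover have "2 ^ 2 dvd a\<^sup>2 - b\<^sup>2" using True \<open>even b\<close> by (intro dvd_diff dvd_power_same)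
    ultimately have "2 ^ 2 * 2 ^ 2 dvd (a\<^sup>2 - b\<^sup>2) * (c\<^sup>2 + e\<^sup>2)" by (intro mult_dvd_mono)
    thus ?thesis by simp
  next
    case a: False
    have "odd b" using \<open>even d\<close> par a False \<open>odd B\<close> unfolding d by auto
    hence od: "odd c" "odd e" using par a by auto
    obtain i j where "a\<^sup>2 = 8 * i + 1" "b\<^sup>2 = 8 * j + 1" using odd_sq_mod_8[OF a] odd_sq_mod_8[OF \<open>odd b\<close>] by metis
    hence "8 dvd a\<^sup>2 - b\<^sup>2" by simp
    moreover have "2 dvd c\<^sup>2 + e\<^sup>2" using od by simp
    ultimately have "8 * 2 dvd (a\<^sup>2 - b\<^sup>2) * (c\<^sup>2 + e\<^sup>2)" by (rule mult_dvd_mono)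
    thus ?thesis by simp
  qed
  thus ?thesis unfolding d by (rule dvd_mult2[OF dvd_mult2])
qed

text \<open>With A and B even, the remaining 2n would be divisible by 4; so the twos sit in the
  factors at 1. If c is even then so are a, b, e, and halving all four leaves 2n, which has no room
  for a second halving of c and e.\<close>

lemma exact_32_structure:
  fixes a b c e A B n :: int
  assumes d: "(a\<^sup>2 - b\<^sup>2) * (c\<^sup>2 + e\<^sup>2) * A\<^sup>2 * B\<^sup>2 = 32 * n" and "odd n"
    and par: "even (a - c)" "even (b - e)" "even (A - B)"
  obtains g c' e' where "g = 1 \<or> g = 2" "c = g * c'" "e = g * e'" "odd c'" "odd e'" "odd B"
proof -
  have no4: "\<not> 4 dvd 2 * n" using \<open>odd n\<close> by presburger
  have "odd A"
  proof
    assume "even A"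
    hence "even B" using par(3) by simp
    obtain A' B' where AB: "A = 2 * A'" "B = 2 * B'" using \<open>even A\<close> \<open>even B\<close> by (auto elim!: evenE)
    have eq: "(a\<^sup>2 - b\<^sup>2) * (c\<^sup>2 + e\<^sup>2) * (A'\<^sup>2 * B'\<^sup>2) = 2 * n" using d by (simp add: AB power_mult_distrib mult_ac)
    show False
    proof (cases "even (a - b)")
      case True
      hence "even (c\<^sup>2 + e\<^sup>2)" using par by auto
      hence "4 * 2 dvd (a\<^sup>2 - b\<^sup>2) * (c\<^sup>2 + e\<^sup>2)" using diff_squares_parity[OF True] by (intro mult_dvd_mono)
      hence "4 dvd (a\<^sup>2 - b\<^sup>2) * (c\<^sup>2 + e\<^sup>2)" by (meson dvd_mult_left)
      thus False using no4 unfolding eq[symmetric] by (simp add: dvd_mult2)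
    next
      case False
      have "odd (a\<^sup>2 - b\<^sup>2)" "odd (c\<^sup>2 + e\<^sup>2)" using False par by auto
      moreover have "even ((a\<^sup>2 - b\<^sup>2) * (c\<^sup>2 + e\<^sup>2) * (A'\<^sup>2 * B'\<^sup>2))" unfolding eq by simp
      ultimately have "even A' \<or> even B'" by simp
      hence "2 ^ 2 dvd A'\<^sup>2 * B'\<^sup>2" by (metis dvd_mult dvd_mult2 dvd_power_same)
      hence "4 dvd (a\<^sup>2 - b\<^sup>2) * (c\<^sup>2 + e\<^sup>2) * (A'\<^sup>2 * B'\<^sup>2)" by (simp add: dvd_mult)
      thus False using no4 unfolding eq by simp
    qed
  qed
  hence "odd B" using par(3) by simp
  have "even ((a\<^sup>2 - b\<^sup>2) * (c\<^sup>2 + e\<^sup>2) * A\<^sup>2 * B\<^sup>2)" unfolding d by simp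
  hence "even (a - b)" "even (c - e)" using \<open>odd A\<close> \<open>odd B\<close> par by auto
  show ?thesis
  proof (cases "even c")
    case False
    thus ?thesis using that[of 1 c e] \<open>even (c - e)\<close> \<open>odd B\<close> by simp
  next
    case True
    hence "even e" "even a" "even b" using \<open>even (c - e)\<close> \<open>even (a - b)\<close> par by auto
    then obtain a' b' c' e' where dbl: "a = 2 * a'" "b = 2 * b'" "c = 2 * c'" "e = 2 * e'"
      using True by (auto elim!: evenE)
    have eq: "(a'\<^sup>2 - b'\<^sup>2) * (c'\<^sup>2 + e'\<^sup>2) * (A\<^sup>2 * B\<^sup>2) = 2 * n"
    proof -
      have "16 * ((a'\<^sup>2 - b'\<^sup>2) * (c'\<^sup>2 + e'\<^sup>2) * (A\<^sup>2 * B\<^sup>2)) = 32 * n"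
        unfolding d[symmetric] dbl by (simp add: power_mult_distrib algebra_simps)
      thus ?thesis by (simp add: mult_ac)
    qed
    have na: "odd (a' - b')"
    proof
      assume "even (a' - b')"
      hence "4 dvd (a'\<^sup>2 - b'\<^sup>2) * ((c'\<^sup>2 + e'\<^sup>2) * (A\<^sup>2 * B\<^sup>2))" by (intro dvd_mult2 diff_squares_parity)
      thus False using no4 unfolding eq[symmetric] by (simp add: mult.assoc)
    qed
    have "even ((a'\<^sup>2 - b'\<^sup>2) * (c'\<^sup>2 + e'\<^sup>2) * (A\<^sup>2 * B\<^sup>2))" unfolding eq by simp
    hence ce: "even (c' - e')" using na \<open>odd A\<close> \<open>odd B\<close> by auto
    have "odd c'"
    proof
      assume "even c'"
      hence "2 ^ 2 dvd c'\<^sup>2 + e'\<^sup>2" using ce by (intro dvd_add dvd_power_same) auto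
      hence "4 dvd (c'\<^sup>2 + e'\<^sup>2) * ((a'\<^sup>2 - b'\<^sup>2) * (A\<^sup>2 * B\<^sup>2))" by (simp add: dvd_mult2)
      thus False using no4 unfolding eq[symmetric] by (simp add: mult_ac)
    qed
    thus ?thesis using that[of 2 c' e'] dbl ce \<open>odd B\<close> by simp
  qed
qed

section \<open>Lower bounds for values with exactly 2^5\<close>

context prime_roots
begin

lemma fermat_int: assumes "\<not> int p dvd x" shows "[x ^ (2 * m) = 1] (mod int p)"
proof -
  have "\<not> p dvd nat \<bar>x\<bar>" using assms by (simp add: nat_abs_dvd_iff flip: int_dvd_int_iff)
  hence "[nat \<bar>x\<bar> ^ (p - 1) = 1] (mod p)" by (rule fermat_theorem[OF prime_p])
  hence "[int (nat \<bar>x\<bar> ^ (p - 1)) = int 1] (mod int p)" by (simp only: cong_int_iff)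
  moreover have "p - 1 = 2 * m" using p_eq by simp
  ultimately show ?thesis by (simp add: power_even_abs)
qed

text \<open>If p divides neither x nor y, raising x^2 = -y^2 to the odd power m gives 1 = -1 modulo
  p by Fermat.\<close>

lemma p_dvd_sum_squares:
  assumes "p mod 4 = 3" "int p dvd c\<^sup>2 + e\<^sup>2" shows "int p dvd c \<and> int p dvd e"
proof -
  have *: "int p dvd x" if "int p dvd x\<^sup>2 + y\<^sup>2" for x y
  proof (rule ccontr)
    assume nx: "\<not> int p dvd x"
    have ny: "\<not> int p dvd y"
    proof
      assume "int p dvd y"
      hence "int p dvd x\<^sup>2" using that by (simp add: dvd_add_left_iff power2_eq_square)
      thus False using nx prime_int_p prime_dvd_power by blast
    qed
    have "[x\<^sup>2 = - y\<^sup>2] (mod int p)" using that by (simp add: cong_iff_dvd_diff)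
    hence "[(x\<^sup>2) ^ m = (- y\<^sup>2) ^ m] (mod int p)" by (rule cong_pow)
    moreover have "odd m" using assms(1) p_eq by presburger
    ultimately have "[x ^ (2 * m) = - (y ^ (2 * m))] (mod int p)" by (simp add: power_mult)
    moreover have "[- (y ^ (2 * m)) = - 1] (mod int p)" using fermat_int[OF ny] by (simp add: cong_minus_minus_iff)
    ultimately have "[1 = - 1] (mod int p)" using fermat_int[OF nx] by (metis cong_sym cong_trans)
    hence "int p dvd 2" by (simp add: cong_iff_dvd_diff)
    hence "int p \<le> 2" by (rule zdvd_imp_le) simp
    thus False using p_gt by simp
  qed
  show ?thesis using *[of c e] *[of e c] assms(2) by (simp add: add.commute)
qed

text \<open>An odd B that is 1 or -1 modulo p is so modulo 2p, and the least such B > 1 is 2p -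
  1.\<close>

lemma odd_pm1_bound:
  assumes B: "odd B" "B \<ge> 0" "B \<noteq> 1" and sq: "[B\<^sup>2 = 1] (mod int p)"
  shows "B \<ge> 2 * int p - 1"
proof -
  have "B \<ge> 2" using B by presburger
  have "int p dvd (B - 1) * (B + 1)"
    using sq by (simp add: cong_iff_dvd_diff power2_eq_square algebra_simps)
  hence "int p dvd B - 1 \<or> int p dvd B + 1" using prime_int_p by (simp add: prime_dvd_mult_iff)
  moreover have "coprime (int p) 2" using odd_p by simp
  ultimately have "2 * int p dvd B - 1 \<or> 2 * int p dvd B + 1"
    using B(1) by (auto intro!: divides_mult simp: coprime_commute)
  thus ?thesis
    using zdvd_imp_le[of "2 * int p" "B - 1"] zdvd_imp_le[of "2 * int p" "B + 1"] \<open>B \<ge> 2\<close> by auto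
qed

lemma exact_32_lower_bound:
  fixes a b c e A B n :: int
  assumes d: "(a\<^sup>2 - b\<^sup>2) * (c\<^sup>2 + e\<^sup>2) * A\<^sup>2 * B\<^sup>2 = 2 ^ 5 * int p ^ l * n"
    and par: "even (a - c)" "even (b - e)" "even (A - B)"
    and B: "[B = (c\<^sup>2 + e\<^sup>2) ^ m] (mod int p)" "B \<ge> 0" "B = 1 \<Longrightarrow> int p dvd c \<or> int p dvd e"
    and n: "coprime n (2 * int p)" and np: "\<not> int p dvd c\<^sup>2 + e\<^sup>2"
  shows "2 * \<bar>n\<bar> \<ge> (int p)\<^sup>2 + 1"
proof -
  have "odd n" using n by (auto simp: coprime_right_2_iff_odd)
  have "odd (int p ^ l * n)" using \<open>odd n\<close> odd_p by simp
  have eq: "(a\<^sup>2 - b\<^sup>2) * (c\<^sup>2 + e\<^sup>2) * A\<^sup>2 * B\<^sup>2 = 32 * (int p ^ l * n)" using d by (simp add: mult.assoc)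
  obtain g c' e' where g: "g = 1 \<or> g = 2" "c = g * c'" "e = g * e'" "odd c'" "odd e'" "odd B"
    by (rule exact_32_structure[OF eq \<open>odd (int p ^ l * n)\<close> par]) (rule that)
  obtain i j where ij: "c'\<^sup>2 = 8 * i + 1" "e'\<^sup>2 = 8 * j + 1" using odd_sq_mod_8 g(4,5) by metis
  \<comment> \<open>Odd squares are 1 modulo 8, so half the sum of two of them is 1 modulo 4, in
    particular odd.\<close>
  define W where "W = 4 * (i + j) + 1"
  have W: "c'\<^sup>2 + e'\<^sup>2 = 2 * W" "odd W" by (simp_all add: W_def ij)
  have Y: "c\<^sup>2 + e\<^sup>2 = g\<^sup>2 * (2 * W)" unfolding W(1)[symmetric] g(2,3) by (simp add: power_mult_distrib algebra_simps)
  have nW: "\<not> int p dvd W" using np unfolding Y by (auto intro: dvd_mult)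
  have nB: "\<not> int p dvd B" using np p_dvd_power_cong[OF B(1)] by simp
  have "W * B\<^sup>2 dvd 2 ^ 5 * int p ^ l * n"
  proof -
    have "2 ^ 5 * int p ^ l * n = W * B\<^sup>2 * ((a\<^sup>2 - b\<^sup>2) * (g\<^sup>2 * 2) * A\<^sup>2)" unfolding d[symmetric] Y by (simp add: mult_ac)
    thus ?thesis by (rule dvdI)
  qed
  moreover have "coprime (W * B\<^sup>2) (2 ^ 5 * int p ^ l)"
  proof -
    have "coprime (W * B\<^sup>2) 2" using W(2) g(6) by (simp add: coprime_right_2_iff_odd)
    moreover have "coprime (int p) (W * B\<^sup>2)"
      using nW nB prime_int_p by (intro prime_imp_coprime) (auto simp: prime_dvd_mult_iff prime_dvd_power_iff)
    ultimately have "coprime (W * B\<^sup>2) (2 ^ 5)" "coprime (W * B\<^sup>2) (int p ^ l)"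
      unfolding coprime_power_right_iff by (simp_all add: coprime_commute)
    thus ?thesis by (simp only: coprime_mult_right_iff)
  qed
  \<comment> \<open>Being prime to 2p, W and B have no room in 2^5 p^l and pass to n.\<close>
  ultimately have "W * B\<^sup>2 dvd n" by (simp add: coprime_dvd_mult_right_iff)
  moreover have "n \<noteq> 0" using \<open>odd n\<close> by auto
  ultimately have le: "\<bar>W * B\<^sup>2\<bar> \<le> \<bar>n\<bar>" by (simp add: dvd_imp_le_int)
  have pos: "c'\<^sup>2 \<ge> 1" "e'\<^sup>2 \<ge> 1" using g(4,5) by (auto simp: int_one_le_iff_zero_less)
  have "W \<ge> 1" using W(1) pos by linarith
  have "B \<ge> 1" using g(6) B(2) by presburger
  have pg: "int p > 2" using p_gt by simp
  show ?thesis
  proof (cases "B = 1")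
    case True
    have nd2: "\<not> int p dvd 2" using zdvd_imp_le[of "int p" 2] pg by auto
    have pd: "int p dvd c' \<or> int p dvd e'"
      using B(3)[OF True] g(1) nd2 prime_int_p unfolding g(2,3) by (auto simp: prime_dvd_mult_iff)
    have sq: "x\<^sup>2 \<ge> (int p)\<^sup>2" if "int p dvd x" "odd x" for x
    proof -
      have "x \<noteq> 0" using that by auto
      hence "\<bar>int p\<bar> \<le> \<bar>x\<bar>" using that(1) by (rule dvd_imp_le_int)
      thus ?thesis by (simp only: abs_le_square_iff)
    qed
    \<comment> \<open>One of the odd numbers c', e' is divisible by p, and the other is at least
      nonzero.\<close>
    have "2 * W \<ge> (int p)\<^sup>2 + 1" unfolding W(1)[symmetric] using pd
      by (elim disjE) (use sq[of c'] sq[of e'] g(4,5) pos in auto)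
    thus ?thesis using le True \<open>W \<ge> 1\<close> by simp
  next
    case False
    have "[B\<^sup>2 = (c\<^sup>2 + e\<^sup>2) ^ (2 * m)] (mod int p)"
      using cong_pow[OF B(1), of 2] by (simp add: power_mult[symmetric] mult.commute)
    hence "[B\<^sup>2 = 1] (mod int p)" using fermat_int[OF np] by (rule cong_trans)
    hence "2 * int p - 1 \<le> B" using odd_pm1_bound g(6) B(2) False by blast
    \<comment> \<open>This bound is enough, since it gives 2 B^2 >= p^2 + 1.\<close>
    hence "int p \<le> B" using pg by linarith
    hence "(int p)\<^sup>2 \<le> B\<^sup>2" using pg by (intro power_mono) auto
    moreover have "1 \<le> B\<^sup>2" using \<open>B \<ge> 1\<close> by (simp add: one_le_power)
    moreover have "B\<^sup>2 \<le> W * B\<^sup>2" using \<open>W \<ge> 1\<close> by (simp add: mult_le_cancel_right1)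
    ultimately show ?thesis using le by linarith
  qed
qed

lemma S_32_lower_bound:
  assumes n: "coprime n (2 * int p)" and d: "2 ^ 5 * int p ^ l * n \<in> S"
    and l: "l = 0 \<or> p mod 4 = 3 \<and> (l = 3 \<or> l = 5)"
  shows "2 * \<bar>n\<bar> \<ge> (int p)\<^sup>2 + 1"
proof -
  obtain a b c e A B :: int where d: "2 ^ 5 * int p ^ l * n = (a\<^sup>2 - b\<^sup>2) * (c\<^sup>2 + e\<^sup>2) * A\<^sup>2 * B\<^sup>2"
    and par: "even (a - c)" "even (b - e)" "even (A - B)"
    and A: "[A = (a\<^sup>2 - b\<^sup>2) ^ m] (mod int p)" and B: "[B = (c\<^sup>2 + e\<^sup>2) ^ m] (mod int p)"
    and B2: "B \<ge> 0" "B = 1 \<Longrightarrow> int p dvd c \<or> int p dvd e"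
    by (rule S_structure[OF d]) (rule that)
  let ?P = "int p"
  have P0: "?P \<noteq> 0" using p_gt by simp
  have ndvd: "\<not> ?P dvd 2 ^ 5 * n"
  proof
    assume "?P dvd 2 ^ 5 * n"
    hence "?P dvd 2 \<or> ?P dvd n" using prime_int_p by (metis prime_dvd_mult_iff prime_dvd_power)
    thus False
    proof
      assume "?P dvd 2" thus False using zdvd_imp_le[of ?P 2] p_gt by auto
    next
      assume "?P dvd n"
      hence "is_unit ?P" using n by (metis coprime_common_divisor dvd_triv_right)
      thus False using prime_int_p not_prime_unit by blast
    qed
  qed
  have "\<not> ?P dvd c\<^sup>2 + e\<^sup>2"
  proof
    assume Y: "?P dvd c\<^sup>2 + e\<^sup>2"
    show False
    proof (cases "l = 0")
      case True
      have "?P dvd 2 ^ 5 * ?P ^ l * n" unfolding d using Y by simp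
      thus False using ndvd True by simp
    next
      case False
      hence p3: "p mod 4 = 3" and l35: "l = 3 \<or> l = 5" using l by auto
      \<comment> \<open>Sums of two squares are divisible by p only in squares, so here p^4 splits off exactly.\<close>
      obtain c' e' where ce: "c = ?P * c'" "e = ?P * e'" using p_dvd_sum_squares[OF p3 Y] by (auto elim!: dvdE)
      have "?P dvd B" using p_dvd_power_cong[OF B] Y by simp
      then obtain B' where B': "B = ?P * B'" by (rule dvdE)
      have eq: "2 ^ 5 * ?P ^ l * n = ?P ^ 4 * ((a\<^sup>2 - b\<^sup>2) * (c'\<^sup>2 + e'\<^sup>2) * A\<^sup>2 * B'\<^sup>2)"
        unfolding d ce B' by (simp add: power_mult_distrib eval_nat_numeral algebra_simps)
      from l35 show False
      proof
        assume "l = 3"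
        hence "?P ^ 3 * (2 ^ 5 * n) = ?P ^ 3 * (?P * ((a\<^sup>2 - b\<^sup>2) * (c'\<^sup>2 + e'\<^sup>2) * A\<^sup>2 * B'\<^sup>2))"
          using eq by (simp add: eval_nat_numeral algebra_simps)
        hence "2 ^ 5 * n = ?P * ((a\<^sup>2 - b\<^sup>2) * (c'\<^sup>2 + e'\<^sup>2) * A\<^sup>2 * B'\<^sup>2)" using P0 by (metis mult_cancel_left power_not_zero)
        thus False using ndvd by simp
      next
        assume "l = 5"
        hence "?P ^ 4 * (?P * (2 ^ 5 * n)) = ?P ^ 4 * ((a\<^sup>2 - b\<^sup>2) * (c'\<^sup>2 + e'\<^sup>2) * A\<^sup>2 * B'\<^sup>2)"
          using eq by (simp add: eval_nat_numeral algebra_simps)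
        hence eq': "?P * (2 ^ 5 * n) = (a\<^sup>2 - b\<^sup>2) * (c'\<^sup>2 + e'\<^sup>2) * A\<^sup>2 * B'\<^sup>2" using P0 by (metis mult_cancel_left power_not_zero)
        \<comment> \<open>A single p is left, but every place where it could occur brings p^2: in
          a^2 - b^2 it comes with A, in c'^2 + e'^2 it comes squared because p = 3 mod 4, and B'
          enters squared.\<close>
        have "?P dvd (a\<^sup>2 - b\<^sup>2) * (c'\<^sup>2 + e'\<^sup>2) * A\<^sup>2 * B'\<^sup>2" unfolding eq'[symmetric] by simp
        hence "?P dvd a\<^sup>2 - b\<^sup>2 \<or> ?P dvd c'\<^sup>2 + e'\<^sup>2 \<or> ?P dvd A \<or> ?P dvd B'"
          using prime_int_p by (simp add: prime_dvd_mult_iff prime_dvd_power_iff)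
        hence "?P dvd A \<or> ?P dvd B' \<or> ?P\<^sup>2 dvd c'\<^sup>2 + e'\<^sup>2"
          using p_dvd_power_cong[OF A] p_dvd_sum_squares[OF p3, of c' e'] by (auto intro: dvd_add dvd_power_same)
        hence "?P\<^sup>2 dvd A\<^sup>2 \<or> ?P\<^sup>2 dvd B'\<^sup>2 \<or> ?P\<^sup>2 dvd c'\<^sup>2 + e'\<^sup>2" by (auto intro: dvd_power_same)
        hence "?P\<^sup>2 dvd ?P * (2 ^ 5 * n)" unfolding eq' by (auto intro: dvd_mult dvd_mult2)
        hence "?P dvd 2 ^ 5 * n" using P0 by (simp add: power2_eq_square)
        thus False using ndvd by simp
      qed
    qed
  qed
  thus ?thesis using exact_32_lower_bound[OF d[symmetric] par B B2 n] by blast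
qed

lemma S_even: assumes "d \<in> S" "even d" shows "16 dvd d"
proof -
  obtain a b c e A B :: int where "d = (a\<^sup>2 - b\<^sup>2) * (c\<^sup>2 + e\<^sup>2) * A\<^sup>2 * B\<^sup>2"
    "even (a - c)" "even (b - e)" "even (A - B)"
    by (rule S_structure[OF assms(1)]) (rule that)
  thus ?thesis using even_value_16_dvd assms(2) by blast
qed

end

section \<open>Sums of two squares, and the values 2^5 p^5 and 2^5 5^3\<close>

text \<open>Pigeonhole: with r the integer part of sqrt p there are (r + 1)^2 > p pairs (i, j) but
  only p residues of i - x j. The difference of two colliding pairs has entries of absolute value at
  most r.\<close>

lemma thue:
  fixes x :: int and p :: nat
  assumes "p > 1"
  obtains a b :: int where "(a, b) \<noteq> (0, 0)" "int p dvd a - x * b" "a\<^sup>2 \<le> int p" "b\<^sup>2 \<le> int p"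
proof -
  define r where "r = nat \<lfloor>sqrt (real p)\<rfloor>"
  have r: "real r \<le> sqrt (real p)" "sqrt (real p) < real r + 1"
    by (simp_all add: r_def)
  have "real p < (real r + 1)\<^sup>2" using r(2) by (smt (verit) real_sqrt_lt_0_iff real_sqrt_pow2 of_nat_0_le_iff power2_eq_square power_strict_mono real_sqrt_ge_zero zero_less_numeral)
  hence "real p < real ((r + 1) * (r + 1))" by (simp add: power2_eq_square algebra_simps)
  hence pr: "p < (r + 1) * (r + 1)" by (simp only: of_nat_less_iff)
  have "(real r)\<^sup>2 \<le> real p" using r(1) by (metis of_nat_0_le_iff power_mono real_sqrt_pow2)
  hence rp: "(int r)\<^sup>2 \<le> int p" by (metis of_nat_le_iff of_nat_power)
  define f where "f = (\<lambda>(i, j). (int i - x * int j) mod int p)"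
  have "f ` ({..r} \<times> {..r}) \<subseteq> {0..<int p}" using assms by (auto simp: f_def)
  hence "card (f ` ({..r} \<times> {..r})) \<le> card {0..<int p}" by (intro card_mono) auto
  also have "\<dots> < card ({..r} \<times> {..r})" using pr by (simp add: card_cartesian_product)
  finally have "\<not> inj_on f ({..r} \<times> {..r})" by (rule pigeonhole)
  then obtain i j i' j' where ij: "i \<le> r" "j \<le> r" "i' \<le> r" "j' \<le> r" "(i, j) \<noteq> (i', j')" "f (i, j) = f (i', j')"
    by (auto simp: inj_on_def)
  show ?thesis
  proof (rule that[of "int i - int i'" "int j - int j'"])
    show "(int i - int i', int j - int j') \<noteq> (0, 0)" using ij(5) by auto
    have "int p dvd (int i - x * int j) - (int i' - x * int j')"
      using ij(6) by (simp add: f_def mod_eq_dvd_iff)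
    thus "int p dvd int i - int i' - x * (int j - int j')" by (simp add: algebra_simps)
    have sq: "(int k - int k')\<^sup>2 \<le> int p" if "k \<le> r" "k' \<le> r" for k k'
    proof -
      have "\<bar>int k - int k'\<bar> \<le> \<bar>int r\<bar>" using that by auto
      hence "(int k - int k')\<^sup>2 \<le> (int r)\<^sup>2" by (simp only: abs_le_square_iff)
      thus ?thesis by (rule order_trans[OF _ rp])
    qed
    show "(int i - int i')\<^sup>2 \<le> int p" "(int j - int j')\<^sup>2 \<le> int p" using sq ij by auto
  qed
qed

context prime_roots
begin

text \<open>Take x with x^2 = -1 modulo p, from Euler's criterion. For the pair given by
  \<open>thue\<close>, a^2 + b^2 is a positive multiple of p below 2p; the upper bound is strict
  because p is not a square.\<close>

lemma sum_two_squares: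
  assumes "p mod 4 = 1" obtains a b :: int where "int p = a\<^sup>2 + b\<^sup>2"
proof -
  have "even m" using assms p_eq by presburger
  have "[Legendre (- 1) (int p) = (- 1) ^ ((p - 1) div 2)] (mod int p)"
    by (rule euler_criterion[OF prime_p p_gt(1)])
  hence L: "[Legendre (- 1) (int p) = 1] (mod int p)" using \<open>even m\<close> by (simp add: m_def)
  have "QuadRes (int p) (- 1)"
  proof (rule ccontr)
    assume "\<not> QuadRes (int p) (- 1)"
    hence "Legendre (- 1) (int p) = 0 \<or> Legendre (- 1) (int p) = - 1" by (auto simp: Legendre_def)
    hence "int p dvd 1 \<or> int p dvd 2" using L by (auto simp: cong_iff_dvd_diff)
    hence "int p \<le> 2" using zdvd_imp_le[of "int p" 1] zdvd_imp_le[of "int p" 2] by auto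
    thus False using p_gt by simp
  qed
  then obtain x where "[x\<^sup>2 = - 1] (mod int p)" by (auto simp: QuadRes_def)
  hence x: "int p dvd x\<^sup>2 + 1" by (simp add: cong_iff_dvd_diff)
  obtain a b :: int where ab: "(a, b) \<noteq> (0, 0)" "int p dvd a - x * b" "a\<^sup>2 \<le> int p" "b\<^sup>2 \<le> int p"
    by (rule thue[OF p_gt(3)]) (rule that)
  have nsq: "y\<^sup>2 \<noteq> int p" for y :: int
  proof
    assume y: "y\<^sup>2 = int p"
    have "prime (y\<^sup>2)" using prime_p unfolding y by simp
    thus False using prime_power_iff[of y 2] by simp
  qed
  have "a\<^sup>2 + b\<^sup>2 = (a - x * b) * (a + x * b) + (x\<^sup>2 + 1) * b\<^sup>2" by (simp add: power2_eq_square algebra_simps)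
  hence "int p dvd a\<^sup>2 + b\<^sup>2" using ab(2) x by simp
  then obtain k where k: "a\<^sup>2 + b\<^sup>2 = int p * k" by (rule dvdE)
  have "a\<^sup>2 + b\<^sup>2 > 0" using ab(1) by (simp add: sum_power2_gt_zero_iff)
  moreover have "a\<^sup>2 + b\<^sup>2 < int p * 2" using ab(3,4) nsq[of a] nsq[of b] by linarith
  ultimately have "int p * 0 < int p * k" "int p * k < int p * 2" using k by auto
  hence "0 < k" "k < 2" by (simp_all only: mult_less_cancel_left_pos p_gt of_nat_0_less_iff)
  hence "k = 1" by simp
  thus ?thesis using that[of a b] k by simp
qed

text \<open>For p = a^2 + b^2 both a + b and a - b are odd and their squares sum to 2p; this puts
  the fifth p into the sum of squares at 1.\<close>

lemma S_32_p5: assumes "p mod 4 = 1" shows "2 ^ 5 * int p ^ 5 \<in> S"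
proof -
  obtain a b :: int where ab: "int p = a\<^sup>2 + b\<^sup>2" by (rule sum_two_squares[OF assms])
  have "odd (a\<^sup>2 + b\<^sup>2)" unfolding ab[symmetric] using odd_p by simp
  hence "odd (a + b)" "odd (a - b)" by auto
  from S_16_p4[OF this] have "16 * ((a + b)\<^sup>2 + (a - b)\<^sup>2) * int p ^ 4 \<in> S" .
  moreover have "(a + b)\<^sup>2 + (a - b)\<^sup>2 = 2 * int p"
    unfolding ab by (simp add: power2_eq_square algebra_simps)
  ultimately have "16 * (2 * int p) * int p ^ 4 \<in> S" by simp
  thus ?thesis by (simp add: eval_nat_numeral mult_ac)
qed

text \<open>Off 1, \<open>x = z + cnj z\<close> is a root of x^2 + x - 1, so that the second factor is
  (x + 1)^2 + 1 = 3 + x = 5 / (2 - x).\<close>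

lemma S_4000: assumes p5: "p = 5" shows "- 4000 \<in> S"
proof -
  \<comment> \<open>At 1 these are 3, 5 and 1, giving (9 - 25)(9 + 1) = -160; the remaining 25 is
    the norm of the sum of squares. Unlike in the two families, the second square does not vanish
    off 1.\<close>
  define f g g2 :: "complex \<Rightarrow> complex" where "f = (\<lambda>z. 1 + z + z ^ 2)" and
    "g = (\<lambda>z. z ^ 2 * (1 + 2 * (z + z ^ 2)))" and "g2 = (\<lambda>z. z ^ 2)"
  have m2: "m = 2" using p_eq p5 by simp
  have R: "f \<in> R" "g \<in> R" "g2 \<in> R" unfolding f_def g_def g2_def by auto
  have gg: "g \<approx> g2" unfolding g_def g2_def
    by (rule cong2_I[of "\<lambda>z. z ^ 2 * (z + z ^ 2)"]) (auto simp: algebra_simps)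
  let ?u = "\<lambda>z. f z * cnj (f z) - g z * cnj (g z)" and ?v = "\<lambda>z. f z * cnj (f z) + g2 z * cnj (g2 z)"
  have u: "nrm ?u = 1"
  proof -
    \<comment> \<open>The difference is minus the square of the unit (z + 1)^2 / z.\<close>
    have "?u z = (- 1) ^ 1 * (cnj z ^ 1 * (z ^ 1 + 1) ^ 2) ^ 2" if "z \<in> \<mu>" for z
    proof -
      have id: "(1 + z + z ^ 2) * (1 + y + y ^ 2) - z ^ 2 * (1 + 2 * (z + z ^ 2)) * (y ^ 2 * (1 + 2 * (y + y ^ 2)))
          = - ((y * (z + 1) ^ 2) ^ 2)" if zy: "z * y = 1" for y :: complex
      proof -
        have "(1 + z + z ^ 2) * (1 + y + y ^ 2) =
            1 + y + y ^ 2 + z + z * y + (z * y) * y + z ^ 2 + z * (z * y) + (z * y) ^ 2"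
          by (simp add: power2_eq_square algebra_simps)
        moreover have "z ^ 2 * (1 + 2 * (z + z ^ 2)) * (y ^ 2 * (1 + 2 * (y + y ^ 2))) = (z * y) ^ 2 *
            (1 + 2 * y + 2 * y ^ 2 + 2 * z + 4 * (z * y) + 4 * ((z * y) * y) + 2 * z ^ 2 + 4 * (z * (z * y)) + 4 * (z * y) ^ 2)"
          by (simp add: power2_eq_square algebra_simps)
        moreover have "y * (z + 1) ^ 2 = z * (z * y) + 2 * (z * y) + y"
          by (simp add: power2_eq_square algebra_simps)
        moreover have "(z + 2 + y) ^ 2 = z ^ 2 + y ^ 2 + 4 + 4 * z + 4 * y + 2 * (z * y)"
          by (simp add: power2_eq_square algebra_simps)
        ultimately show ?thesis by (simp add: zy)
      qed
      show ?thesis using id[OF \<mu>_cnj_mult[OF \<open>z \<in> \<mu>\<close>]] by (simp add: f_def g_def)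
    qed
    hence "nrm ?u = nrm (\<lambda>z. (- 1) ^ 1 * (cnj z ^ 1 * (z ^ 1 + 1) ^ 2) ^ 2)" by (intro nrm_cong)
    thus ?thesis unfolding nrm_mult nrm_power nrm_monom nrm_sign nrm_power_plus_1[OF not_p_dvd(1)]
      using nrm_monom(2)[of 1] nrm_sign[of 1] by simp
  qed
  have v: "nrm ?v = 25"
  proof -
    have "?v z * (z + cnj z - 2) = - 5" if "z \<in> \<mu>" "z \<noteq> 1" for z
    proof -
      have e2: "1 + z + cnj z + z ^ 2 + (cnj z) ^ 2 = 0"
        using \<Phi>_0[OF that] \<Phi>_eq_eps[OF that(1)] by (simp add: m2 eval_nat_numeral add_ac)
      have id: "((1 + z + z ^ 2) * (1 + y + y ^ 2) + z ^ 2 * y ^ 2) * (z + y - 2) = - 5"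
        if zy: "z * y = 1" and rel: "1 + z + y + z ^ 2 + y ^ 2 = 0" for y :: complex
      proof -
        have "(1 + z + z ^ 2) * (1 + y + y ^ 2) + z ^ 2 * y ^ 2 =
            1 + y + y ^ 2 + z + z * y + (z * y) * y + z ^ 2 + z * (z * y) + 2 * (z * y) ^ 2"
          by (simp add: power2_eq_square algebra_simps)
        also have "\<dots> = (1 + z + y + z ^ 2 + y ^ 2) + (3 + z + y)" by (simp add: zy)
        finally have 1: "(1 + z + z ^ 2) * (1 + y + y ^ 2) + z ^ 2 * y ^ 2 = 3 + z + y" by (simp add: rel)
        have "(3 + z + y) * (z + y - 2) = (1 + z + y + z ^ 2 + y ^ 2) + 2 * (z * y) - 7"
          by (simp add: power2_eq_square algebra_simps)
        thus ?thesis unfolding 1 by (simp add: zy rel)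
      qed
      show ?thesis using id[OF \<mu>_cnj_mult[OF that(1)] e2] by (simp add: f_def g2_def)
    qed
    hence "nrm (\<lambda>z. ?v z * (z + cnj z - 2)) = nrm (\<lambda>z. - 5)" by (intro nrm_cong)
    hence "nrm ?v * of_nat (p\<^sup>2) = nrm (\<lambda>z. - 5)" unfolding nrm_mult nrm_binomials(4) .
    moreover have "nrm (\<lambda>z. - 5) = 625" by (simp add: nrm_const m2)
    moreover have "of_nat (p\<^sup>2) = (25 :: complex)" by (simp add: p5)
    ultimately show ?thesis by simp
  qed
  show ?thesis
  proof (rule S_I[OF R(1,2,1,3) cong2_refl gg])
    show "of_int (- 4000) = dval f g f g2"
      unfolding dval_def prod_\<mu> u v by (simp add: f_def g_def g2_def)
  qed
qed

section \<open>Assembling the assertions from the explicit values\<close>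

lemma decompose_2_p:
  fixes d :: int assumes "d \<noteq> 0"
  obtains k l n where "d = 2 ^ k * int p ^ l * n" "coprime n (2 * int p)"
proof -
  obtain x where x: "d = 2 ^ multiplicity 2 d * x" "\<not> 2 dvd x"
    by (rule multiplicity_decompose'[of d 2]) (use assms in auto)
  obtain n where n: "x = int p ^ multiplicity (int p) x * n" "\<not> int p dvd n"
    by (rule multiplicity_decompose'[of x "int p"]) (use x assms prime_int_p in \<open>auto dest: not_prime_unit\<close>)
  have "odd n" using x(2) n(1) by (metis dvd_mult)
  hence "coprime n 2" by (simp add: coprime_right_2_iff_odd)
  moreover have "coprime n (int p)"
    using prime_imp_coprime[OF prime_int_p n(2)] by (simp add: coprime_commute)
  ultimately have "coprime n (2 * int p)" by simp
  moreover have "d = 2 ^ multiplicity 2 d * int p ^ multiplicity (int p) x * n"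
    using x(1) n(1) by (simp add: mult.assoc)
  ultimately show ?thesis using that by blast
qed

lemma S_valuations:
  assumes d: "2 ^ k * int p ^ l * n \<in> S" and n: "coprime n (2 * int p)"
  shows "k = 0 \<or> k \<ge> 4" "l = 0 \<or> l \<ge> 3"
proof -
  have n2: "odd n" using n by (auto simp: coprime_right_2_iff_odd)
  have np: "\<not> int p dvd n"
    using n prime_int_p by (metis coprime_common_divisor dvd_triv_right not_prime_unit)
  show "k = 0 \<or> k \<ge> 4"
  proof (rule ccontr)
    assume "\<not> (k = 0 \<or> k \<ge> 4)"
    hence k: "k > 0" "k < 4" by auto
    have "even (2 ^ k * int p ^ l * n)" using k by simp
    hence "2 ^ 4 dvd 2 ^ k * int p ^ l * n" using S_even[OF d] by simp
    moreover have "(2 :: int) ^ 4 = 2 ^ k * 2 ^ (4 - k)" using k by (simp flip: power_add)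
    ultimately have "2 ^ k * 2 ^ (4 - k) dvd 2 ^ k * (int p ^ l * n)" by (simp only: mult.assoc)
    hence "2 ^ (4 - k) dvd int p ^ l * n" by simp
    moreover have "(2 :: int) dvd 2 ^ (4 - k)" using k by simp
    ultimately have "2 dvd int p ^ l * n" using dvd_trans by blast
    thus False using n2 odd_p by simp
  qed
  show "l = 0 \<or> l \<ge> 3"
  proof (rule ccontr)
    assume "\<not> (l = 0 \<or> l \<ge> 3)"
    hence l: "l > 0" "l < 3" by auto
    have "int p dvd 2 ^ k * int p ^ l * n" using l by simp
    hence "int p ^ 3 dvd int p ^ l * (2 ^ k * n)" using S_p_dvd[OF d] by (simp add: mult_ac)
    moreover have "int p ^ 3 = int p ^ l * int p ^ (3 - l)" using l by (simp flip: power_add)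
    ultimately have "int p ^ (3 - l) dvd 2 ^ k * n" using p_gt by simp
    moreover have "int p dvd int p ^ (3 - l)" using l by simp
    ultimately have "int p dvd 2 ^ k * n" using dvd_trans by blast
    hence "int p dvd 2 \<or> int p dvd n" using prime_int_p by (metis prime_dvd_mult_iff prime_dvd_power)
    thus False using np zdvd_imp_le[of "int p" 2] p_gt by auto
  qed
qed

text \<open>The exponents 4, 6, 7, 8, 9 are starting values, 8 being 4 + 4; from 10 on a factor 2^4
  splits off and leaves an exponent at least 6.\<close>

lemma S_power_2: "k = 0 \<or> k = 4 \<or> k \<ge> 6 \<Longrightarrow> 2 ^ k \<in> S"
proof (induction k rule: less_induct)
  case (less k)
  consider "k = 0" | "k = 4" | "k = 6" | "k = 7" | "k = 8" | "k = 9" | "k \<ge> 4" "k \<ge> 10" using less.prems by linarith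
  thus ?case
  proof cases
    case 7
    hence "2 ^ (k - 4) \<in> S" by (intro less.IH) auto
    hence "2 ^ (k - 4) * 2 ^ 4 \<in> S" using S_16 by (intro S_mult) simp_all
    moreover have "(2 :: int) ^ k = 2 ^ (k - 4) * 2 ^ 4"
      using 7 by (simp only: power_add[symmetric] le_add_diff_inverse2)
    ultimately show ?thesis by (simp only:)
  qed (use S_one S_16 S_64 S_128_512 S_mult[OF S_16 S_16] in auto)
qed

text \<open>p^l is p^3 times an odd number, so one construction covers all l >= 3; products of p^3
  alone would miss 4 and 5.\<close>

lemma S_power_p: "l = 0 \<or> l \<ge> 3 \<Longrightarrow> int p ^ l \<in> S"
  using S_one S_p3_mult_odd[of "int p ^ (l - 3)"] odd_p by (auto simp flip: power_add)

lemma S_sufficient: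
  assumes "coprime n (2 * int p)" "l = 0 \<or> l \<ge> 3" "k = 0 \<or> k = 4 \<or> k \<ge> 6"
  shows "2 ^ k * int p ^ l * n \<in> S"
  by (intro S_mult S_power_2 S_power_p S_coprime assms)

text \<open>For l >= 7 split off p^4 and keep l - 4 >= 3. For l = 6 this would leave p^2, which is
  not a value, so 2^5 p^6 has its own construction.\<close>

lemma S_sufficient_32:
  assumes "coprime n (2 * int p)" "l = 4 \<or> l \<ge> 6"
  shows "2 ^ 5 * int p ^ l * n \<in> S"
proof (rule S_mult[OF _ S_coprime[OF assms(1)]])
  consider "l = 4" | "l = 6" | "l \<ge> 7" using assms(2) by linarith
  thus "2 ^ 5 * int p ^ l \<in> S"
  proof cases
    case 3
    have "2 ^ 5 * int p ^ 4 * int p ^ (l - 4) \<in> S" using 3 by (intro S_mult S_32_p4 S_power_p) auto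
    thus ?thesis using 3 by (simp add: mult.assoc flip: power_add)
  qed (use S_32_p4 S_32_p6 in auto)
qed

text \<open>A further factor 2 or p in n leads to exponents already covered; only n prime to 2p
  calls on \<open>S_32_p5\<close>.\<close>

lemma S_32_p5_mult: assumes "p mod 4 = 1" shows "2 ^ 5 * int p ^ 5 * n \<in> S"
proof (cases "n = 0")
  case False
  obtain k l q where q: "n = 2 ^ k * int p ^ l * q" "coprime q (2 * int p)" by (rule decompose_2_p[OF False]) (rule that)
  have eq: "2 ^ 5 * int p ^ 5 * n = 2 ^ (5 + k) * int p ^ (5 + l) * q" by (simp only: q(1) power_add mult_ac)
  consider "k > 0" | "k = 0" "l > 0" | "k = 0" "l = 0" by blast
  thus ?thesis
  proof cases
    case 1
    thus ?thesis unfolding eq by (intro S_sufficient q) auto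
  next
    case 2
    hence "2 ^ 5 * int p ^ (5 + l) * q \<in> S" by (intro S_sufficient_32 q) auto
    thus ?thesis unfolding eq using 2 by simp
  next
    case 3
    thus ?thesis using S_mult[OF S_32_p5[OF assms] S_coprime[OF q(2)]] q(1) by simp
  qed
qed (simp add: S_zero)

text \<open>For odd n the exponent 3 + l is covered already except for l = 2, where 5 = 1 mod 4
  gives the multiples of 2^5 p^5, and l = 0, where 4000 = 2^5 5^3 enters.\<close>

lemma S_32_p3_mult: assumes "p = 5" shows "2 ^ 5 * int p ^ 3 * n \<in> S"
proof (cases "n = 0")
  case False
  obtain k l q where q: "n = 2 ^ k * int p ^ l * q" "coprime q (2 * int p)" by (rule decompose_2_p[OF False]) (rule that)
  have eq: "2 ^ 5 * int p ^ 3 * n = 2 ^ (5 + k) * int p ^ (3 + l) * q" by (simp only: q(1) power_add mult_ac)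
  consider "k > 0" | "k = 0" "l = 1 \<or> l \<ge> 3" | "k = 0" "l = 2" | "k = 0" "l = 0" by linarith
  thus ?thesis
  proof cases
    case 1
    thus ?thesis unfolding eq by (intro S_sufficient q) auto
  next
    case 2
    hence "2 ^ 5 * int p ^ (3 + l) * q \<in> S" by (intro S_sufficient_32 q) auto
    thus ?thesis unfolding eq using 2 by simp
  next
    case 3
    have "2 ^ 5 * int p ^ 5 * q \<in> S" by (rule S_32_p5_mult) (simp add: assms)
    thus ?thesis unfolding eq using 3 by simp
  next
    case 4
    have "4000 \<in> S" using S_uminus[OF S_4000[OF assms]] by simp
    hence "4000 * q \<in> S" using S_coprime[OF q(2)] by (rule S_mult)
    moreover have "2 ^ 5 * int p ^ 3 * n = 4000 * q" using 4 q(1) by (simp add: assms)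
    ultimately show ?thesis by (simp only:)
  qed
qed (simp add: S_zero)

lemma half_p_sq_plus_1: "2 * (((int p)\<^sup>2 + 1) div 2) = (int p)\<^sup>2 + 1"
  by (rule dvd_mult_div_cancel) (use odd_p in simp)

end

theorem theorem2:
  fixes p :: nat
  assumes "prime p" and "odd p"
  defines "S \<equiv> det_values (dicyclic p)"
  defines "P \<equiv> int p"
  shows
    "(\<forall>d\<in>S. d = 0 \<or> (\<exists>k l m. d = 2 ^ k * P ^ l * m \<and> coprime m (2 * P)
          \<and> (k = 0 \<or> k \<ge> 4) \<and> (l = 0 \<or> l \<ge> 3)))
   \<and> (\<forall>k l m. coprime m (2 * P) \<and> (l = 0 \<or> l \<ge> 3) \<and> (k = 0 \<or> k = 4 \<or> k \<ge> 6)
          \<longrightarrow> 2 ^ k * P ^ l * m \<in> S)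
   \<and> (\<forall>l m. coprime m (2 * P) \<and> (l = 4 \<or> l \<ge> 6) \<longrightarrow> 2 ^ 5 * P ^ l * m \<in> S)
   \<and> (\<forall>m. coprime m (2 * P) \<and> 2 ^ 5 * m \<in> S \<longrightarrow> 2 * \<bar>m\<bar> \<ge> P ^ 2 + 1)
   \<and> 2 ^ 5 * ((P ^ 2 + 1) div 2) \<in> S
   \<and> (p mod 4 = 3 \<longrightarrow>
        (\<forall>m. coprime m (2 * P) \<and> (2 ^ 5 * P ^ 3 * m \<in> S \<or> 2 ^ 5 * P ^ 5 * m \<in> S)
              \<longrightarrow> 2 * \<bar>m\<bar> \<ge> P ^ 2 + 1)
        \<and> (\<exists>s\<in>{1, -1}. s * 2 ^ 5 * P ^ 3 * ((P ^ 2 + 1) div 2) \<in> S)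
        \<and> (\<exists>s\<in>{1, -1}. s * 2 ^ 5 * P ^ 5 * ((P ^ 2 + 1) div 2) \<in> S))
   \<and> (p mod 4 = 1 \<longrightarrow> (\<forall>m. 2 ^ 5 * P ^ 5 * m \<in> S))
   \<and> (p = 5 \<longrightarrow> (\<forall>m. 2 ^ 5 * P ^ 3 * m \<in> S))"
proof -
  interpret prime_roots p by unfold_locales (rule assms)+
  define H where "H = (P ^ 2 + 1) div 2"
  have H: "2 * H = P ^ 2 + 1" unfolding H_def P_def by (rule half_p_sq_plus_1)
  show ?thesis
    unfolding S_def P_def H_def[symmetric, unfolded P_def]
  proof (intro conjI ballI allI impI)
    fix d assume d: "d \<in> det_values (dicyclic p)"
    show "d = 0 \<or> (\<exists>k l n. d = 2 ^ k * int p ^ l * n \<and> coprime n (2 * int p) \<and> (k = 0 \<or> 4 \<le> k) \<and> (l = 0 \<or> 3 \<le> l))"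
    proof (cases "d = 0")
      case False
      obtain k l n where n: "d = 2 ^ k * int p ^ l * n" "coprime n (2 * int p)"
        by (rule decompose_2_p[OF False]) (rule that)
      show ?thesis using S_valuations[OF d[unfolded n(1)] n(2)] n by blast
    qed simp
  next
    fix n assume "coprime n (2 * int p) \<and> 2 ^ 5 * n \<in> det_values (dicyclic p)"
    thus "(int p)\<^sup>2 + 1 \<le> 2 * \<bar>n\<bar>" using S_32_lower_bound[of n 0] by simp
  next
    have "16 * (2 * H) \<in> det_values (dicyclic p)"
      using S_16_mult_p_sq_plus_1 unfolding H P_def by simp
    thus "2 ^ 5 * H \<in> det_values (dicyclic p)" by simp
  next
    fix n assume "p mod 4 = 3"
      and "coprime n (2 * int p) \<and> (2 ^ 5 * int p ^ 3 * n \<in> det_values (dicyclic p) \<or> 2 ^ 5 * int p ^ 5 * n \<in> det_values (dicyclic p))"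
    thus "(int p)\<^sup>2 + 1 \<le> 2 * \<bar>n\<bar>" using S_32_lower_bound[of n 3] S_32_lower_bound[of n 5] by blast
  next
    assume p3: "p mod 4 = 3"
    have "\<exists>s\<in>{1, - 1}. s * (16 * int p ^ 3 * q * (2 * H)) \<in> det_values (dicyclic p)" for q
      using S_p_3_mod_4[OF p3, of q] unfolding H P_def .
    \<comment> \<open>The choices q = 1 and q = p^2 give the exponents 3 and 5 of p.\<close>
    note * = this[of 1] this[of "(int p)\<^sup>2"]
    have eq: "s * 2 ^ 5 * int p ^ 3 * H = s * (16 * int p ^ 3 * 1 * (2 * H))"
      "s * 2 ^ 5 * int p ^ 5 * H = s * (16 * int p ^ 3 * (int p)\<^sup>2 * (2 * H))" for s
      by (simp_all add: eval_nat_numeral)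
    show "\<exists>s\<in>{1, - 1}. s * 2 ^ 5 * int p ^ 3 * H \<in> det_values (dicyclic p)"
      "\<exists>s\<in>{1, - 1}. s * 2 ^ 5 * int p ^ 5 * H \<in> det_values (dicyclic p)"
      unfolding eq by (rule *)+
  qed (use S_sufficient S_sufficient_32 S_32_p5_mult S_32_p3_mult in blast)+
qed

end
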